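(* Let $\mathrm S$ be a dependent type theory with identity types and discrete identity types. The category $\mathcal C_{\mathrm S}$ of contexts in $\mathrm S$ may be extended to a locally groupoidal $2$-category $\mathfrak C_{\mathrm S}$ (i.e. one in which every $2$-cell is invertible) whose $2$-cells $\alpha\colon f\Rightarrow g\colon\Gamma\to\Delta$ are judgements $x:\Gamma\vdash\alpha(x):\mathrm{Id}_\Delta(fx,gx)$.
   Context: **Type theory.** $\mathrm S$ is a dependent type theory with the four judgement forms $A\ \mathsf{type}$, $a:A$, $A=B\ \mathsf{type}$, $a=b:A$ (the last two are definitional equality), made relative to contexts $\Gamma=(x_1:A_1,\dots,x_n:A_n)$ with each $A_i$ a type in context $(x_1:A_1,\dots,x_{i-1}:A_{i-1})$. It has the equality rules (definitional equality is a congruence) and the structural rules (weakening, contraction, exchange, substitution). Every rule is read relative to an arbitrary ambient context and every operation is stable under substitution in it. Furthermore $\mathrm S$ has: - identity types: from $a,b:A$ form $\mathrm{Id}_A(a,b)$; $\mathrm r(a):\mathrm{Id}_A(a,a)$; from $x,y:A,\,p:\mathrm{Id}_A(x,y),\,\Delta\vdash C(x,y,p)\ \mathsf{type}$ and $x:A,\,\Delta[x,x,\mathrm r(x)/x,y,p]\vdash d(x):C(x,x,\mathrm r(x))$ infer $x,y:A,\,p:\mathrm{Id}_A(x,y),\,\Delta\vdash\mathrm J_d(x,y,p):C(x,y,p)$, with $\mathrm J_d(x,x,\mathrm r(x))=d(x)$; - discrete identity types: if $p,q:\mathrm{Id}_A(a,b)$ and $\alpha:\mathrm{Id}_{\mathrm{Id}_A(a,b)}(p,q)$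 then $p=q$ and $\alpha=\mathrm r(p)$ definitionally. Vector notation is used: an element $a:\Gamma$ of a context is a list of terms of the successive types, and $x:\Gamma\vdash\Delta(x)\ \mathsf{ctxt}$ denotes a telescope over $\Gamma$. All categorical structures built from the syntax are taken modulo $\alpha$-conversion and definitional equality. **Category of contexts $\mathcal C_{\mathrm S}$.** Objects: contexts; morphisms $\Gamma\to\Delta$: judgements $x:\Gamma\vdash f(x):\Delta$; composition is substitution, and the identity on $\Gamma$ is $x:\Gamma\vdash x:\Gamma$. **Identity contexts.** The identity rules extend from types to contexts by induction on length. For a single type, elimination into a context $\Theta=(u:\Lambda,v:D(u))$ is componentwise: from $d=(d_1,d_2)$ form $\mathrm J_{d_1}$, then $\mathrm J_{d_2}$ eliminating into $D(x,y,p,\mathrm J_{d_1}(x,y,p))$. For the empty context, $\mathrm{Id}_{()}=()$ and $\mathrm J_d=d$. For $\Phi=(x:\Lambda,y:D(x))$: transport $p^*(z):\Upsilon(x)$ for $x:\Lambda\vdash\Upsilon(x)\ \mathsf{ctxt}$, $p:\mathrm{Id}_\Lambda(x,x')$, $z:\Upsilon(x')$ is defined by $\mathrm{Id}_\Lambda$-elimination from $\mathrm r(x)^*(z)=z$; $\mathrm{Id}_\Phi((x,y),(x',y')):=(p:\mathrm{Id}_\Lambda(x,x'),\,q:\mathrm{Id}_{D(x)}(y,p^*y'))$; $\mathrm r(x,y):=(\mathrm r(x),\mathrm r(y))$; elimination for $\mathrm{Id}_\Phi$ is obtained by first applying elimination for $\mathrm{Id}_{D(x)}$ to $d$, giving $d'(x,y,y',q)$,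 and then applying $\mathrm{Id}_\Lambda$-elimination with post-context $(y,y',q)$ to $d'$. *)

theory Defs
  imports Main
begin

section \<open>Raw syntax\<close>

text \<open>
  Types and terms share one sort of raw expressions with de Bruijn indices, so
  \<open>\<alpha>\<close>-conversion is syntactic identity. An argument \<open>(k, e)\<close> of an operator binds \<open>k\<close>
  variables in \<open>e\<close>. The type \<open>'f\<close> supplies whatever further symbols the type theory has.
\<close>

datatype 'f symb = IdSym | ReflSym | JSym | Symb 'f

datatype 'f expr = Var nat | Op "'f symb" "(nat \<times> 'f expr) list"

fun scoped :: "nat \<Rightarrow> 'f expr \<Rightarrow> bool" where
  "scoped n (Var i) \<longleftrightarrow> i < n"
| "scoped n (Op c es) \<longleftrightarrow> (\<forall>(k, e) \<in> set es. scoped (n + k) e)"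

fun ren :: "(nat \<Rightarrow> nat) \<Rightarrow> 'f expr \<Rightarrow> 'f expr" where
  "ren \<rho> (Var i) = Var (\<rho> i)"
| "ren \<rho> (Op c es) =
    Op c (map (\<lambda>(k, e). (k, ren (\<lambda>i. if i < k then i else \<rho> (i - k) + k) e)) es)"

definition wk :: "nat \<Rightarrow> 'f expr \<Rightarrow> 'f expr" where
  "wk n = ren (\<lambda>i. i + n)"

definition lift :: "nat \<Rightarrow> (nat \<Rightarrow> 'f expr) \<Rightarrow> nat \<Rightarrow> 'f expr" where
  "lift k \<sigma> i = (if i < k then Var i else wk k (\<sigma> (i - k)))"

fun subst :: "(nat \<Rightarrow> 'f expr) \<Rightarrow> 'f expr \<Rightarrow> 'f expr" where
  "subst \<sigma> (Var i) = \<sigma> i"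
| "subst \<sigma> (Op c es) = Op c (map (\<lambda>(k, e). (k, subst (lift k \<sigma>) e)) es)"

text \<open>
  Contexts and telescopes list their most recent entry first: \<open>A # \<Gamma>\<close> is \<open>\<Gamma>, x : A\<close>, and a
  telescope \<open>\<Delta>\<close> over \<open>\<Gamma>\<close> yields the context \<open>\<Delta> @ \<Gamma>\<close>. Elements of contexts are listed in
  the same order.
\<close>

type_synonym 'f ctx = "'f expr list"

fun subst_tele :: "(nat \<Rightarrow> 'f expr) \<Rightarrow> 'f ctx \<Rightarrow> 'f ctx" where
  "subst_tele \<sigma> [] = []"
| "subst_tele \<sigma> (A # \<Delta>) = subst (lift (length \<Delta>) \<sigma>) A # subst_tele \<sigma> \<Delta>"

text \<open>
  \<open>inst m ts\<close> takes expressions over \<open>\<Gamma>, \<Theta>\<close> to expressions over \<open>\<Gamma>, \<Xi>\<close>, where \<open>\<Xi>\<close> has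
  length \<open>m\<close>, replacing the variables of \<open>\<Theta>\<close> by the entries of \<open>ts\<close> (which live over
  \<open>\<Gamma>, \<Xi>\<close>) and fixing those of \<open>\<Gamma>\<close>.
\<close>

definition inst :: "nat \<Rightarrow> 'f expr list \<Rightarrow> nat \<Rightarrow> 'f expr" where
  "inst m ts i = (if i < length ts then ts ! i else Var (i - length ts + m))"

definition vars :: "nat \<Rightarrow> nat \<Rightarrow> 'f expr list" where
  "vars k n = map Var [k..<k + n]"

definition Id :: "'f expr \<Rightarrow> 'f expr \<Rightarrow> 'f expr \<Rightarrow> 'f expr" where
  "Id A a b = Op IdSym [(0, A), (0, a), (0, b)]"

definition Refl :: "'f expr \<Rightarrow> 'f expr \<Rightarrow> 'f expr" where
  "Refl A a = Op ReflSym [(0, A), (0, a)]"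

fun tele_args :: "nat \<Rightarrow> 'f ctx \<Rightarrow> (nat \<times> 'f expr) list" where
  "tele_args k [] = []"
| "tele_args k (A # \<Delta>) = (k + length \<Delta>, A) # tele_args k \<Delta>"

text \<open>
  The eliminator applied to arguments \<open>a\<close>, \<open>b\<close>, \<open>p\<close> and an instance \<open>es\<close> of the post-context
  \<open>\<Delta>\<close>. The data on which the notation \<open>J\<^sub>d\<close> tacitly depends (\<open>A\<close>, \<open>\<Delta>\<close> and the motive \<open>C\<close>)
  are recorded in the term: if they were dropped, eliminations into different motives with
  the same \<open>d\<close> would be identified.
\<close>

definition J :: "'f expr \<Rightarrow> 'f ctx \<Rightarrow> 'f expr \<Rightarrow> 'f expr \<Rightarrow>
    'f expr \<Rightarrow> 'f expr \<Rightarrow> 'f expr \<Rightarrow> 'f expr list \<Rightarrow> 'f expr" where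
  "J A \<Delta> C d a b p es = Op JSym
    ([(0, A)] @ tele_args 3 \<Delta> @ [(length \<Delta> + 3, C), (length \<Delta> + 1, d), (0, a), (0, b), (0, p)]
     @ map (Pair 0) es)"

text \<open>The generic instance, over \<open>x, y : A, p : Id\<^sub>A(x, y), \<Delta>\<close>.\<close>

definition J_gen :: "'f expr \<Rightarrow> 'f ctx \<Rightarrow> 'f expr \<Rightarrow> 'f expr \<Rightarrow> 'f expr" where
  "J_gen A \<Delta> C d =
    (let m = length \<Delta>; \<sigma> = (\<lambda>i. Var (i + (m + 3))) in
      J (subst \<sigma> A) (subst_tele (lift 3 \<sigma>) \<Delta>) (subst (lift (m + 3) \<sigma>) C)
        (subst (lift (m + 1) \<sigma>) d) (Var (m + 2)) (Var (m + 1)) (Var m) (vars 0 m))"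

text \<open>The context \<open>\<Gamma>, x, y : A, p : Id\<^sub>A(x, y)\<close>.\<close>

definition Id_ext :: "'f ctx \<Rightarrow> 'f expr \<Rightarrow> 'f ctx" where
  "Id_ext \<Gamma> A = Id (wk 2 A) (Var 1) (Var 0) # wk 1 A # A # \<Gamma>"

text \<open>The substitution \<open>[x, x, r(x) / x, y, p]\<close>.\<close>

definition diag :: "'f expr \<Rightarrow> nat \<Rightarrow> 'f expr" where
  "diag A = inst 1 [Refl (wk 1 A) (Var 0), Var 0, Var 0]"


section \<open>Dependent type theories\<close>

text \<open>
  A type theory is given by its derivable judgements
  \<open>\<Gamma> \<turnstile> A type\<close>, \<open>\<Gamma> \<turnstile> a : A\<close>, \<open>\<Gamma> \<turnstile> A = B type\<close>, \<open>\<Gamma> \<turnstile> a = b : A\<close>; it may be closed under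
  further rules beyond those required below.
\<close>

record 'f judgements =
  is_type :: "'f ctx \<Rightarrow> 'f expr \<Rightarrow> bool"
  has_type :: "'f ctx \<Rightarrow> 'f expr \<Rightarrow> 'f expr \<Rightarrow> bool"
  eq_type :: "'f ctx \<Rightarrow> 'f expr \<Rightarrow> 'f expr \<Rightarrow> bool"
  eq_term :: "'f ctx \<Rightarrow> 'f expr \<Rightarrow> 'f expr \<Rightarrow> 'f expr \<Rightarrow> bool"

fun is_ctx :: "'f judgements \<Rightarrow> 'f ctx \<Rightarrow> bool" where
  "is_ctx S [] \<longleftrightarrow> True"
| "is_ctx S (A # \<Gamma>) \<longleftrightarrow> is_ctx S \<Gamma> \<and> is_type S \<Gamma> A"

text \<open>Definitional equality of telescopes over \<open>\<Gamma>\<close>; for \<open>\<Gamma> = []\<close>, of contexts.\<close>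

fun eq_tele :: "'f judgements \<Rightarrow> 'f ctx \<Rightarrow> 'f ctx \<Rightarrow> 'f ctx \<Rightarrow> bool" where
  "eq_tele S \<Gamma> [] [] \<longleftrightarrow> True"
| "eq_tele S \<Gamma> (A # \<Delta>) (B # \<Delta>') \<longleftrightarrow> eq_tele S \<Gamma> \<Delta> \<Delta>' \<and> eq_type S (\<Delta> @ \<Gamma>) A B"
| "eq_tele S \<Gamma> _ _ \<longleftrightarrow> False"

text \<open>
  Elements of a telescope \<open>\<Delta>\<close> over \<open>\<Gamma>\<close>, and their definitional equality. A closed context
  \<open>\<Delta>\<close> is a telescope over any \<open>\<Gamma>\<close>, and then this is the judgement \<open>x : \<Gamma> \<turnstile> f(x) : \<Delta>\<close>.
\<close>

fun elem :: "'f judgements \<Rightarrow> 'f ctx \<Rightarrow> 'f expr list \<Rightarrow> 'f ctx \<Rightarrow> bool" where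
  "elem S \<Gamma> [] [] \<longleftrightarrow> True"
| "elem S \<Gamma> (t # ts) (A # \<Delta>) \<longleftrightarrow> elem S \<Gamma> ts \<Delta> \<and> has_type S \<Gamma> t (subst (inst 0 ts) A)"
| "elem S \<Gamma> _ _ \<longleftrightarrow> False"

fun eq_elem :: "'f judgements \<Rightarrow> 'f ctx \<Rightarrow> 'f expr list \<Rightarrow> 'f expr list \<Rightarrow> 'f ctx \<Rightarrow> bool" where
  "eq_elem S \<Gamma> [] [] [] \<longleftrightarrow> True"
| "eq_elem S \<Gamma> (t # ts) (u # us) (A # \<Delta>) \<longleftrightarrow>
    eq_elem S \<Gamma> ts us \<Delta> \<and> eq_term S \<Gamma> t u (subst (inst 0 ts) A)"
| "eq_elem S \<Gamma> _ _ _ \<longleftrightarrow> False"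

text \<open>
  The structural rules are stated through simultaneous substitution along \<open>\<Gamma> \<turnstile> f : \<Delta>\<close>.
  With the variable rule this gives weakening, contraction, exchange and substitution of a
  single term, also in the presence of later variables, and it follows from them.
\<close>

locale dependent_type_theory =
  fixes S :: "'f judgements"
  assumes type_presup: "is_type S \<Gamma> A \<Longrightarrow> is_ctx S \<Gamma> \<and> scoped (length \<Gamma>) A"
    and term_presup: "has_type S \<Gamma> a A \<Longrightarrow> is_type S \<Gamma> A \<and> scoped (length \<Gamma>) a"
    and eq_type_presup: "eq_type S \<Gamma> A B \<Longrightarrow> is_type S \<Gamma> A \<and> is_type S \<Gamma> B"
    and eq_term_presup: "eq_term S \<Gamma> a b A \<Longrightarrow> has_type S \<Gamma> a A \<and> has_type S \<Gamma> b A"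
    and eq_type_refl: "is_type S \<Gamma> A \<Longrightarrow> eq_type S \<Gamma> A A"
    and eq_type_sym: "eq_type S \<Gamma> A B \<Longrightarrow> eq_type S \<Gamma> B A"
    and eq_type_trans: "eq_type S \<Gamma> A B \<Longrightarrow> eq_type S \<Gamma> B C \<Longrightarrow> eq_type S \<Gamma> A C"
    and eq_term_refl: "has_type S \<Gamma> a A \<Longrightarrow> eq_term S \<Gamma> a a A"
    and eq_term_sym: "eq_term S \<Gamma> a b A \<Longrightarrow> eq_term S \<Gamma> b a A"
    and eq_term_trans: "eq_term S \<Gamma> a b A \<Longrightarrow> eq_term S \<Gamma> b c A \<Longrightarrow> eq_term S \<Gamma> a c A"
    and conv_term: "has_type S \<Gamma> a A \<Longrightarrow> eq_type S \<Gamma> A B \<Longrightarrow> has_type S \<Gamma> a B"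
    and conv_eq_term: "eq_term S \<Gamma> a b A \<Longrightarrow> eq_type S \<Gamma> A B \<Longrightarrow> eq_term S \<Gamma> a b B"
    and var: "is_ctx S \<Gamma> \<Longrightarrow> i < length \<Gamma> \<Longrightarrow> has_type S \<Gamma> (Var i) (wk (Suc i) (\<Gamma> ! i))"
    and subst_type: "is_ctx S \<Gamma> \<Longrightarrow> elem S \<Gamma> f \<Delta> \<Longrightarrow> is_type S \<Delta> A \<Longrightarrow>
      is_type S \<Gamma> (subst (inst 0 f) A)"
    and subst_term: "is_ctx S \<Gamma> \<Longrightarrow> elem S \<Gamma> f \<Delta> \<Longrightarrow> has_type S \<Delta> a A \<Longrightarrow>
      has_type S \<Gamma> (subst (inst 0 f) a) (subst (inst 0 f) A)"
    and subst_eq_type: "is_ctx S \<Gamma> \<Longrightarrow> elem S \<Gamma> f \<Delta> \<Longrightarrow> eq_type S \<Delta> A B \<Longrightarrow>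
      eq_type S \<Gamma> (subst (inst 0 f) A) (subst (inst 0 f) B)"
    and subst_eq_term: "is_ctx S \<Gamma> \<Longrightarrow> elem S \<Gamma> f \<Delta> \<Longrightarrow> eq_term S \<Delta> a b A \<Longrightarrow>
      eq_term S \<Gamma> (subst (inst 0 f) a) (subst (inst 0 f) b) (subst (inst 0 f) A)"
    and cong_type: "is_ctx S \<Gamma> \<Longrightarrow> eq_elem S \<Gamma> f g \<Delta> \<Longrightarrow> is_type S \<Delta> A \<Longrightarrow>
      eq_type S \<Gamma> (subst (inst 0 f) A) (subst (inst 0 g) A)"
    and cong_term: "is_ctx S \<Gamma> \<Longrightarrow> eq_elem S \<Gamma> f g \<Delta> \<Longrightarrow> has_type S \<Delta> a A \<Longrightarrow>
      eq_term S \<Gamma> (subst (inst 0 f) a) (subst (inst 0 g) a) (subst (inst 0 f) A)"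

locale identity_type_theory = dependent_type_theory +
  assumes Id_form: "is_type S \<Gamma> A \<Longrightarrow> has_type S \<Gamma> a A \<Longrightarrow> has_type S \<Gamma> b A \<Longrightarrow>
      is_type S \<Gamma> (Id A a b)"
    and Id_intro: "has_type S \<Gamma> a A \<Longrightarrow> has_type S \<Gamma> (Refl A a) (Id A a a)"
    and Id_elim: "is_type S (\<Delta> @ Id_ext \<Gamma> A) C \<Longrightarrow>
      has_type S (subst_tele (diag A) \<Delta> @ A # \<Gamma>) d (subst (lift (length \<Delta>) (diag A)) C) \<Longrightarrow>
      has_type S (\<Delta> @ Id_ext \<Gamma> A) (J_gen A \<Delta> C d) C"
    and Id_comp: "is_type S (\<Delta> @ Id_ext \<Gamma> A) C \<Longrightarrow>
      has_type S (subst_tele (diag A) \<Delta> @ A # \<Gamma>) d (subst (lift (length \<Delta>) (diag A)) C) \<Longrightarrow>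
      eq_term S (subst_tele (diag A) \<Delta> @ A # \<Gamma>)
        (subst (lift (length \<Delta>) (diag A)) (J_gen A \<Delta> C d)) d
        (subst (lift (length \<Delta>) (diag A)) C)"
    and Id_cong: "eq_type S \<Gamma> A A' \<Longrightarrow> eq_term S \<Gamma> a a' A \<Longrightarrow> eq_term S \<Gamma> b b' A \<Longrightarrow>
      eq_type S \<Gamma> (Id A a b) (Id A' a' b')"
    and Refl_cong: "eq_type S \<Gamma> A A' \<Longrightarrow> eq_term S \<Gamma> a a' A \<Longrightarrow>
      eq_term S \<Gamma> (Refl A a) (Refl A' a') (Id A a a)"
    and J_cong: "eq_type S \<Gamma> A A' \<Longrightarrow> eq_tele S (Id_ext \<Gamma> A) \<Delta> \<Delta>' \<Longrightarrow>
      eq_type S (\<Delta> @ Id_ext \<Gamma> A) C C' \<Longrightarrow>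
      eq_term S (subst_tele (diag A) \<Delta> @ A # \<Gamma>) d d' (subst (lift (length \<Delta>) (diag A)) C) \<Longrightarrow>
      eq_term S (\<Delta> @ Id_ext \<Gamma> A) (J_gen A \<Delta> C d) (J_gen A' \<Delta>' C' d') C"

locale discrete_identity_type_theory = identity_type_theory +
  assumes discrete: "has_type S \<Gamma> p (Id A a b) \<Longrightarrow> has_type S \<Gamma> q (Id A a b) \<Longrightarrow>
      has_type S \<Gamma> \<alpha> (Id (Id A a b) p q) \<Longrightarrow>
      eq_term S \<Gamma> p q (Id A a b) \<and>
      eq_term S \<Gamma> \<alpha> (Refl (Id A a b) p) (Id (Id A a b) p q)"


section \<open>Identity contexts\<close>

text \<open>\<open>r(x)\<close> for \<open>x : \<Lambda>\<close>, over \<open>x : \<Lambda>\<close>.\<close>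

fun refl_ctx :: "'f ctx \<Rightarrow> 'f expr list" where
  "refl_ctx [] = []"
| "refl_ctx (D # \<Lambda>) = Refl (wk 1 D) (Var 0) # map (wk 1) (refl_ctx \<Lambda>)"

text \<open>
  \<open>J_ctx \<Lambda> \<Delta> C d\<close> is \<open>J\<^sub>d(x, y, p) : C(x, y, p)\<close> over \<open>x, y : \<Lambda>, p : Id\<^sub>\<Lambda>(x, y), \<Delta>\<close>, where
  \<open>\<Delta>\<close> and \<open>C\<close> are over \<open>x, y : \<Lambda>, p : Id\<^sub>\<Lambda>(x, y)\<close> (and \<open>\<Delta>\<close>), and \<open>d\<close> is over
  \<open>x : \<Lambda>, \<Delta>[x, x, r(x) / x, y, p]\<close>. In the step for \<open>\<Phi> = (x : \<Lambda>, y : D(x))\<close>: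
  \<^item> \<open>trD\<close>, named \<open>transport \<Lambda> D\<close> below, is \<open>p\<^sup>*(z) : D(x)\<close> over \<open>x, x' : \<Lambda>, p : Id\<^sub>\<Lambda>(x, x'), z : D(x')\<close>;
  \<^item> \<open>\<delta>\<close> goes from \<open>(x, y), (x', y'), (p, q) : Id\<^sub>\<Phi>\<close> to \<open>x : \<Lambda>, y, y' : D(x), q : Id(y, y')\<close>,
    putting \<open>x' = x\<close> and \<open>p = r(x)\<close>, and \<open>d'\<close> is the elimination of \<open>q\<close>;
  \<^item> \<open>\<omega>\<close> goes from \<open>(x, y), (x', y'), (p, q)\<close> to \<open>x, x', p, y, y', q\<close>, that is to \<open>\<Lambda>\<close>'s identity
    context followed by \<open>y, y', q\<close> as start of the post-context, and \<open>\<nu>\<close> goes back.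
\<close>

fun J_ctx :: "'f ctx \<Rightarrow> 'f ctx \<Rightarrow> 'f expr \<Rightarrow> 'f expr \<Rightarrow> 'f expr" where
  "J_ctx [] \<Delta> C d = d"
| "J_ctx (D # \<Lambda>) \<Delta> C d =
    (let n = length \<Lambda>; m = length \<Delta>;
         trD = J_ctx \<Lambda> [subst (inst (3 * n) (vars n n)) D]
                 (subst (inst (3 * n + 1) (vars (2 * n + 1) n)) D) (Var 0);
         \<delta> = inst (n + 3) (Var 0 # map (wk 3) (refl_ctx \<Lambda>) @ Var 1 # vars 3 n @ Var 2 # vars 3 n);
         d' = J_gen D (subst_tele \<delta> \<Delta>) (subst (lift m \<delta>) C) d;
         \<omega> = inst (3 * n + 3)
               (Var 0 # vars 3 n @ Var 1 # vars (n + 3) n @ Var 2 # vars (2 * n + 3) n);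
         Y = subst (inst (3 * n) (vars (2 * n) n)) D;
         Y' = subst (inst (3 * n + 1) (vars (n + 1) n)) D;
         Q = Id (subst (inst (3 * n + 2) (vars (2 * n + 2) n)) D) (Var 1)
               (subst (inst (3 * n + 2)
                  (Var 0 # vars 2 n @ vars (n + 2) n @ vars (2 * n + 2) n)) trD);
         \<nu> = inst (3 * n + 3)
               (Var 0 # Var (n + 1) # Var (2 * n + 2) #
                vars 1 n @ vars (n + 2) n @ vars (2 * n + 3) n)
     in subst (lift m \<nu>) (J_ctx \<Lambda> (subst_tele \<omega> \<Delta> @ [Q, Y', Y]) (subst (lift m \<omega>) C) d'))"

text \<open>\<open>p\<^sup>*(z) : D(x)\<close> over \<open>x, x' : \<Lambda>, p : Id\<^sub>\<Lambda>(x, x'), z : D(x')\<close>.\<close>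

definition transport :: "'f ctx \<Rightarrow> 'f expr \<Rightarrow> 'f expr" where
  "transport \<Lambda> D = (let n = length \<Lambda> in
    J_ctx \<Lambda> [subst (inst (3 * n) (vars n n)) D]
      (subst (inst (3 * n + 1) (vars (2 * n + 1) n)) D) (Var 0))"

text \<open>\<open>Id\<^sub>\<Phi>(u, u')\<close> as a telescope over \<open>u, u' : \<Phi>\<close>.\<close>

fun Id_ctx_gen :: "'f ctx \<Rightarrow> 'f ctx" where
  "Id_ctx_gen [] = []"
| "Id_ctx_gen (D # \<Lambda>) =
    (let n = length \<Lambda> in
      Id (subst (inst (3 * n + 2) (vars (2 * n + 2) n)) D) (Var (2 * n + 1))
        (subst (inst (3 * n + 2) (Var n # vars 0 n @ vars (n + 1) n @ vars (2 * n + 2) n))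
          (transport \<Lambda> D))
      # subst_tele (inst (2 * n + 2) (vars 1 n @ vars (n + 2) n)) (Id_ctx_gen \<Lambda>))"

definition Id_ctx :: "'f ctx \<Rightarrow> 'f expr list \<Rightarrow> 'f expr list \<Rightarrow> 'f ctx" where
  "Id_ctx \<Delta> f g = subst_tele (inst 0 (g @ f)) (Id_ctx_gen \<Delta>)"


section \<open>Locally groupoidal 2-categories\<close>

locale category =
  fixes Ob :: "'o set" and Ar :: "'a set"
    and dom cod :: "'a \<Rightarrow> 'o" and ide :: "'o \<Rightarrow> 'a" and cmp :: "'a \<Rightarrow> 'a \<Rightarrow> 'a"
  assumes dom_Ob: "f \<in> Ar \<Longrightarrow> dom f \<in> Ob"
    and cod_Ob: "f \<in> Ar \<Longrightarrow> cod f \<in> Ob"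
    and ide_Ar: "x \<in> Ob \<Longrightarrow> ide x \<in> Ar \<and> dom (ide x) = x \<and> cod (ide x) = x"
    and cmp_Ar: "f \<in> Ar \<Longrightarrow> g \<in> Ar \<Longrightarrow> dom g = cod f \<Longrightarrow>
      cmp g f \<in> Ar \<and> dom (cmp g f) = dom f \<and> cod (cmp g f) = cod g"
    and cmp_ide_right: "f \<in> Ar \<Longrightarrow> cmp f (ide (dom f)) = f"
    and cmp_ide_left: "f \<in> Ar \<Longrightarrow> cmp (ide (cod f)) f = f"
    and cmp_assoc: "f \<in> Ar \<Longrightarrow> g \<in> Ar \<Longrightarrow> h \<in> Ar \<Longrightarrow> dom g = cod f \<Longrightarrow> dom h = cod g \<Longrightarrow>
      cmp h (cmp g f) = cmp (cmp h g) f"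

text \<open>
  A strict 2-category extending the category \<open>(Ob, Ar, dom, cod, ide, cmp)\<close>: 2-cells \<open>Ce\<close> with
  source and target 1-cells \<open>src\<close>, \<open>tgt\<close>, identities \<open>vide\<close>, vertical composition \<open>vcmp\<close>
  (making up the hom-categories) and horizontal composition \<open>hcmp\<close>.
\<close>

locale two_category = category Ob Ar dom cod ide cmp + vert: category Ar Ce src tgt vide vcmp
  for Ob :: "'o set" and Ar :: "'a set"
    and dom cod :: "'a \<Rightarrow> 'o" and ide :: "'o \<Rightarrow> 'a" and cmp :: "'a \<Rightarrow> 'a \<Rightarrow> 'a"
    and Ce :: "'c set" and src tgt :: "'c \<Rightarrow> 'a"
    and vide :: "'a \<Rightarrow> 'c" and vcmp :: "'c \<Rightarrow> 'c \<Rightarrow> 'c" +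
  fixes hcmp :: "'c \<Rightarrow> 'c \<Rightarrow> 'c"
  assumes parallel: "\<alpha> \<in> Ce \<Longrightarrow> dom (src \<alpha>) = dom (tgt \<alpha>) \<and> cod (src \<alpha>) = cod (tgt \<alpha>)"
    and hcmp_Ce: "\<alpha> \<in> Ce \<Longrightarrow> \<beta> \<in> Ce \<Longrightarrow> dom (src \<beta>) = cod (src \<alpha>) \<Longrightarrow>
      hcmp \<beta> \<alpha> \<in> Ce \<and> src (hcmp \<beta> \<alpha>) = cmp (src \<beta>) (src \<alpha>) \<and>
      tgt (hcmp \<beta> \<alpha>) = cmp (tgt \<beta>) (tgt \<alpha>)"
    and hcmp_ide_right: "\<alpha> \<in> Ce \<Longrightarrow> hcmp \<alpha> (vide (ide (dom (src \<alpha>)))) = \<alpha>"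
    and hcmp_ide_left: "\<alpha> \<in> Ce \<Longrightarrow> hcmp (vide (ide (cod (src \<alpha>)))) \<alpha> = \<alpha>"
    and hcmp_assoc: "\<alpha> \<in> Ce \<Longrightarrow> \<beta> \<in> Ce \<Longrightarrow> \<gamma> \<in> Ce \<Longrightarrow>
      dom (src \<beta>) = cod (src \<alpha>) \<Longrightarrow> dom (src \<gamma>) = cod (src \<beta>) \<Longrightarrow>
      hcmp \<gamma> (hcmp \<beta> \<alpha>) = hcmp (hcmp \<gamma> \<beta>) \<alpha>"
    and hcmp_vide: "f \<in> Ar \<Longrightarrow> g \<in> Ar \<Longrightarrow> dom g = cod f \<Longrightarrow>
      hcmp (vide g) (vide f) = vide (cmp g f)"
    and interchange: "\<alpha> \<in> Ce \<Longrightarrow> \<alpha>' \<in> Ce \<Longrightarrow> \<beta> \<in> Ce \<Longrightarrow> \<beta>' \<in> Ce \<Longrightarrow>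
      src \<alpha>' = tgt \<alpha> \<Longrightarrow> src \<beta>' = tgt \<beta> \<Longrightarrow> dom (src \<beta>) = cod (src \<alpha>) \<Longrightarrow>
      hcmp (vcmp \<beta>' \<beta>) (vcmp \<alpha>' \<alpha>) = vcmp (hcmp \<beta>' \<alpha>') (hcmp \<beta> \<alpha>)"

locale locally_groupoidal_two_category = two_category +
  assumes invertible: "\<alpha> \<in> Ce \<Longrightarrow> \<exists>\<beta>\<in>Ce. src \<beta> = tgt \<alpha> \<and> tgt \<beta> = src \<alpha> \<and>
      vcmp \<beta> \<alpha> = vide (src \<alpha>) \<and> vcmp \<alpha> \<beta> = vide (tgt \<alpha>)"


section \<open>The category of contexts and its 2-cells\<close>

text \<open>
  Objects, arrows and 2-cells are classes of contexts, of morphisms with their source and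
  target, and of 2-cells with their boundary, all modulo definitional equality.
\<close>

type_synonym 'f ctx_mor = "'f ctx \<times> 'f expr list \<times> 'f ctx"
type_synonym 'f ctx_cell = "'f ctx \<times> 'f ctx \<times> 'f expr list \<times> 'f expr list \<times> 'f expr list"

definition ob_rel :: "'f judgements \<Rightarrow> ('f ctx \<times> 'f ctx) set" where
  "ob_rel S = {(\<Gamma>, \<Gamma>'). eq_tele S [] \<Gamma> \<Gamma>'}"

definition objects :: "'f judgements \<Rightarrow> 'f ctx set set" where
  "objects S = {\<Gamma>. is_ctx S \<Gamma>} // ob_rel S"

definition mor_rel :: "'f judgements \<Rightarrow> ('f ctx_mor \<times> 'f ctx_mor) set" where
  "mor_rel S = {((\<Gamma>, f, \<Delta>), (\<Gamma>', f', \<Delta>')).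
    eq_tele S [] \<Gamma> \<Gamma>' \<and> eq_tele S [] \<Delta> \<Delta>' \<and> eq_elem S \<Gamma> f f' \<Delta>}"

definition arrows :: "'f judgements \<Rightarrow> 'f ctx_mor set set" where
  "arrows S = {(\<Gamma>, f, \<Delta>). is_ctx S \<Gamma> \<and> is_ctx S \<Delta> \<and> elem S \<Gamma> f \<Delta>} // mor_rel S"

definition arr_dom :: "'f ctx_mor set \<Rightarrow> 'f ctx set" where
  "arr_dom F = {\<Gamma>. \<exists>f \<Delta>. (\<Gamma>, f, \<Delta>) \<in> F}"

definition arr_cod :: "'f ctx_mor set \<Rightarrow> 'f ctx set" where
  "arr_cod F = {\<Delta>. \<exists>\<Gamma> f. (\<Gamma>, f, \<Delta>) \<in> F}"

definition arr_id :: "'f judgements \<Rightarrow> 'f ctx set \<Rightarrow> 'f ctx_mor set" where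
  "arr_id S X = mor_rel S `` {(\<Gamma>, vars 0 (length \<Gamma>), \<Gamma>) | \<Gamma>. \<Gamma> \<in> X}"

definition arr_comp :: "'f judgements \<Rightarrow> 'f ctx_mor set \<Rightarrow> 'f ctx_mor set \<Rightarrow> 'f ctx_mor set" where
  "arr_comp S G F = mor_rel S ``
    {(\<Gamma>, map (subst (inst 0 f)) g, \<Theta>) | \<Gamma> f \<Delta> g \<Theta>. (\<Gamma>, f, \<Delta>) \<in> F \<and> (\<Delta>, g, \<Theta>) \<in> G}"

definition cell_rel :: "'f judgements \<Rightarrow> ('f ctx_cell \<times> 'f ctx_cell) set" where
  "cell_rel S = {((\<Gamma>, \<Delta>, f, g, \<alpha>), (\<Gamma>', \<Delta>', f', g', \<alpha>')).
    eq_tele S [] \<Gamma> \<Gamma>' \<and> eq_tele S [] \<Delta> \<Delta>' \<and> eq_elem S \<Gamma> f f' \<Delta> \<and> eq_elem S \<Gamma> g g' \<Delta> \<and>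
    eq_elem S \<Gamma> \<alpha> \<alpha>' (Id_ctx \<Delta> f g)}"

definition two_cells :: "'f judgements \<Rightarrow> 'f ctx_cell set set" where
  "two_cells S = {(\<Gamma>, \<Delta>, f, g, \<alpha>). is_ctx S \<Gamma> \<and> is_ctx S \<Delta> \<and>
    elem S \<Gamma> f \<Delta> \<and> elem S \<Gamma> g \<Delta> \<and> elem S \<Gamma> \<alpha> (Id_ctx \<Delta> f g)} // cell_rel S"

definition cell_src :: "'f ctx_cell set \<Rightarrow> 'f ctx_mor set" where
  "cell_src X = {(\<Gamma>, f, \<Delta>) | \<Gamma> f \<Delta>. \<exists>g \<alpha>. (\<Gamma>, \<Delta>, f, g, \<alpha>) \<in> X}"

definition cell_tgt :: "'f ctx_cell set \<Rightarrow> 'f ctx_mor set" where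
  "cell_tgt X = {(\<Gamma>, g, \<Delta>) | \<Gamma> g \<Delta>. \<exists>f \<alpha>. (\<Gamma>, \<Delta>, f, g, \<alpha>) \<in> X}"

end

theory Submission
  imports Defs
begin

text \<open>
  A 2-cell \<open>f \<Rightarrow> g : \<Gamma> \<rightarrow> \<Delta>\<close> is a morphism from \<open>\<Gamma>\<close> to the context \<open>x, y : \<Delta>, p : Id\<^sub>\<Delta>(x, y)\<close>. Two
  morphisms from a context extending \<open>x, y : \<Lambda>, p : Id\<^sub>\<Lambda>(x, y)\<close> to an identity context are equal as
  soon as they have equal ends and agree after setting \<open>y = x\<close> and \<open>p = r(x)\<close>: going through the
  entries one at a time, elimination gives an element of the identity type between the two
  values, and discreteness turns it into a definitional equality. Composition, inverses and
  horizontal composition are defined by elimination, and each law holds because both sides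
  agree on the diagonal. What remains is that elimination for identity contexts is well typed,
  computes on the diagonal and respects definitional equality, by induction on the context.
\<close>

section \<open>Substitution\<close>

text \<open>Formation and elimination of identity contexts are entangled: the type of
  \<open>q\<close> in \<open>Id_ctx_gen (D # \<Lambda>)\<close> contains
  \<open>transport \<Lambda> D\<close>, which is itself an instance of
  \<open>J_ctx \<Lambda>\<close>. So identity contexts cannot be shown well formed before
  elimination is available; \<open>elim_ok\<close> carries formation, reflexivity, elimination and
  computation through one induction. It compares two definitionally equal contexts because the
  codomain of a 2-cell is also taken modulo definitional equality. A second obstacle is that
  transport along reflexivity is the identity only definitionally. Contexts that coincide informally
  once \<open>p\<close> is r(x) are then different expressions, and the inductive step has to
  convert between them. A third is that the ends of composable 2-cells agree only up to definitional
  equality. Generic cells are therefore built with literally prescribed ends, and the laws are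
  proved for generic chains in which neighbouring cells share an end.\<close>

lemma subst_cong:
  assumes "scoped n e" and "\<And>i. i < n \<Longrightarrow> \<sigma> i = \<tau> i"
  shows "subst \<sigma> e = subst \<tau> e"
  using assms
proof (induction e arbitrary: n \<sigma> \<tau>)
  case (Var i) then show ?case by simp
next
  case (Op c es)
  have "subst (lift k \<sigma>) e = subst (lift k \<tau>) e" if "(k, e) \<in> set es" for k e
    using that Op.prems by (intro Op.IH[of "(k, e)" e "n + k"]) (auto simp: lift_def)
  then show ?case by auto
qed

lemma ren_eq_subst: "ren \<rho> e = subst (\<lambda>i. Var (\<rho> i)) e"
proof (induction e arbitrary: \<rho>)
  case (Var i) then show ?case by simp
next
  case (Op c es)
  have *: "(\<lambda>i. Var (if i < k then i else \<rho> (i - k) + k)) = lift k (\<lambda>i. Var (\<rho> i))" for k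
    by (auto simp: fun_eq_iff lift_def wk_def)
  have "ren (\<lambda>i. if i < k then i else \<rho> (i - k) + k) e = subst (lift k (\<lambda>i. Var (\<rho> i))) e"
    if "(k, e) \<in> set es" for k e
    using Op.IH[of "(k, e)" e] that by (auto simp: *)
  then show ?case by auto
qed

lemma wk_eq_subst: "wk k = subst (\<lambda>i. Var (i + k))"
  by (simp add: wk_def ren_eq_subst fun_eq_iff)

lemma subst_ren: "subst \<sigma> (ren \<rho> e) = subst (\<lambda>i. \<sigma> (\<rho> i)) e"
proof (induction e arbitrary: \<rho> \<sigma>)
  case (Var i) then show ?case by simp
next
  case (Op c es)
  have *: "(\<lambda>i. lift k \<sigma> (if i < k then i else \<rho> (i - k) + k)) = lift k (\<lambda>i. \<sigma> (\<rho> i))" for k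
    by (auto simp: fun_eq_iff lift_def)
  have "subst (lift k \<sigma>) (ren (\<lambda>i. if i < k then i else \<rho> (i - k) + k) e) = subst (lift k (\<lambda>i. \<sigma> (\<rho> i))) e"
    if "(k, e) \<in> set es" for k e
    using Op.IH[of "(k, e)" e] that by (auto simp: *)
  then show ?case by auto
qed

lemma subst_wk: "subst \<sigma> (wk k e) = subst (\<lambda>i. \<sigma> (i + k)) e"
  by (simp add: wk_def subst_ren)

lemma ren_ren: "ren \<rho> (ren \<pi> e) = ren (\<lambda>i. \<rho> (\<pi> i)) e"
  unfolding ren_eq_subst[of \<rho>] subst_ren by (rule ren_eq_subst[symmetric])

lemma ren_subst: "ren \<rho> (subst \<sigma> e) = subst (\<lambda>i. ren \<rho> (\<sigma> i)) e"
proof (induction e arbitrary: \<rho> \<sigma>)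
  case (Var i) then show ?case by simp
next
  case (Op c es)
  have *: "(\<lambda>i. ren (\<lambda>i. if i < k then i else \<rho> (i - k) + k) (lift k \<sigma> i)) = lift k (\<lambda>i. ren \<rho> (\<sigma> i))" for k
    by (auto simp: fun_eq_iff lift_def wk_def ren_ren)
  have "ren (\<lambda>i. if i < k then i else \<rho> (i - k) + k) (subst (lift k \<sigma>) e) = subst (lift k (\<lambda>i. ren \<rho> (\<sigma> i))) e"
    if "(k, e) \<in> set es" for k e
    using Op.IH[of "(k, e)" e] that by (auto simp: *)
  then show ?case by auto
qed

lemma wk_subst: "wk k (subst \<sigma> e) = subst (\<lambda>i. wk k (\<sigma> i)) e"
  by (simp add: wk_def ren_subst)

lemma lift_comp: "(\<lambda>i. subst (lift k \<sigma>) (lift k \<tau> i)) = lift k (\<lambda>i. subst \<sigma> (\<tau> i))"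
  by (auto simp: fun_eq_iff lift_def subst_wk wk_subst)

text \<open>Going under a binder lifts both substitutions, and lifting weakens by a renaming. Hence
  the composition law rests on the two mixed laws \<open>subst_ren\<close> and
  \<open>ren_subst\<close>, which come first.\<close>

lemma subst_subst [simp]: "subst \<sigma> (subst \<tau> e) = subst (\<lambda>i. subst \<sigma> (\<tau> i)) e"
proof (induction e arbitrary: \<tau> \<sigma>)
  case (Var i) then show ?case by simp
next
  case (Op c es)
  have "subst (lift k \<sigma>) (subst (lift k \<tau>) e) = subst (lift k (\<lambda>i. subst \<sigma> (\<tau> i))) e"
    if "(k, e) \<in> set es" for k e
    using Op.IH[of "(k, e)" e] that by (auto simp: lift_comp)
  then show ?case by auto
qed

lemma lift_Var: "lift k Var = Var"
  by (auto simp: fun_eq_iff lift_def wk_def)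

lemma subst_Var [simp]: "subst Var e = e"
proof (induction e)
  case (Var i) then show ?case by simp
next
  case (Op c es)
  then show ?case by (auto simp: lift_Var intro!: map_idI)
qed

lemma wk_0 [simp]: "wk 0 e = e"
  by (simp add: wk_eq_subst)

lemma wk_wk [simp]: "wk k (wk l e) = wk (l + k) e"
  by (simp add: wk_eq_subst add.assoc)

lemma wk_Var [simp]: "wk k (Var i) = Var (i + k)"
  by (simp add: wk_def)

lemma lift_0 [simp]: "lift 0 \<sigma> = \<sigma>"
  by (simp add: lift_def fun_eq_iff)

lemma lift_lift [simp]: "lift k (lift l \<sigma>) = lift (k + l) \<sigma>"
  by (auto simp: lift_def fun_eq_iff add.commute)

lemma lift_add [simp]: "lift k \<sigma> (i + k) = wk k (\<sigma> i)" "lift k \<sigma> (k + i) = wk k (\<sigma> i)"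
  by (simp_all add: lift_def)

lemma length_subst_tele [simp]: "length (subst_tele \<sigma> \<Delta>) = length \<Delta>"
  by (induction \<Delta>) auto

lemma subst_tele_append:
  "subst_tele \<sigma> (\<Theta> @ \<Delta>) = subst_tele (lift (length \<Delta>) \<sigma>) \<Theta> @ subst_tele \<sigma> \<Delta>"
  by (induction \<Theta>) auto

lemma subst_tele_subst_tele [simp]:
  "subst_tele \<sigma> (subst_tele \<tau> \<Delta>) = subst_tele (\<lambda>i. subst \<sigma> (\<tau> i)) \<Delta>"
  by (induction \<Delta>) (auto simp: lift_comp)

lemma subst_tele_Var [simp]: "subst_tele Var \<Delta> = \<Delta>"
  by (induction \<Delta>) (auto simp: lift_Var)

lemma subst_Id [simp]: "subst \<sigma> (Id A a b) = Id (subst \<sigma> A) (subst \<sigma> a) (subst \<sigma> b)"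
  by (simp add: Id_def)

lemma subst_Refl [simp]: "subst \<sigma> (Refl A a) = Refl (subst \<sigma> A) (subst \<sigma> a)"
  by (simp add: Refl_def)

lemma length_vars [simp]: "length (vars k n) = n"
  by (simp add: vars_def)

lemma nth_vars [simp]: "i < n \<Longrightarrow> vars k n ! i = Var (k + i)"
  by (simp add: vars_def)

lemma inst_Nil [simp]: "inst 0 [] = Var"
  by (simp add: inst_def fun_eq_iff)

lemma inst_Cons_Suc [simp]: "inst k (t # ts) (Suc i) = inst k ts i"
  by (simp add: inst_def)

lemma inst_Cons_0 [simp]: "inst k (t # ts) 0 = t"
  by (simp add: inst_def)

lemma inst_map: "i < n \<Longrightarrow> inst k (map \<sigma> [0..<n]) i = \<sigma> i"
  by (simp add: inst_def)


section \<open>Typed substitutions\<close>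

context dependent_type_theory
begin

text \<open>
  Morphisms are handled as functions on variables, of which only the values at the variables
  of the target matter. \<open>hom\<close> is the diagonal of \<open>seq\<close>, so that typing statements are
  instances of congruence statements.
\<close>

fun seq :: "'f ctx \<Rightarrow> (nat \<Rightarrow> 'f expr) \<Rightarrow> (nat \<Rightarrow> 'f expr) \<Rightarrow> 'f ctx \<Rightarrow> bool" where
  "seq \<Gamma> \<sigma> \<tau> [] \<longleftrightarrow> is_ctx S \<Gamma>"
| "seq \<Gamma> \<sigma> \<tau> (A # \<Delta>) \<longleftrightarrow> seq \<Gamma> (\<lambda>i. \<sigma> (Suc i)) (\<lambda>i. \<tau> (Suc i)) \<Delta> \<and> is_type S \<Delta> A \<and>
    eq_term S \<Gamma> (\<sigma> 0) (\<tau> 0) (subst (\<lambda>i. \<sigma> (Suc i)) A)"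

abbreviation "hom \<Gamma> \<sigma> \<Delta> \<equiv> seq \<Gamma> \<sigma> \<sigma> \<Delta>"

lemma type_ctx: "is_type S \<Gamma> A \<Longrightarrow> is_ctx S \<Gamma>" and type_scoped: "is_type S \<Gamma> A \<Longrightarrow> scoped (length \<Gamma>) A"
  using type_presup by auto

lemma seq_ctx: "seq \<Gamma> \<sigma> \<tau> \<Delta> \<Longrightarrow> is_ctx S \<Gamma> \<and> is_ctx S \<Delta>"
  by (induction \<Delta> arbitrary: \<sigma> \<tau>) auto

lemma eq_type_left: "eq_type S \<Gamma> A B \<Longrightarrow> is_type S \<Gamma> A"
  and eq_type_right: "eq_type S \<Gamma> A B \<Longrightarrow> is_type S \<Gamma> B"
  using eq_type_presup by auto

lemma eq_term_left: "eq_term S \<Gamma> a b A \<Longrightarrow> has_type S \<Gamma> a A"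
  and eq_term_right: "eq_term S \<Gamma> a b A \<Longrightarrow> has_type S \<Gamma> b A"
  using eq_term_presup by auto

lemma eq_term_type: "eq_term S \<Gamma> a b A \<Longrightarrow> is_type S \<Gamma> A"
  using eq_term_presup term_presup by blast

text \<open>The premises \<open>is_type S \<Delta> A\<close> recorded in \<open>seq\<close> bound
  the variables of each \<open>A\<close>, so values beyond the target never enter a typing
  condition.\<close>

lemma seq_cong:
  assumes "\<And>i. i < length \<Delta> \<Longrightarrow> \<sigma> i = \<sigma>' i" "\<And>i. i < length \<Delta> \<Longrightarrow> \<tau> i = \<tau>' i"
  shows "seq \<Gamma> \<sigma> \<tau> \<Delta> \<longleftrightarrow> seq \<Gamma> \<sigma>' \<tau>' \<Delta>"
  using assms
proof (induction \<Delta> arbitrary: \<sigma> \<tau> \<sigma>' \<tau>')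
  case Nil then show ?case by simp
next
  case (Cons A \<Delta>)
  have "seq \<Gamma> (\<lambda>i. \<sigma> (Suc i)) (\<lambda>i. \<tau> (Suc i)) \<Delta> \<longleftrightarrow> seq \<Gamma> (\<lambda>i. \<sigma>' (Suc i)) (\<lambda>i. \<tau>' (Suc i)) \<Delta>"
    using Cons.prems by (intro Cons.IH) auto
  moreover have "subst (\<lambda>i. \<sigma> (Suc i)) A = subst (\<lambda>i. \<sigma>' (Suc i)) A" if "is_type S \<Delta> A"
    using type_scoped[OF that] Cons.prems by (intro subst_cong) auto
  ultimately show ?case using Cons.prems[of 0] by auto
qed

text \<open>Passes between the lists of the definitions and functions on variables; both instantiate
  the types of \<open>\<Delta>\<close> alike because each type is scoped in the entries before
  it.\<close>

lemma seq_eq_elem_iff: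
  assumes "is_ctx S \<Gamma>" "is_ctx S \<Delta>"
  shows "seq \<Gamma> \<sigma> \<tau> \<Delta> \<longleftrightarrow> eq_elem S \<Gamma> (map \<sigma> [0..<length \<Delta>]) (map \<tau> [0..<length \<Delta>]) \<Delta>"
  using assms
proof (induction \<Delta> arbitrary: \<sigma> \<tau>)
  case Nil then show ?case by simp
next
  case (Cons A \<Delta>)
  have "subst (inst 0 (map (\<lambda>i. \<sigma> (Suc i)) [0..<length \<Delta>])) A = subst (\<lambda>i. \<sigma> (Suc i)) A"
    using Cons.prems by (intro subst_cong[OF type_scoped]) (auto simp: inst_map)
  then show ?case using Cons by (auto simp: map_upt_Suc simp del: upt_Suc)
qed

lemma seq_elem:
  assumes "seq \<Gamma> \<sigma> \<tau> \<Delta>"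
  shows "elem S \<Gamma> (map \<sigma> [0..<length \<Delta>]) \<Delta>"
  using assms
proof (induction \<Delta> arbitrary: \<sigma> \<tau>)
  case Nil then show ?case by simp
next
  case (Cons A \<Delta>)
  have "subst (inst 0 (map (\<lambda>i. \<sigma> (Suc i)) [0..<length \<Delta>])) A = subst (\<lambda>i. \<sigma> (Suc i)) A"
    using Cons.prems by (intro subst_cong[OF type_scoped]) (auto simp: inst_map)
  then show ?case using Cons by (auto simp: map_upt_Suc eq_term_left simp del: upt_Suc)
qed

lemma inst_subst: "is_type S \<Delta> A \<Longrightarrow> subst (inst 0 (map \<sigma> [0..<length \<Delta>])) A = subst \<sigma> A"
  by (intro subst_cong[OF type_scoped]) (auto simp: inst_map)

lemma inst_subst_term: "has_type S \<Delta> a A \<Longrightarrow> subst (inst 0 (map \<sigma> [0..<length \<Delta>])) a = subst \<sigma> a"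
  using term_presup by (intro subst_cong[of "length \<Delta>"]) (auto simp: inst_map)

lemma subst_typeI: "seq \<Gamma> \<sigma> \<tau> \<Delta> \<Longrightarrow> is_type S \<Delta> A \<Longrightarrow> is_type S \<Gamma> (subst \<sigma> A)"
  using subst_type[of \<Gamma> "map \<sigma> [0..<length \<Delta>]" \<Delta> A] seq_ctx seq_elem by (simp add: inst_subst)

text \<open>The rules vary either the expression under a fixed substitution or the substitution
  under a fixed expression; \<open>subst \<sigma> B\<close> is the meeting point.\<close>

lemma seq_eq_type:
  assumes s: "seq \<Gamma> \<sigma> \<tau> \<Delta>" and e: "eq_type S \<Delta> A B"
  shows "eq_type S \<Gamma> (subst \<sigma> A) (subst \<tau> B)"
proof (rule eq_type_trans)
  note t = eq_type_left[OF e] eq_type_right[OF e] and c = seq_ctx[OF s]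
  show "eq_type S \<Gamma> (subst \<sigma> A) (subst \<sigma> B)"
    using subst_eq_type[OF _ seq_elem[OF s] e] t c by (simp add: inst_subst)
  show "eq_type S \<Gamma> (subst \<sigma> B) (subst \<tau> B)"
    using cong_type[OF _ _ t(2), of \<Gamma> "map \<sigma> [0..<length \<Delta>]" "map \<tau> [0..<length \<Delta>]"] s t c
    by (simp add: inst_subst seq_eq_elem_iff)
qed

lemma seq_eq_term:
  assumes s: "seq \<Gamma> \<sigma> \<tau> \<Delta>" and e: "eq_term S \<Delta> a b A"
  shows "eq_term S \<Gamma> (subst \<sigma> a) (subst \<tau> b) (subst \<sigma> A)"
proof (rule eq_term_trans)
  note t = eq_term_left[OF e] eq_term_right[OF e] eq_term_type[OF e] and c = seq_ctx[OF s]
  show "eq_term S \<Gamma> (subst \<sigma> a) (subst \<sigma> b) (subst \<sigma> A)"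
    using subst_eq_term[OF _ seq_elem[OF s] e] t c by (simp add: inst_subst inst_subst_term)
  show "eq_term S \<Gamma> (subst \<sigma> b) (subst \<tau> b) (subst \<sigma> A)"
    using cong_term[OF _ _ t(2), of \<Gamma> "map \<sigma> [0..<length \<Delta>]" "map \<tau> [0..<length \<Delta>]"] s t c
    by (simp add: inst_subst inst_subst_term seq_eq_elem_iff)
qed

text \<open>Components are typed over the left substitution, so reversing needs a conversion between
  \<open>subst \<sigma> A\<close> and \<open>subst \<tau> A\<close>, which the equality of the tails
  supplies.\<close>

lemma seq_sym: "seq \<Gamma> \<sigma> \<tau> \<Delta> \<Longrightarrow> seq \<Gamma> \<tau> \<sigma> \<Delta>"
proof (induction \<Delta> arbitrary: \<sigma> \<tau>)
  case Nil then show ?case by simp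
next
  case (Cons A \<Delta>)
  then have "eq_type S \<Gamma> (subst (\<lambda>i. \<sigma> (Suc i)) A) (subst (\<lambda>i. \<tau> (Suc i)) A)"
    by (auto intro: seq_eq_type eq_type_refl)
  with Cons show ?case by (auto intro: conv_eq_term eq_term_sym)
qed

lemma seq_trans: "seq \<Gamma> \<sigma> \<tau> \<Delta> \<Longrightarrow> seq \<Gamma> \<tau> \<rho> \<Delta> \<Longrightarrow> seq \<Gamma> \<sigma> \<rho> \<Delta>"
proof (induction \<Delta> arbitrary: \<sigma> \<tau> \<rho>)
  case Nil then show ?case by simp
next
  case (Cons A \<Delta>)
  then have "eq_type S \<Gamma> (subst (\<lambda>i. \<sigma> (Suc i)) A) (subst (\<lambda>i. \<tau> (Suc i)) A)"
    by (auto intro: seq_eq_type eq_type_refl)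
  then have "eq_type S \<Gamma> (subst (\<lambda>i. \<tau> (Suc i)) A) (subst (\<lambda>i. \<sigma> (Suc i)) A)"
    by (rule eq_type_sym)
  with Cons show ?case by (auto intro: conv_eq_term eq_term_trans)
qed

lemma seq_left: "seq \<Gamma> \<sigma> \<tau> \<Delta> \<Longrightarrow> hom \<Gamma> \<sigma> \<Delta>" and seq_right: "seq \<Gamma> \<sigma> \<tau> \<Delta> \<Longrightarrow> hom \<Gamma> \<tau> \<Delta>"
  using seq_sym seq_trans by blast+

lemma seq_comp:
  "seq \<Gamma> \<sigma> \<tau> \<Delta> \<Longrightarrow> seq \<Delta> \<rho> \<pi> \<Theta> \<Longrightarrow> seq \<Gamma> (\<lambda>i. subst \<sigma> (\<rho> i)) (\<lambda>i. subst \<tau> (\<pi> i)) \<Theta>"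
proof (induction \<Theta> arbitrary: \<rho> \<pi>)
  case Nil then show ?case using seq_ctx by auto
next
  case (Cons A \<Theta>)
  then have "eq_term S \<Gamma> (subst \<sigma> (\<rho> 0)) (subst \<tau> (\<pi> 0)) (subst \<sigma> (subst (\<lambda>i. \<rho> (Suc i)) A))"
    by (intro seq_eq_term) auto
  with Cons show ?case by auto
qed

lemma seq_append:
  "seq \<Gamma> \<sigma> \<tau> (\<Theta> @ \<Delta>) \<Longrightarrow> seq \<Gamma> (\<lambda>i. \<sigma> (i + length \<Theta>)) (\<lambda>i. \<tau> (i + length \<Theta>)) \<Delta>"
proof (induction \<Theta> arbitrary: \<sigma> \<tau>)
  case (Cons A \<Theta>)
  then show ?case using Cons.IH[of "\<lambda>i. \<sigma> (Suc i)" "\<lambda>i. \<tau> (Suc i)"] by simp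
qed simp

lemma is_ctx_append: "is_ctx S (\<Theta> @ \<Delta>) \<Longrightarrow> is_ctx S \<Delta>"
  by (induction \<Theta>) auto

text \<open>Stripping the last entry from \<open>\<Delta>\<close> enlarges the weakening
  \<open>\<Theta>\<close> by that entry, so \<open>\<Theta>\<close> must vary in the
  induction.\<close>

lemma hom_wk: "is_ctx S (\<Theta> @ \<Delta>) \<Longrightarrow> hom (\<Theta> @ \<Delta>) (\<lambda>i. Var (i + length \<Theta>)) \<Delta>"
proof (induction \<Delta> arbitrary: \<Theta>)
  case Nil then show ?case by simp
next
  case (Cons A \<Delta>)
  have "has_type S (\<Theta> @ A # \<Delta>) (Var (length \<Theta>)) (wk (Suc (length \<Theta>)) ((\<Theta> @ A # \<Delta>) ! length \<Theta>))"
    using Cons.prems by (intro var) auto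
  moreover have "hom (\<Theta> @ A # \<Delta>) (\<lambda>i. Var (i + length (\<Theta> @ [A]))) \<Delta>"
    using Cons.IH[of "\<Theta> @ [A]"] Cons.prems by simp
  moreover have "is_type S \<Delta> A" using is_ctx_append[OF Cons.prems] by simp
  ultimately show ?case by (auto simp: wk_eq_subst intro: eq_term_refl)
qed

lemma hom_id: "is_ctx S \<Delta> \<Longrightarrow> hom \<Delta> Var \<Delta>"
  using hom_wk[of "[]"] by simp

lemma var_eq: "is_ctx S \<Gamma> \<Longrightarrow> i < length \<Gamma> \<Longrightarrow> T = wk (Suc i) (\<Gamma> ! i) \<Longrightarrow> eq_term S \<Gamma> (Var i) (Var i) T"
  using var eq_term_refl by blast


section \<open>Definitional equality of contexts and telescopes\<close>

lemma eq_tele_length: "eq_tele S \<Gamma> \<Delta> \<Delta>' \<Longrightarrow> length \<Delta> = length \<Delta>'"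
  by (induction S \<Gamma> \<Delta> \<Delta>' rule: eq_tele.induct) auto

lemma eq_tele_append:
  assumes "length \<Theta> = length \<Theta>'"
  shows "eq_tele S \<Gamma> (\<Theta> @ \<Delta>) (\<Theta>' @ \<Delta>') \<longleftrightarrow> eq_tele S \<Gamma> \<Delta> \<Delta>' \<and> eq_tele S (\<Delta> @ \<Gamma>) \<Theta> \<Theta>'"
  using assms by (induction \<Theta> \<Theta>' rule: list_induct2) auto

lemma eq_tele_refl: "is_ctx S (\<Theta> @ \<Gamma>) \<Longrightarrow> eq_tele S \<Gamma> \<Theta> \<Theta>"
  by (induction \<Theta>) (auto intro: eq_type_refl)

lemma eq_tele_ctx: "eq_tele S \<Gamma> \<Theta> \<Theta>' \<Longrightarrow> is_ctx S \<Gamma> \<Longrightarrow> is_ctx S (\<Theta> @ \<Gamma>)"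
proof (induction \<Theta> arbitrary: \<Theta>')
  case (Cons A \<Theta>)
  then show ?case by (cases \<Theta>') (auto dest: eq_type_left)
qed simp

lemma seq_wk: "seq \<Gamma> \<sigma> \<tau> \<Delta> \<Longrightarrow> is_ctx S (\<Theta> @ \<Gamma>) \<Longrightarrow>
    seq (\<Theta> @ \<Gamma>) (\<lambda>i. wk (length \<Theta>) (\<sigma> i)) (\<lambda>i. wk (length \<Theta>) (\<tau> i)) \<Delta>"
  unfolding wk_eq_subst by (rule seq_comp[OF hom_wk])

lemma seq_lift1:
  assumes "seq \<Gamma> \<sigma> \<tau> \<Delta>" "is_type S \<Delta> A"
  shows "seq (subst \<sigma> A # \<Gamma>) (lift 1 \<sigma>) (lift 1 \<tau>) (A # \<Delta>)"
proof -
  have c: "is_ctx S ([subst \<sigma> A] @ \<Gamma>)" using assms seq_ctx subst_typeI by auto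
  have "eq_term S (subst \<sigma> A # \<Gamma>) (Var 0) (Var 0) (subst (\<lambda>i. wk 1 (\<sigma> i)) A)"
    using c by (intro var_eq) (auto simp: wk_subst)
  with seq_wk[OF assms(1) c] assms(2) show ?thesis by (simp add: lift_def)
qed

text \<open>The two conclusions need a common induction: comparing the next type uses the lifted
  substitutions over the telescope built so far, and lifting once more uses that type.\<close>

lemma seq_tele:
  assumes "seq \<Gamma> \<sigma> \<tau> \<Delta>" "eq_tele S \<Delta> \<Theta> \<Theta>'"
  shows "eq_tele S \<Gamma> (subst_tele \<sigma> \<Theta>) (subst_tele \<tau> \<Theta>') \<and>
    seq (subst_tele \<sigma> \<Theta> @ \<Gamma>) (lift (length \<Theta>) \<sigma>) (lift (length \<Theta>) \<tau>) (\<Theta> @ \<Delta>)"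
  using eq_tele_length[OF assms(2)] assms(2)
proof (induction \<Theta> \<Theta>' rule: list_induct2)
  case Nil then show ?case using assms(1) by simp
next
  case (Cons A \<Theta> B \<Theta>')
  then have IH: "eq_tele S \<Gamma> (subst_tele \<sigma> \<Theta>) (subst_tele \<tau> \<Theta>')"
    "seq (subst_tele \<sigma> \<Theta> @ \<Gamma>) (lift (length \<Theta>) \<sigma>) (lift (length \<Theta>) \<tau>) (\<Theta> @ \<Delta>)"
    and e: "eq_type S (\<Theta> @ \<Delta>) A B" by auto
  show ?case using IH seq_eq_type[OF IH(2) e] seq_lift1[OF IH(2) eq_type_left[OF e]] Cons.hyps by simp
qed

lemma seq_lift:
  assumes "seq \<Gamma> \<sigma> \<tau> \<Delta>" "is_ctx S (\<Theta> @ \<Delta>)"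
  shows "seq (subst_tele \<sigma> \<Theta> @ \<Gamma>) (lift (length \<Theta>) \<sigma>) (lift (length \<Theta>) \<tau>) (\<Theta> @ \<Delta>)"
  using seq_tele[OF assms(1) eq_tele_refl[OF assms(2)]] by simp

text \<open>\<open>eq_tele\<close> compares each pair of types over the left context. Turning it
  around means moving types to the right context, which the identity substitution does once it is a
  morphism both ways; hence one induction for all three claims.\<close>

lemma eq_ctx_conv: "eq_tele S [] \<Gamma> \<Gamma>' \<Longrightarrow> hom \<Gamma> Var \<Gamma>' \<and> hom \<Gamma>' Var \<Gamma> \<and> eq_tele S [] \<Gamma>' \<Gamma>"
proof -
  assume "eq_tele S [] \<Gamma> \<Gamma>'"
  with eq_tele_length[OF this] show ?thesis
  proof (induction \<Gamma> \<Gamma>' rule: list_induct2)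
    case Nil then show ?case by simp
  next
    case (Cons A \<Gamma> B \<Gamma>')
    then have h: "hom \<Gamma> Var \<Gamma>'" "hom \<Gamma>' Var \<Gamma>" and e: "eq_type S \<Gamma> A B" and s: "eq_tele S [] \<Gamma>' \<Gamma>" by auto
    have e': "eq_type S \<Gamma>' A B" using seq_eq_type[OF h(2) e] by simp
    have c: "is_ctx S ([A] @ \<Gamma>)" "is_ctx S ([B] @ \<Gamma>')" "is_type S \<Gamma>' B" "is_type S \<Gamma> A"
      using eq_type_left[OF e] eq_type_right[OF e'] type_ctx by auto
    have w: "eq_type S (A # \<Gamma>) (wk 1 A) (wk 1 B)" "eq_type S (B # \<Gamma>') (wk 1 A) (wk 1 B)"
      using seq_eq_type[OF hom_wk[OF c(1)] e] seq_eq_type[OF hom_wk[OF c(2)] e'] by (auto simp: wk_eq_subst)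
    have "eq_term S (A # \<Gamma>) (Var 0) (Var 0) (wk 1 B)" "eq_term S (B # \<Gamma>') (Var 0) (Var 0) (wk 1 A)"
      using conv_eq_term[OF var_eq w(1), of 0] conv_eq_term[OF var_eq eq_type_sym[OF w(2)], of 0] c by simp_all
    with seq_wk[OF h(1) c(1)] seq_wk[OF h(2) c(2)] c s eq_type_sym[OF e'] show ?case
      by (simp add: wk_eq_subst)
  qed
qed

lemma eq_ctx_sym: "eq_tele S [] \<Gamma> \<Gamma>' \<Longrightarrow> eq_tele S [] \<Gamma>' \<Gamma>"
  using eq_ctx_conv by blast

lemma eq_type_conv: "eq_tele S [] \<Gamma> \<Gamma>' \<Longrightarrow> eq_type S \<Gamma> A B \<Longrightarrow> eq_type S \<Gamma>' A B"
  using eq_ctx_conv seq_eq_type[of \<Gamma>' Var Var \<Gamma>] by auto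

lemma eq_term_conv: "eq_tele S [] \<Gamma> \<Gamma>' \<Longrightarrow> eq_term S \<Gamma> a b A \<Longrightarrow> eq_term S \<Gamma>' a b A"
  using eq_ctx_conv seq_eq_term[of \<Gamma>' Var Var \<Gamma>] by auto

lemma eq_ctx_trans: "eq_tele S [] \<Gamma> \<Gamma>' \<Longrightarrow> eq_tele S [] \<Gamma>' \<Gamma>'' \<Longrightarrow> eq_tele S [] \<Gamma> \<Gamma>''"
proof (induction \<Gamma> arbitrary: \<Gamma>' \<Gamma>'')
  case Nil then show ?case by (cases \<Gamma>'; cases \<Gamma>'') auto
next
  case (Cons A \<Gamma>)
  then obtain B \<Delta> where B: "\<Gamma>' = B # \<Delta>" by (cases \<Gamma>') auto
  with Cons.prems obtain C \<Theta> where "\<Gamma>'' = C # \<Theta>" by (cases \<Gamma>'') auto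
  with B Cons show ?case
    by (auto intro: eq_type_trans eq_type_conv[OF eq_ctx_sym])
qed

lemma seq_conv_target: "eq_tele S [] \<Delta> \<Delta>' \<Longrightarrow> seq \<Gamma> \<sigma> \<tau> \<Delta> \<Longrightarrow> seq \<Gamma> \<sigma> \<tau> \<Delta>'"
  using seq_comp[of \<Gamma> \<sigma> \<tau> \<Delta> Var Var \<Delta>'] eq_ctx_conv by auto

lemma seq_conv_source: "eq_tele S [] \<Gamma> \<Gamma>' \<Longrightarrow> seq \<Gamma> \<sigma> \<tau> \<Delta> \<Longrightarrow> seq \<Gamma>' \<sigma> \<tau> \<Delta>"
  using seq_comp[of \<Gamma>' Var Var \<Gamma> \<sigma> \<tau> \<Delta>] eq_ctx_conv by auto

lemma subst_tele_cong:
  "is_ctx S (\<Theta> @ \<Gamma>) \<Longrightarrow> (\<And>i. i < length \<Gamma> \<Longrightarrow> \<sigma> i = \<tau> i) \<Longrightarrow> subst_tele \<sigma> \<Theta> = subst_tele \<tau> \<Theta>"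
proof (induction \<Theta>)
  case Nil then show ?case by simp
next
  case (Cons A \<Theta>)
  then have "subst (lift (length \<Theta>) \<sigma>) A = subst (lift (length \<Theta>) \<tau>) A"
    by (intro subst_cong[OF type_scoped[of "\<Theta> @ \<Gamma>"]]) (auto simp: lift_def)
  with Cons show ?case by auto
qed

lemma subst_tele_closed: "is_ctx S \<Lambda> \<Longrightarrow> subst_tele \<sigma> \<Lambda> = \<Lambda>"
  using subst_tele_cong[of \<Lambda> "[]" \<sigma> Var] by simp

text \<open>\<open>subst_tele \<kappa> \<Theta> @ X\<close> is the pullback of the projection \<open>\<Theta> @ Y \<rightarrow> Y\<close> along \<open>\<kappa> : X \<rightarrow> Y\<close>.\<close>

lemma seq_pullback:
  assumes "hom X \<kappa> Y" "is_ctx S (\<Theta> @ Y)"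
    and "seq \<Gamma> (\<lambda>i. \<sigma> (i + length \<Theta>)) (\<lambda>i. \<tau> (i + length \<Theta>)) X"
    and "seq \<Gamma> (\<lambda>i. if i < length \<Theta> then \<sigma> i else subst (\<lambda>i. \<sigma> (i + length \<Theta>)) (\<kappa> (i - length \<Theta>)))
               (\<lambda>i. if i < length \<Theta> then \<tau> i else subst (\<lambda>i. \<tau> (i + length \<Theta>)) (\<kappa> (i - length \<Theta>))) (\<Theta> @ Y)"
  shows "seq \<Gamma> \<sigma> \<tau> (subst_tele \<kappa> \<Theta> @ X)"
  using assms(2-)
proof (induction \<Theta> arbitrary: \<sigma> \<tau>)
  case Nil then show ?case by simp
next
  case (Cons A \<Theta>)
  have "seq \<Gamma> (\<lambda>i. \<sigma> (Suc i)) (\<lambda>i. \<tau> (Suc i)) (subst_tele \<kappa> \<Theta> @ X)"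
    using Cons.prems by (intro Cons.IH) (auto cong: if_cong)
  moreover have "is_type S (subst_tele \<kappa> \<Theta> @ X) (subst (lift (length \<Theta>) \<kappa>) A)"
    using Cons.prems by (intro subst_typeI[OF seq_lift[OF assms(1)]]) auto
  \<comment> \<open>Substituting into the lifted \<open>\<kappa>\<close> keeps the entries of
    \<open>\<Theta>\<close> and sends the rest through \<open>\<kappa>\<close>, which is the typing
    asked for in the last assumption.\<close>
  moreover have "(\<lambda>i. subst (\<lambda>i. \<sigma> (Suc i)) (lift (length \<Theta>) \<kappa> i)) =
     (\<lambda>i. if i < length \<Theta> then \<sigma> (Suc i) else subst (\<lambda>i. \<sigma> (Suc (i + length \<Theta>))) (\<kappa> (i - length \<Theta>)))"
    by (auto simp: fun_eq_iff lift_def subst_wk)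
  ultimately show ?case using Cons.prems(3) by (simp cong: if_cong)
qed

text \<open>A closed \<open>\<Lambda>\<close> is its own pullback along the map to the empty
  context, so \<open>\<Lambda> @ X\<close> is a product of contexts.\<close>

lemma seq_closed_append:
  assumes "seq \<Gamma> \<sigma> \<tau> \<Lambda>" "seq \<Gamma> (\<lambda>i. \<sigma> (i + length \<Lambda>)) (\<lambda>i. \<tau> (i + length \<Lambda>)) X"
  shows "seq \<Gamma> \<sigma> \<tau> (\<Lambda> @ X)"
proof -
  have c: "is_ctx S X" "is_ctx S \<Lambda>" using assms seq_ctx by auto
  have "seq \<Gamma> \<sigma> \<tau> (subst_tele Var \<Lambda> @ X)"
  proof (rule seq_pullback[where Y = "[]"])
    show "seq \<Gamma> (\<lambda>i. if i < length \<Lambda> then \<sigma> i else subst (\<lambda>i. \<sigma> (i + length \<Lambda>)) (Var (i - length \<Lambda>)))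
      (\<lambda>i. if i < length \<Lambda> then \<tau> i else subst (\<lambda>i. \<tau> (i + length \<Lambda>)) (Var (i - length \<Lambda>))) (\<Lambda> @ [])"
      using assms(1) by (subst seq_cong[where \<sigma>' = \<sigma> and \<tau>' = \<tau>]) auto
  qed (use assms c in auto)
  then show ?thesis by simp
qed

lemma is_ctx_closed_append: "is_ctx S \<Lambda> \<Longrightarrow> is_ctx S X \<Longrightarrow> is_ctx S (\<Lambda> @ X)"
  using seq_tele[of X Var Var "[]" \<Lambda> \<Lambda>] eq_tele_ctx[of X \<Lambda> \<Lambda>] by (simp add: eq_tele_refl)

lemma hom_closed_left: "is_ctx S \<Lambda> \<Longrightarrow> is_ctx S X \<Longrightarrow> hom (\<Lambda> @ X) Var \<Lambda>"
  using seq_lift[of X Var Var "[]" \<Lambda>] by (simp add: subst_tele_closed lift_Var)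

text \<open>The entries kept in \<open>\<Theta>\<close> acquire new types when the tail changes;
  these equal the old ones because the tails agree. This lets the ends of a 2-cell be exchanged for
  definitionally equal ones.\<close>

lemma seq_replace:
  assumes "hom \<Gamma> \<sigma> (\<Theta> @ W)" "seq \<Gamma> \<tau> (\<lambda>i. \<sigma> (i + length \<Theta>)) W"
  shows "seq \<Gamma> (\<lambda>i. if i < length \<Theta> then \<sigma> i else \<tau> (i - length \<Theta>)) \<sigma> (\<Theta> @ W)"
  using assms
proof (induction \<Theta> arbitrary: \<sigma>)
  case Nil then show ?case by simp
next
  case (Cons A \<Theta>)
  have *: "seq \<Gamma> (\<lambda>i. if i < length \<Theta> then \<sigma> (Suc i) else \<tau> (i - length \<Theta>)) (\<lambda>i. \<sigma> (Suc i)) (\<Theta> @ W)"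
    using Cons.prems by (intro Cons.IH) auto
  have "is_type S (\<Theta> @ W) A" using Cons.prems by auto
  then have "eq_type S \<Gamma> (subst (\<lambda>i. if i < length \<Theta> then \<sigma> (Suc i) else \<tau> (i - length \<Theta>)) A) (subst (\<lambda>i. \<sigma> (Suc i)) A)"
    by (intro seq_eq_type[OF *] eq_type_refl)
  with * Cons.prems show ?case by (auto intro: conv_eq_term eq_type_sym cong: if_cong)
qed

text \<open>An element of a telescope over \<open>\<Gamma>\<close> is a section of the projection to
  \<open>\<Gamma>\<close>: past the entries of \<open>ts\<close>, \<open>inst 0 ts\<close> is the
  identity on the variables of \<open>\<Gamma>\<close>.\<close>

lemma eq_elem_iff:
  assumes "is_ctx S (\<Theta> @ \<Gamma>)"
  shows "eq_elem S \<Gamma> ts us \<Theta> \<longleftrightarrow>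
    length ts = length \<Theta> \<and> length us = length \<Theta> \<and> seq \<Gamma> (inst 0 ts) (inst 0 us) (\<Theta> @ \<Gamma>)"
  using assms
proof (induction \<Theta> arbitrary: ts us)
  case Nil then show ?case by (cases ts; cases us) (auto simp: hom_id)
next
  case (Cons A \<Theta>) then show ?case by (cases ts; cases us) auto
qed

lemma elem_iff: "elem S \<Gamma> ts \<Theta> \<longleftrightarrow> eq_elem S \<Gamma> ts ts \<Theta>"
proof (induction ts arbitrary: \<Theta>)
  case Nil then show ?case by (cases \<Theta>) auto
next
  case (Cons t ts)
  then show ?case by (cases \<Theta>) (auto intro: eq_term_refl dest: eq_term_left)
qed

end

section \<open>Elimination for identity contexts\<close>

lemma length_refl_ctx [simp]: "length (refl_ctx \<Lambda>) = length \<Lambda>"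
  by (induction \<Lambda>) auto

lemma length_Id_ctx_gen [simp]: "length (Id_ctx_gen \<Lambda>) = length \<Lambda>"
  by (induction \<Lambda>) (auto simp: Let_def)

text \<open>The context \<open>x, y : \<Lambda>, p : Id\<^sub>\<Lambda>(x, y)\<close> and the map \<open>x \<mapsto> (x, x, r(x))\<close> into it.\<close>

definition id_ctx :: "'f ctx \<Rightarrow> 'f ctx" where
  "id_ctx \<Lambda> = Id_ctx_gen \<Lambda> @ \<Lambda> @ \<Lambda>"

definition dg :: "'f ctx \<Rightarrow> nat \<Rightarrow> 'f expr" where
  "dg \<Lambda> i = (if i < length \<Lambda> then refl_ctx \<Lambda> ! i
    else if i < 2 * length \<Lambda> then Var (i - length \<Lambda>) else Var (i - 2 * length \<Lambda>))"

lemma length_id_ctx [simp]: "length (id_ctx \<Lambda>) = 3 * length \<Lambda>"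
  by (simp add: id_ctx_def)

text \<open>
  The variable shuffles of \<open>Id_ctx_gen\<close> and \<open>J_ctx\<close> for \<open>\<Phi> = (x : \<Lambda>, y : D(x))\<close>, as functions;
  \<open>omega\<close> and \<open>nu\<close> are mutually inverse.
\<close>

definition kappa :: "nat \<Rightarrow> nat \<Rightarrow> 'f expr" where
  "kappa n i = (if i < n then Var (i + 1) else Var (i + 2))"

definition zeta :: "nat \<Rightarrow> nat \<Rightarrow> 'f expr" where
  "zeta n i = (if i = 0 then Var n else if i \<le> n then Var (i - 1) else if i \<le> 2 * n then Var i else Var (i + 1))"

definition zeta' :: "nat \<Rightarrow> 'f expr" where
  "zeta' i = (if i = 0 then Var 0 else Var (i + 1))"

definition omega :: "nat \<Rightarrow> nat \<Rightarrow> 'f expr" where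
  "omega n i = (if i = 0 then Var 0 else if i \<le> n then Var (i + 2) else if i = n + 1 then Var 1
    else if i \<le> 2 * n + 1 then Var (i + 1) else if i = 2 * n + 2 then Var 2 else Var i)"

definition nu :: "nat \<Rightarrow> nat \<Rightarrow> 'f expr" where
  "nu n i = (if i = 0 then Var 0 else if i = 1 then Var (n + 1) else if i = 2 then Var (2 * n + 2)
    else if i < n + 3 then Var (i - 2) else if i < 2 * n + 3 then Var (i - 1) else Var i)"

lemma inst_kappa: "inst (2 * n + 2) (vars 1 n @ vars (n + 2) n) = kappa n"
  by (auto simp: fun_eq_iff inst_def kappa_def nth_append)

lemma inst_zeta: "inst (3 * n + 2) (Var n # vars 0 n @ vars (n + 1) n @ vars (2 * n + 2) n) = zeta n"
  by (auto simp: fun_eq_iff inst_def zeta_def nth_append nth_Cons')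

lemma inst_zeta': "inst (3 * n + 2) (Var 0 # vars 2 n @ vars (n + 2) n @ vars (2 * n + 2) n) = zeta'"
  by (auto simp: fun_eq_iff inst_def zeta'_def nth_append nth_Cons')

lemma inst_omega: "inst (3 * n + 3)
   (Var 0 # vars 3 n @ Var 1 # vars (n + 3) n @ Var 2 # vars (2 * n + 3) n) = omega n"
  by (auto simp: fun_eq_iff inst_def omega_def nth_append nth_Cons')

lemma inst_nu: "inst (3 * n + 3) (Var 0 # Var (n + 1) # Var (2 * n + 2) #
   vars 1 n @ vars (n + 2) n @ vars (2 * n + 3) n) = nu n"
  by (auto simp: fun_eq_iff inst_def nu_def nth_append nth_Cons')

lemma nu_omega: "subst (nu n) (omega n i) = Var i"
  by (auto simp: nu_def omega_def)

text \<open>On expressions, the substitution \<open>\<delta>\<close> of \<open>J_ctx\<close> first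
  reorders so that y, y', q come last and then restricts along the diagonal of
  \<open>\<Lambda>\<close> alone. The factorization lets typing and computation be treated stage by
  stage.\<close>

lemma inst_delta: "inst (length \<Lambda> + 3) (Var 0 # map (wk 3) (refl_ctx \<Lambda>) @ Var 1 # vars 3 (length \<Lambda>) @
    Var 2 # vars 3 (length \<Lambda>)) = (\<lambda>i. subst (lift 3 (dg \<Lambda>)) (omega (length \<Lambda>) i))"
proof -
  have "inst (n + 3) (Var 0 # map (wk 3) r @ Var 1 # vars 3 n @ Var 2 # vars 3 n) i =
    subst (lift 3 (\<lambda>i. if i < n then r ! i else if i < 2 * n then Var (i - n) else Var (i - 2 * n))) (omega n i)"
    if "length r = n" for r :: "'f expr list" and n i
    using that by (auto simp: inst_def omega_def lift_def nth_append nth_Cons'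
      simp flip: length_greater_0_conv)
  from this[of "refl_ctx \<Lambda>" "length \<Lambda>"] show ?thesis
    by (simp add: fun_eq_iff dg_def[abs_def])
qed

lemma diag_simps [simp]:
  "diag A 0 = Refl (wk 1 A) (Var 0)" "diag A (Suc 0) = Var 0" "diag A 2 = Var 0"
  "diag A (Suc (Suc 0)) = Var 0" "diag A (i + 3) = Var (i + 1)" "diag A (Suc (Suc (Suc i))) = Var (i + 1)"
  by (auto simp: diag_def inst_def numeral_eq_Suc)

text \<open>The diagonal of \<open>D # \<Lambda>\<close> is reached in two stages, p = r(x) and then
  q = r(y). This equation is the source of the computation rule for longer contexts.\<close>

lemma dg_nu: "subst (dg (D # \<Lambda>)) (nu (length \<Lambda>) i) = subst (diag D) (lift 3 (dg \<Lambda>) i)"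
proof -
  have d: "diag D (i + 3) = Var (i + 1)" "3 \<le> i \<Longrightarrow> diag D i = Var (i - 2)" for i
    by (auto simp: diag_def inst_def)
  show ?thesis
  proof (cases "i < 3")
    case True
    \<comment> \<open>These variables are q, y' and y, on which the diagonal of
      \<open>\<Lambda>\<close> does not act.\<close>
    then have "i = 0 \<or> i = 1 \<or> i = 2" by auto
    then show ?thesis by (auto simp: dg_def nu_def lift_def)
  next
    case False
    then show ?thesis
      by (auto simp: dg_def nu_def lift_def subst_wk d wk_eq_subst nth_Cons')
  qed
qed

lemma diag_delta:
  "subst (diag D) (subst (lift 3 (dg \<Lambda>)) (omega (length \<Lambda>) i)) = dg (D # \<Lambda>) i"
proof -
  have "subst (diag D) (subst (lift 3 (dg \<Lambda>)) (omega (length \<Lambda>) i)) =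
     subst (dg (D # \<Lambda>)) (subst (nu (length \<Lambda>)) (omega (length \<Lambda>) i))"
    by (simp add: dg_nu)
  then show ?thesis by (simp add: nu_omega del: subst_subst)
qed

text \<open>The type of the new entry q over x, y, x', y', p; splitting it off leaves a renamed copy
  of the shorter identity context.\<close>

definition id_ty :: "'f ctx \<Rightarrow> 'f expr \<Rightarrow> 'f expr" where
  "id_ty \<Lambda> D = (let n = length \<Lambda> in
    Id (subst (\<lambda>i. Var (i + (2 * n + 2))) D) (Var (2 * n + 1)) (subst (zeta n) (transport \<Lambda> D)))"

lemma inst_vars_shift:
  "inst (3 * n) (vars (2 * n) n) = (\<lambda>i. Var (i + 2 * n))"
  "inst (3 * n + 1) (vars (2 * n + 1) n) = (\<lambda>i. Var (i + (2 * n + 1)))"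
  "inst (3 * n + 2) (vars (2 * n + 2) n) = (\<lambda>i. Var (i + (2 * n + 2)))"
  by (auto simp: fun_eq_iff inst_def)

lemma Id_ctx_gen_Cons:
  "Id_ctx_gen (D # \<Lambda>) = id_ty \<Lambda> D # subst_tele (kappa (length \<Lambda>)) (Id_ctx_gen \<Lambda>)"
  unfolding Id_ctx_gen.simps Let_def inst_kappa inst_zeta id_ty_def inst_vars_shift ..

text \<open>The telescope \<open>y : D(x), y' : D(x'), q : Id(y, p\<^sup>*y')\<close> over \<open>id_ctx \<Lambda>\<close>.\<close>

definition post :: "'f ctx \<Rightarrow> 'f expr \<Rightarrow> 'f ctx" where
  "post \<Lambda> D = (let n = length \<Lambda> in
    [Id (subst (\<lambda>i. Var (i + (2 * n + 2))) D) (Var 1) (subst zeta' (transport \<Lambda> D)),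
     subst (\<lambda>i. Var (i + (n + 1))) D, subst (\<lambda>i. Var (i + 2 * n)) D])"

lemma length_post [simp]: "length (post \<Lambda> D) = 3"
  by (simp add: post_def Let_def)

text \<open>The two substitutions in the type of z differ past the variables of
  \<open>\<Lambda>\<close>, where \<open>D\<close> has none.\<close>

lemma transport_eq:
  assumes "scoped (length \<Lambda>) D"
  shows "transport \<Lambda> D = J_ctx \<Lambda> [subst (\<lambda>i. Var (i + length \<Lambda>)) D]
    (subst (\<lambda>i. Var (i + (2 * length \<Lambda> + 1))) D) (Var 0)"
proof -
  have "subst (inst (3 * length \<Lambda>) (vars (length \<Lambda>) (length \<Lambda>))) D = subst (\<lambda>i. Var (i + length \<Lambda>)) D"
    using assms by (intro subst_cong) (auto simp: inst_def)
  then show ?thesis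
    unfolding transport_def Let_def inst_vars_shift by simp
qed

lemma J_ctx_Cons:
  assumes "scoped (length \<Lambda>) D"
  defines "\<delta> \<equiv> \<lambda>i. subst (lift 3 (dg \<Lambda>)) (omega (length \<Lambda>) i)"
  shows "J_ctx (D # \<Lambda>) \<Delta> C d = subst (lift (length \<Delta>) (nu (length \<Lambda>)))
    (J_ctx \<Lambda> (subst_tele (omega (length \<Lambda>)) \<Delta> @ post \<Lambda> D) (subst (lift (length \<Delta>) (omega (length \<Lambda>))) C)
      (J_gen D (subst_tele \<delta> \<Delta>) (subst (lift (length \<Delta>) \<delta>) C) d))"
proof -
  have "subst (inst (3 * length \<Lambda> + 1) (vars (length \<Lambda> + 1) (length \<Lambda>))) D = subst (\<lambda>i. Var (i + (length \<Lambda> + 1))) D"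
    using assms by (intro subst_cong) (auto simp: inst_def)
  then show ?thesis
    unfolding J_ctx.simps Let_def inst_zeta' inst_omega inst_nu inst_delta post_def \<delta>_def
      transport_def inst_vars_shift by simp
qed

declare Id_ctx_gen.simps(2) [simp del] J_ctx.simps(2) [simp del]

context identity_type_theory
begin

text \<open>What the induction on contexts establishes, for definitionally equal \<open>\<Lambda>\<close> and \<open>\<Lambda>'\<close>.\<close>

definition elim_ok :: "'a ctx \<Rightarrow> 'a ctx \<Rightarrow> bool" where
  "elim_ok \<Lambda> \<Lambda>' \<longleftrightarrow> eq_tele S [] (id_ctx \<Lambda>) (id_ctx \<Lambda>') \<and> seq \<Lambda> (dg \<Lambda>) (dg \<Lambda>') (id_ctx \<Lambda>) \<and>
    (\<forall>\<Delta> \<Delta>' C C' d d'. eq_tele S (id_ctx \<Lambda>) \<Delta> \<Delta>' \<longrightarrow> eq_type S (\<Delta> @ id_ctx \<Lambda>) C C' \<longrightarrow>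
      eq_term S (subst_tele (dg \<Lambda>) \<Delta> @ \<Lambda>) d d' (subst (lift (length \<Delta>) (dg \<Lambda>)) C) \<longrightarrow>
      eq_term S (\<Delta> @ id_ctx \<Lambda>) (J_ctx \<Lambda> \<Delta> C d) (J_ctx \<Lambda>' \<Delta>' C' d') C \<and>
      eq_term S (subst_tele (dg \<Lambda>) \<Delta> @ \<Lambda>) (subst (lift (length \<Delta>) (dg \<Lambda>)) (J_ctx \<Lambda> \<Delta> C d)) d
        (subst (lift (length \<Delta>) (dg \<Lambda>)) C))"

lemma elim_ok_Nil: "elim_ok [] []"
proof -
  have [simp]: "dg [] = Var" by (simp add: dg_def fun_eq_iff)
  show ?thesis by (auto simp: elim_ok_def id_ctx_def lift_Var dest: eq_term_left intro: eq_term_refl)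
qed

lemma hom_px: "is_ctx S (id_ctx \<Lambda>) \<Longrightarrow> hom (id_ctx \<Lambda>) (\<lambda>i. Var (i + 2 * length \<Lambda>)) \<Lambda>"
  using hom_wk[of "Id_ctx_gen \<Lambda> @ \<Lambda>" \<Lambda>] by (simp add: id_ctx_def mult_2)

lemma hom_py: "is_ctx S (id_ctx \<Lambda>) \<Longrightarrow> hom (id_ctx \<Lambda>) (\<lambda>i. Var (i + length \<Lambda>)) \<Lambda>"
  using seq_comp[OF hom_wk[of "Id_ctx_gen \<Lambda>" "\<Lambda> @ \<Lambda>"] hom_closed_left[of \<Lambda> \<Lambda>]] is_ctx_append
  by (auto simp: id_ctx_def)

section \<open>The inductive step from \<open>\<Lambda>\<close> to
  \<open>D # \<Lambda>\<close>\<close>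

context
  fixes \<Lambda> \<Lambda>' :: "'a ctx" and D D' :: "'a expr"
  assumes ctx: "eq_tele S [] \<Lambda> \<Lambda>'" and ok: "elim_ok \<Lambda> \<Lambda>'" and D: "eq_type S \<Lambda> D D'"
begin

private abbreviation "n \<equiv> length \<Lambda>"

lemma len': "length \<Lambda>' = n" using eq_tele_length[OF ctx] by simp

lemma D_sc: "scoped n D" "scoped n D'"
  using type_scoped eq_type_left[OF D] eq_type_right[OF D] by auto

lemma ctxs: "is_ctx S \<Lambda>" "is_ctx S (id_ctx \<Lambda>)" "is_ctx S (D # \<Lambda>)" "is_type S \<Lambda> D"
  using ok[unfolded elim_ok_def] seq_ctx eq_type_left[OF D] by auto

lemma elimD:
  assumes "eq_tele S (id_ctx \<Lambda>) \<Delta> \<Delta>'" "eq_type S (\<Delta> @ id_ctx \<Lambda>) C C'"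
    "eq_term S (subst_tele (dg \<Lambda>) \<Delta> @ \<Lambda>) d d' (subst (lift (length \<Delta>) (dg \<Lambda>)) C)"
  shows "eq_term S (\<Delta> @ id_ctx \<Lambda>) (J_ctx \<Lambda> \<Delta> C d) (J_ctx \<Lambda>' \<Delta>' C' d') C"
    "eq_term S (subst_tele (dg \<Lambda>) \<Delta> @ \<Lambda>) (subst (lift (length \<Delta>) (dg \<Lambda>)) (J_ctx \<Lambda> \<Delta> C d)) d
        (subst (lift (length \<Delta>) (dg \<Lambda>)) C)"
  using ok assms unfolding elim_ok_def by blast+

lemma dg_px: "subst (\<lambda>i. dg \<Lambda> (i + 2 * n)) e = e"
  by (simp add: dg_def)

lemma dg_py: "scoped n e \<Longrightarrow> subst (\<lambda>i. dg \<Lambda> (i + n)) e = e"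
  using subst_cong[of n e "\<lambda>i. dg \<Lambda> (i + n)" Var] by (simp add: dg_def)

text \<open>Transport is the induction hypothesis for the post-context z : D(x'), the motive D(x)
  and the branch z. On the diagonal x' is x, so post-context and motive become the same type and the
  computation rule returns z.\<close>

lemma transport:
  "eq_term S (subst (\<lambda>i. Var (i + n)) D # id_ctx \<Lambda>) (transport \<Lambda> D) (transport \<Lambda>' D')
     (subst (\<lambda>i. Var (i + (2 * n + 1))) D)" (is "eq_term S (?Z # _) _ _ ?C")
  "eq_term S (D # \<Lambda>) (subst (lift 1 (dg \<Lambda>)) (transport \<Lambda> D)) (Var 0) (wk 1 D)"
proof -
  have Z: "eq_type S (id_ctx \<Lambda>) ?Z (subst (\<lambda>i. Var (i + n)) D')"
    using seq_eq_type[OF hom_py D] ctxs by simp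
  then have c: "is_ctx S ([?Z] @ id_ctx \<Lambda>)" using ctxs eq_type_left by auto
  have "eq_type S (?Z # id_ctx \<Lambda>) ?C (subst (\<lambda>i. Var (i + (2 * n + 1))) D')"
    using seq_eq_type[OF seq_wk[OF hom_px c] D] ctxs by simp
  moreover have [simp]: "subst (\<lambda>i. dg \<Lambda> (i + n)) D = D" using dg_py D_sc by simp
  have [simp]: "subst (\<lambda>i. lift (Suc 0) (dg \<Lambda>) (Suc (i + 2 * n))) D = wk (Suc 0) D"
    using dg_px[of "D"] wk_subst[of 1 "\<lambda>i. dg \<Lambda> (i + 2 * n)" D] by (simp add: lift_def)
  have "eq_term S (D # \<Lambda>) (Var 0) (Var 0) (wk 1 D)" using ctxs by (intro var_eq) auto
  ultimately show "eq_term S (?Z # id_ctx \<Lambda>) (transport \<Lambda> D) (transport \<Lambda>' D') ?C"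
    "eq_term S (D # \<Lambda>) (subst (lift 1 (dg \<Lambda>)) (transport \<Lambda> D)) (Var 0) (wk 1 D)"
    using elimD[of "[?Z]" "[subst (\<lambda>i. Var (i + n)) D']" ?C "subst (\<lambda>i. Var (i + (2 * n + 1))) D'" "Var 0" "Var 0"] Z
      D_sc ctxs
    by (simp_all add: transport_eq len')
qed

lemma transport_scoped: "scoped (3 * n + 1) (transport \<Lambda> D)"
  using term_presup[OF eq_term_left[OF transport(1)]] by simp

text \<open>\<open>K\<close> is \<open>u, u' : (\<Lambda>, D), p : Id\<^sub>\<Lambda>\<close>, which \<open>id_ctx (D # \<Lambda>)\<close> extends by \<open>q\<close>.\<close>

private abbreviation "B \<equiv> (D # \<Lambda>) @ D # \<Lambda>"
private abbreviation "K \<equiv> subst_tele (kappa n) (Id_ctx_gen \<Lambda>) @ B"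

lemma id_ctx_Cons: "id_ctx (D # \<Lambda>) = id_ty \<Lambda> D # K"
  by (simp add: id_ctx_def Id_ctx_gen_Cons)

lemma B_ctx: "is_ctx S B"
  using is_ctx_closed_append ctxs by blast

text \<open>This is the projection that forgets y and y'; as \<open>\<Lambda>\<close> is closed, its
  two components can be checked separately.\<close>

lemma kappa: "hom B (kappa n) (\<Lambda> @ \<Lambda>)"
proof (rule seq_closed_append)
  have "hom B (\<lambda>i. Var (i + 1)) \<Lambda>"
    using seq_comp[OF hom_wk[of "[D]" "\<Lambda> @ D # \<Lambda>"] hom_closed_left[of \<Lambda> "D # \<Lambda>"]] B_ctx ctxs by simp
  then show "hom B (kappa n) \<Lambda>"
    by (subst seq_cong[where \<sigma>' = "\<lambda>i. Var (i + 1)" and \<tau>' = "\<lambda>i. Var (i + 1)"]) (auto simp: kappa_def)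
  show "hom B (\<lambda>i. kappa n (i + length \<Lambda>)) \<Lambda>"
    using hom_wk[of "D # \<Lambda> @ [D]" "\<Lambda>"] B_ctx by (simp add: kappa_def)
qed

lemma K: "is_ctx S K" "hom K (lift n (kappa n)) (id_ctx \<Lambda>)"
proof -
  have c: "is_ctx S (Id_ctx_gen \<Lambda> @ \<Lambda> @ \<Lambda>)" using ctxs id_ctx_def by metis
  show "is_ctx S K" "hom K (lift n (kappa n)) (id_ctx \<Lambda>)"
    using eq_tele_ctx[OF seq_tele[THEN conjunct1, OF kappa eq_tele_refl[OF c]] B_ctx] seq_lift[OF kappa c]
    by (auto simp: id_ctx_def)
qed

text \<open>Supplies y' for the argument z of \<open>transport\<close>, while x, x' and p go to
  themselves.\<close>

lemma zeta: "hom K (zeta n) (subst (\<lambda>i. Var (i + n)) D # id_ctx \<Lambda>)"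
proof -
  have z: "zeta n (Suc i) = lift n (kappa n) i" for i
    by (auto simp: zeta_def lift_def kappa_def)
  have "eq_term S K (zeta n 0) (zeta n 0) (subst (\<lambda>i. lift n (kappa n) (i + n)) D)"
  proof -
    have "subst (\<lambda>i. lift n (kappa n) (i + n)) D = wk (Suc n) D"
      unfolding wk_eq_subst by (rule subst_cong[OF D_sc(1)]) (auto simp: kappa_def)
    then show ?thesis using K(1)
      by (auto simp: zeta_def nth_append intro!: var_eq)
  qed
  then show ?thesis
    using K subst_typeI[OF hom_py ctxs(4)] ctxs by (simp add: z)
qed

lemma id_ty: "eq_type S K (id_ty \<Lambda> D) (id_ty \<Lambda>' D')"
proof -
  have w: "hom K (\<lambda>i. Var (i + (2 * n + 2))) \<Lambda>"
    using hom_wk[of "subst_tele (kappa n) (Id_ctx_gen \<Lambda>) @ D # \<Lambda> @ [D]" "\<Lambda>"] K(1) by (simp add: mult_2 add.assoc)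
  have "eq_term S K (Var (2 * n + 1)) (Var (2 * n + 1)) (subst (\<lambda>i. Var (i + (2 * n + 2))) D)"
    using K(1) by (intro var_eq) (auto simp: nth_append wk_eq_subst)
  moreover have "subst (\<lambda>i. subst (zeta n) (Var (i + (2 * n + 1)))) D = subst (\<lambda>i. Var (i + (2 * n + 2))) D"
    by (intro arg_cong2[where f = subst]) (auto simp: zeta_def)
  then have "eq_term S K (subst (zeta n) (transport \<Lambda> D)) (subst (zeta n) (transport \<Lambda>' D')) (subst (\<lambda>i. Var (i + (2 * n + 2))) D)"
    using seq_eq_term[OF zeta transport(1)] by simp
  ultimately show ?thesis
    using Id_cong[OF seq_eq_type[OF w D]] by (simp add: id_ty_def Let_def len')
qed

lemma id_ctx_step: "eq_tele S [] (id_ctx (D # \<Lambda>)) (id_ctx (D' # \<Lambda>'))"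
proof -
  have 1: "eq_tele S [] (D # \<Lambda>) (D' # \<Lambda>')" using ctx D by simp
  have "eq_tele S (D # \<Lambda>) (subst_tele Var (D # \<Lambda>)) (subst_tele Var (D' # \<Lambda>'))"
    using seq_tele[of "D # \<Lambda>" Var Var "[]", OF _ 1] ctxs by simp
  with 1 have B: "eq_tele S [] B ((D' # \<Lambda>') @ D' # \<Lambda>')"
    using eq_tele_length[OF 1] eq_tele_append by (simp add: lift_Var)
  have "eq_tele S [] (Id_ctx_gen \<Lambda> @ \<Lambda> @ \<Lambda>) (Id_ctx_gen \<Lambda>' @ \<Lambda>' @ \<Lambda>')"
    using ok by (simp add: elim_ok_def id_ctx_def)
  then have "eq_tele S (\<Lambda> @ \<Lambda>) (Id_ctx_gen \<Lambda>) (Id_ctx_gen \<Lambda>')"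
    using eq_tele_append[of "Id_ctx_gen \<Lambda>" "Id_ctx_gen \<Lambda>'"] len' by simp
  then have "eq_tele S B (subst_tele (kappa n) (Id_ctx_gen \<Lambda>)) (subst_tele (kappa n) (Id_ctx_gen \<Lambda>'))"
    using seq_tele[OF kappa] by blast
  with B id_ty show ?thesis
    using len' eq_tele_append[of "subst_tele (kappa n) (Id_ctx_gen \<Lambda>)" "subst_tele (kappa n) (Id_ctx_gen \<Lambda>')" "[]"]
    by (simp add: id_ctx_Cons) (simp add: id_ctx_def Id_ctx_gen_Cons)
qed

text \<open>The entry for q is r(y) : Id(y, y), while its type on the diagonal is Id(y, z) with z
  the transport of y along r(x). The computation rule of transport equates these types; the
  remaining entries come from \<open>K\<close> being a pullback.\<close>

lemma dg_step: "seq (D # \<Lambda>) (dg (D # \<Lambda>)) (dg (D' # \<Lambda>')) (id_ctx (D # \<Lambda>))"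
proof -
  have kap: "(if i < n then dg (E # \<Gamma>) (Suc i) else subst (\<lambda>i. dg (E # \<Gamma>) (Suc (i + n))) (kappa n (i - n))) = wk 1 (dg \<Gamma> i)"
    if "length \<Gamma> = n" for E :: "'a expr" and \<Gamma> i
    using that by (auto simp: dg_def kappa_def nth_Cons')
  have c: "is_ctx S ([D] @ \<Lambda>)" using ctxs by simp
  have "seq (D # \<Lambda>) (\<lambda>i. dg (D # \<Lambda>) (Suc i)) (\<lambda>i. dg (D' # \<Lambda>') (Suc i)) K"
  proof (rule seq_pullback[OF kappa], goal_cases)
    case 1 show ?case using ctxs(2) by (simp add: id_ctx_def)
  next
    case 2
    have i: "hom (D # \<Lambda>) Var (D # \<Lambda>)" using hom_id ctxs by blast
    show ?case
    proof (rule seq_closed_append)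
      show "seq (D # \<Lambda>) (\<lambda>i. dg (D # \<Lambda>) (Suc (i + length (Id_ctx_gen \<Lambda>))))
         (\<lambda>i. dg (D' # \<Lambda>') (Suc (i + length (Id_ctx_gen \<Lambda>)))) (D # \<Lambda>)"
        by (subst seq_cong[where \<sigma>' = Var and \<tau>' = Var]) (use i in \<open>auto simp: dg_def len' simp del: seq.simps\<close>)
      show "seq (D # \<Lambda>) (\<lambda>i. dg (D # \<Lambda>) (Suc (i + length (D # \<Lambda>) + length (Id_ctx_gen \<Lambda>))))
         (\<lambda>i. dg (D' # \<Lambda>') (Suc (i + length (D # \<Lambda>) + length (Id_ctx_gen \<Lambda>)))) (D # \<Lambda>)"
        by (subst seq_cong[where \<sigma>' = Var and \<tau>' = Var]) (use i in \<open>auto simp: dg_def len' simp del: seq.simps\<close>)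
    qed
  next
    case 3
    have "seq (D # \<Lambda>) (\<lambda>i. wk 1 (dg \<Lambda> i)) (\<lambda>i. wk 1 (dg \<Lambda>' i)) (id_ctx \<Lambda>)"
      using seq_wk[OF _ c] ok by (simp add: elim_ok_def)
    then show ?case
      unfolding length_Id_ctx_gen kap[OF refl] kap[OF len'] id_ctx_def .
  qed
  moreover have "eq_term S (D # \<Lambda>) (dg (D # \<Lambda>) 0) (dg (D' # \<Lambda>') 0) (subst (\<lambda>i. dg (D # \<Lambda>) (Suc i)) (id_ty \<Lambda> D))"
  proof -
    have w: "eq_type S (D # \<Lambda>) (wk 1 D) (wk 1 D')"
      using seq_eq_type[OF hom_wk[OF c] D] by (simp add: wk_eq_subst)
    have v: "eq_term S (D # \<Lambda>) (Var 0) (Var 0) (wk 1 D)"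
      using ctxs by (intro var_eq) auto
    \<comment> \<open>Within the scope of \<open>transport\<close>, z becomes y, and x, x', p are
      placed on the diagonal of \<open>\<Lambda>\<close>.\<close>
    have "subst (\<lambda>i. subst (\<lambda>i. dg (D # \<Lambda>) (Suc i)) (zeta n i)) (transport \<Lambda> D) = subst (lift 1 (dg \<Lambda>)) (transport \<Lambda> D)"
      by (rule subst_cong[OF transport_scoped]) (auto simp: zeta_def dg_def lift_def nth_Cons')
    moreover have "subst (\<lambda>i. dg (D # \<Lambda>) (Suc (i + (2 * n + 2)))) D = wk 1 D"
      by (simp add: dg_def wk_eq_subst)
    ultimately have "eq_type S (D # \<Lambda>) (Id (wk 1 D) (Var 0) (Var 0)) (subst (\<lambda>i. dg (D # \<Lambda>) (Suc i)) (id_ty \<Lambda> D))"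
      using Id_cong[OF eq_type_refl v eq_term_sym[OF transport(2)]] w eq_type_left
      by (simp add: id_ty_def Let_def dg_def[of "D # \<Lambda>" "Suc (Suc (2 * length \<Lambda>))"])
    from conv_eq_term[OF Refl_cong[OF w v] this] show ?thesis by (simp add: dg_def)
  qed
  moreover have "is_type S K (id_ty \<Lambda> D)" using id_ty eq_type_left by blast
  ultimately show ?thesis unfolding id_ctx_Cons by simp
qed

lemma id_ext: "is_ctx S (Id_ext \<Lambda> D)" "hom (D # \<Lambda>) (diag D) (Id_ext \<Lambda> D)"
proof -
  have c2: "is_ctx S ([wk 1 D, D] @ \<Lambda>)"
    using subst_typeI[OF hom_wk[of "[D]" \<Lambda>]] ctxs by (simp add: wk_eq_subst)
  have t: "is_type S ([wk 1 D, D] @ \<Lambda>) (wk 2 D)"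
    using subst_typeI[OF hom_wk[OF c2]] ctxs by (simp add: wk_eq_subst)
  have "has_type S ([wk 1 D, D] @ \<Lambda>) (Var 0) (wk 2 D)" "has_type S ([wk 1 D, D] @ \<Lambda>) (Var 1) (wk 2 D)"
    using var_eq[OF c2, of 0 "wk 2 D"] var_eq[OF c2, of 1 "wk 2 D"] eq_term_left by (auto simp: numeral_2_eq_2)
  then have I: "is_type S (wk 1 D # D # \<Lambda>) (Id (wk 2 D) (Var 1) (Var 0))"
    using Id_form[OF t] by simp
  then show "is_ctx S (Id_ext \<Lambda> D)"
    using type_ctx[OF I] by (simp add: Id_ext_def)
  have v: "eq_term S (D # \<Lambda>) (Var 0) (Var 0) (wk 1 D)"
    using ctxs by (intro var_eq) auto
  have r: "eq_term S (D # \<Lambda>) (Refl (wk 1 D) (Var 0)) (Refl (wk 1 D) (Var 0)) (Id (wk 1 D) (Var 0) (Var 0))"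
    using eq_term_refl[OF Id_intro[OF eq_term_left[OF v]]] .
  show "hom (D # \<Lambda>) (diag D) (Id_ext \<Lambda> D)"
    using hom_wk[of "[D]" \<Lambda>] v r I c2 ctxs
    by (auto simp: Id_ext_def wk_eq_subst)
qed

private abbreviation "G \<equiv> post \<Lambda> D @ id_ctx \<Lambda>"

lemma post: "eq_tele S (id_ctx \<Lambda>) (post \<Lambda> D) (post \<Lambda>' D')" "is_ctx S G"
proof -
  let ?Y = "subst (\<lambda>i. Var (i + 2 * n)) D" and ?Y' = "subst (\<lambda>i. Var (i + (n + 1))) D"
  have Y: "eq_type S (id_ctx \<Lambda>) ?Y (subst (\<lambda>i. Var (i + 2 * n)) D')"
    using seq_eq_type[OF hom_px D] ctxs by simp
  then have c1: "is_ctx S ([?Y] @ id_ctx \<Lambda>)" using ctxs eq_type_left by auto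
  have Y': "eq_type S (?Y # id_ctx \<Lambda>) ?Y' (subst (\<lambda>i. Var (i + (n + 1))) D')"
    using seq_eq_type[OF seq_wk[OF hom_py c1] D] ctxs by simp
  then have c2: "is_ctx S ([?Y', ?Y] @ id_ctx \<Lambda>)" using c1 eq_type_left by auto
  let ?E = "?Y' # ?Y # id_ctx \<Lambda>"
  have x: "eq_type S ?E (subst (\<lambda>i. Var (i + (2 * n + 2))) D) (subst (\<lambda>i. Var (i + (2 * n + 2))) D')"
    using seq_eq_type[OF seq_wk[OF hom_px c2] D] ctxs by simp
  have y: "eq_term S ?E (Var 1) (Var 1) (subst (\<lambda>i. Var (i + (2 * n + 2))) D)"
    using c2 by (intro var_eq) (auto simp: wk_eq_subst)
  have z: "hom ?E zeta' (subst (\<lambda>i. Var (i + n)) D # id_ctx \<Lambda>)"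
  proof -
    have "eq_term S ?E (Var 0) (Var 0) (subst (\<lambda>i. Var (i + n + 2)) D)"
      using c2 by (intro var_eq) (auto simp: wk_eq_subst)
    then show ?thesis
      using hom_wk[OF c2] subst_typeI[OF hom_py ctxs(4)] ctxs by (simp add: zeta'_def)
  qed
  have "eq_term S ?E (subst zeta' (transport \<Lambda> D)) (subst zeta' (transport \<Lambda>' D')) (subst (\<lambda>i. Var (i + (2 * n + 2))) D)"
    using seq_eq_term[OF z transport(1)] by (simp add: zeta'_def)
  with Y Y' Id_cong[OF x y] show "eq_tele S (id_ctx \<Lambda>) (post \<Lambda> D) (post \<Lambda>' D')"
    by (simp add: post_def Let_def len')
  then show "is_ctx S G" using eq_tele_ctx ctxs by blast
qed

lemma K_weaken: "hom (id_ctx (D # \<Lambda>)) (\<lambda>i. Var (i + 1)) K"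
  using hom_wk[of "[id_ty \<Lambda> D]" K] id_ty eq_type_left K(1) by (simp add: id_ctx_Cons)

lemma id_ctx_Cons_ctx: "is_ctx S (id_ctx (D # \<Lambda>))"
  using dg_step seq_ctx by blast

lemma G_hom_px: "hom G (\<lambda>i. Var (i + (2 * n + 3))) \<Lambda>"
  and G_hom_py: "hom G (\<lambda>i. Var (i + (n + 3))) \<Lambda>"
  using seq_wk[OF hom_px post(2)] seq_wk[OF hom_py post(2)] ctxs by (simp_all add: numeral_3_eq_3)

lemma G_nth: "G ! 0 = Id (subst (\<lambda>i. Var (i + (2 * n + 2))) D) (Var 1) (subst zeta' (transport \<Lambda> D))"
  "G ! 1 = subst (\<lambda>i. Var (i + (n + 1))) D" "G ! 2 = subst (\<lambda>i. Var (i + 2 * n)) D"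
  by (simp_all add: post_def Let_def)

text \<open>Since \<open>K\<close> is a pullback, it suffices to find (x, y) and (x', y') in
  \<open>G\<close> together with the identity triple of \<open>\<Lambda>\<close>. The type of q
  matches because \<open>zeta\<close> and \<open>zeta'\<close> give transport the same
  arguments.\<close>

lemma omega: "hom G (omega n) (id_ctx (D # \<Lambda>))"
proof -
  have "hom G (\<lambda>i. omega n (Suc i)) K"
  proof (rule seq_pullback[OF kappa], goal_cases)
    case 1 show ?case using ctxs(2) by (simp add: id_ctx_def)
  next
    case 2
    have y': "eq_term S G (Var 1) (Var 1) (subst (\<lambda>i. Var (i + (n + 3))) D)"
      using post(2) by (intro var_eq) (auto simp only: G_nth, auto simp: wk_eq_subst numeral_3_eq_3)
    have y: "eq_term S G (Var 2) (Var 2) (subst (\<lambda>i. Var (i + (2 * n + 3))) D)"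
      using post(2) by (intro var_eq) (auto simp only: G_nth, auto simp: wk_eq_subst numeral_3_eq_3)
    have f: "hom G (\<lambda>i. if i = 0 then Var 1 else Var (i + (n + 2))) (D # \<Lambda>)"
      using y' G_hom_py ctxs by (simp add: numeral_3_eq_3)
    have g: "hom G (\<lambda>i. if i = 0 then Var 2 else Var (i + (2 * n + 2))) (D # \<Lambda>)"
      using y G_hom_px ctxs by (simp add: numeral_3_eq_3)
    show ?case
    proof (rule seq_closed_append)
      show "hom G (\<lambda>i. omega n (Suc (i + length (Id_ctx_gen \<Lambda>)))) (D # \<Lambda>)"
        by (subst seq_cong[where \<sigma>' = "\<lambda>i. if i = 0 then Var 1 else Var (i + (n + 2))" and
              \<tau>' = "\<lambda>i. if i = 0 then Var 1 else Var (i + (n + 2))"])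
           (use f in \<open>auto simp: omega_def simp del: seq.simps\<close>)
      show "hom G (\<lambda>i. omega n (Suc (i + length (D # \<Lambda>) + length (Id_ctx_gen \<Lambda>)))) (D # \<Lambda>)"
        by (subst seq_cong[where \<sigma>' = "\<lambda>i. if i = 0 then Var 2 else Var (i + (2 * n + 2))" and
              \<tau>' = "\<lambda>i. if i = 0 then Var 2 else Var (i + (2 * n + 2))"])
           (use g in \<open>auto simp: omega_def simp del: seq.simps\<close>)
    qed
  next
    case 3
    \<comment> \<open>With q, y and y' left out, \<open>omega\<close> is the weakening by the three
      entries of \<open>post\<close>.\<close>
    have e: "(if i < n then omega n (Suc i) else subst (\<lambda>i. omega n (Suc (i + n))) (kappa n (i - n))) = Var (i + 3)" for i
      by (auto simp: omega_def kappa_def)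
    show ?case
      using hom_wk[OF post(2)] unfolding length_Id_ctx_gen e id_ctx_def by simp
  qed
  moreover have "eq_term S G (omega n 0) (omega n 0) (subst (\<lambda>i. omega n (Suc i)) (id_ty \<Lambda> D))"
  proof -
    have "subst (\<lambda>i. subst (\<lambda>i. omega n (Suc i)) (zeta n i)) (transport \<Lambda> D) =
      subst (\<lambda>i. wk 1 (zeta' i)) (transport \<Lambda> D)"
      by (intro arg_cong2[where f = subst]) (auto simp: fun_eq_iff omega_def zeta_def zeta'_def)
    moreover have "subst (\<lambda>i. omega n (Suc (i + (2 * n + 2)))) D = subst (\<lambda>i. Var (i + (2 * n + 3))) D"
      by (intro arg_cong2[where f = subst]) (auto simp: fun_eq_iff omega_def)
    moreover have "omega n (Suc (2 * n + 1)) = (Var 2 :: 'a expr)" by (simp_all add: omega_def)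
    ultimately have "subst (\<lambda>i. omega n (Suc i)) (id_ty \<Lambda> D) = wk (Suc 0) (G ! 0)" (is "?T = _")
      by (simp add: id_ty_def Let_def G_nth wk_eq_subst numeral_3_eq_3 numeral_2_eq_2)
    then have "eq_term S G (Var 0) (Var 0) ?T"
      using post(2) by (intro var_eq) (simp_all del: length_greater_0_conv)
    moreover have "omega n 0 = (Var 0 :: 'a expr)" by (simp add: omega_def)
    ultimately show ?thesis by (simp only:)
  qed
  moreover have "is_type S K (id_ty \<Lambda> D)" using id_ty eq_type_left by blast
  ultimately show ?thesis unfolding id_ctx_Cons by simp
qed

lemma nu: "hom (id_ctx (D # \<Lambda>)) (nu n) G"
proof -
  let ?X = "id_ctx (D # \<Lambda>)"
  note c = id_ctx_Cons_ctx
  have nth: "?X ! (n + 1) = D" "?X ! (2 * n + 2) = D"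
    by (simp_all add: id_ctx_Cons nth_append)
  have b: "hom ?X (\<lambda>i. nu n (i + 3)) (id_ctx \<Lambda>)"
  proof -
    have "(\<lambda>i. nu n (i + 3)) = (\<lambda>i. subst (\<lambda>i. Var (i + 1)) (lift n (kappa n) i) :: 'a expr)"
      by (auto simp: fun_eq_iff nu_def lift_def kappa_def)
    then show ?thesis using seq_comp[OF K_weaken K(2)] by simp
  qed
  have Y: "eq_term S ?X (nu n 2) (nu n 2) (subst (\<lambda>i. nu n (i + 3)) (G ! 2))"
  proof -
    have "subst (\<lambda>i. nu n (i + 3)) (G ! 2) = wk (Suc (2 * n + 2)) D"
      unfolding G_nth wk_eq_subst subst_subst
      by (intro arg_cong2[where f = subst]) (auto simp: fun_eq_iff nu_def)
    moreover have "eq_term S ?X (Var (2 * n + 2)) (Var (2 * n + 2)) (wk (Suc (2 * n + 2)) D)"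
      using c nth by (intro var_eq) auto
    ultimately show ?thesis by (simp add: nu_def)
  qed
  have Y': "eq_term S ?X (nu n 1) (nu n 1) (subst (\<lambda>i. nu n (i + 2)) (G ! 1))"
  proof -
    \<comment> \<open>The type of y' mentions only x'. Past the \<open>n\<close> variables of x',
      \<open>nu\<close> no longer agrees with this weakening, so the scope of \<open>D\<close> is
      used.\<close>
    have "subst (\<lambda>i. nu n (i + 2)) (G ! 1) = wk (Suc (n + 1)) D"
      unfolding G_nth wk_eq_subst subst_subst
      by (rule subst_cong[OF D_sc(1)]) (auto simp: nu_def)
    moreover have "eq_term S ?X (Var (n + 1)) (Var (n + 1)) (wk (Suc (n + 1)) D)"
      using c nth by (intro var_eq) auto
    ultimately show ?thesis by (simp add: nu_def)
  qed
  have Q: "eq_term S ?X (nu n 0) (nu n 0) (subst (\<lambda>i. nu n (Suc i)) (G ! 0))"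
  proof -
    have "subst (\<lambda>i. nu n (Suc i)) (subst zeta' (transport \<Lambda> D)) = wk 1 (subst (zeta n) (transport \<Lambda> D))"
      unfolding wk_eq_subst subst_subst
      by (intro arg_cong2[where f = subst]) (auto simp: fun_eq_iff nu_def zeta_def zeta'_def)
    moreover have "subst (\<lambda>i. nu n (Suc i)) (subst (\<lambda>i. Var (i + (2 * n + 2))) D) = wk 1 (subst (\<lambda>i. Var (i + (2 * n + 2))) D)"
      unfolding wk_eq_subst subst_subst
      by (intro arg_cong2[where f = subst]) (auto simp: fun_eq_iff nu_def)
    moreover have "nu n (Suc 1) = (wk 1 (Var (2 * n + 1)) :: 'a expr)" by (simp add: nu_def)
    ultimately have "subst (\<lambda>i. nu n (Suc i)) (G ! 0) = wk 1 (id_ty \<Lambda> D)"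
      unfolding G_nth id_ty_def Let_def subst_Id wk_eq_subst by (simp only: subst.simps)
    moreover have "eq_term S ?X (Var 0) (Var 0) (wk 1 (id_ty \<Lambda> D))"
      using c by (intro var_eq) (auto simp: id_ctx_Cons)
    ultimately show ?thesis by (simp add: nu_def)
  qed
  obtain q y' y where G: "post \<Lambda> D = [q, y', y]" by (simp add: post_def Let_def)
  show ?thesis
    using b Y Y' Q post(2) unfolding G by (simp add: numeral_3_eq_3 numeral_2_eq_2)
qed

text \<open>After p is set to r(x), q has type Id(y, z) with z the transport of y' along r(x),
  whereas in \<open>Id_ext \<Lambda> D\<close> it has type Id(y, y'). These contexts are only
  definitionally equal, so the lifted diagonal is typed after converting its source.\<close>

lemma delta:
  "hom (Id_ext \<Lambda> D) (lift 3 (dg \<Lambda>)) G"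
  "seq (Id_ext \<Lambda> D) (lift 3 (dg \<Lambda>)) (lift 3 (dg \<Lambda>')) G"
  "eq_tele S [] (Id_ext \<Lambda> D) (subst_tele (dg \<Lambda>) (post \<Lambda> D) @ \<Lambda>)"
proof -
  have dg: "seq \<Lambda> (dg \<Lambda>) (dg \<Lambda>') (id_ctx \<Lambda>)" using ok by (simp add: elim_ok_def)
  have 1: "subst (dg \<Lambda>) (subst (\<lambda>i. Var (i + 2 * n)) D) = D" by (simp add: dg_px)
  have 2: "subst (lift 1 (dg \<Lambda>)) (subst (\<lambda>i. Var (i + (n + 1))) D) = wk 1 D"
    using dg_py[OF D_sc(1)] wk_subst[of 1 "\<lambda>i. dg \<Lambda> (i + n)" D] by (simp add: lift_def)
  have 3: "subst (lift 2 (dg \<Lambda>)) (subst (\<lambda>i. Var (i + (2 * n + 2))) D) = wk 2 D"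
    using dg_px[of D] wk_subst[of 2 "\<lambda>i. dg \<Lambda> (i + 2 * n)" D] by (simp add: lift_def)
  have c2: "is_ctx S ([wk 1 D, D] @ \<Lambda>)" "is_type S ([wk 1 D, D] @ \<Lambda>) (wk 2 D)"
    "has_type S ([wk 1 D, D] @ \<Lambda>) (Var 1) (wk 2 D)"
  proof -
    show c: "is_ctx S ([wk 1 D, D] @ \<Lambda>)" using id_ext(1) by (simp add: Id_ext_def)
    show "is_type S ([wk 1 D, D] @ \<Lambda>) (wk 2 D)"
      using subst_typeI[OF hom_wk[OF c]] ctxs by (simp add: wk_eq_subst)
    show "has_type S ([wk 1 D, D] @ \<Lambda>) (Var 1) (wk 2 D)"
      using var_eq[OF c, of 1 "wk 2 D"] eq_term_left by (auto simp: numeral_2_eq_2)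
  qed
  have w: "hom ([wk 1 D, D] @ \<Lambda>) (\<lambda>i. if i = 0 then Var 0 else Var (i + 1)) (D # \<Lambda>)"
  proof -
    have "eq_term S ([wk 1 D, D] @ \<Lambda>) (Var 0) (Var 0) (wk 2 D)"
      using c2 by (intro var_eq) (auto simp: numeral_2_eq_2)
    then show ?thesis using hom_wk[OF c2(1)] ctxs by (simp add: wk_eq_subst)
  qed
  \<comment> \<open>The computation rule of transport, instantiated at y' along the renaming of
    \<open>w\<close>, which leaves out y.\<close>
  have t: "eq_term S ([wk 1 D, D] @ \<Lambda>) (subst (lift 2 (dg \<Lambda>)) (subst zeta' (transport \<Lambda> D))) (Var 0) (wk 2 D)"
  proof -
    have "subst (lift 2 (dg \<Lambda>)) (subst zeta' (transport \<Lambda> D)) =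
       subst (\<lambda>i. if i = 0 then Var 0 else Var (i + 1)) (subst (lift 1 (dg \<Lambda>)) (transport \<Lambda> D))"
      unfolding subst_subst
      by (intro arg_cong2[where f = subst]) (auto simp: fun_eq_iff zeta'_def lift_def subst_wk wk_eq_subst numeral_2_eq_2)
    then show ?thesis using seq_eq_term[OF w transport(2)] by (simp add: subst_wk wk_eq_subst)
  qed
  have "subst_tele (dg \<Lambda>) (post \<Lambda> D) = [Id (wk 2 D) (Var 1) (subst (lift 2 (dg \<Lambda>)) (subst zeta' (transport \<Lambda> D))), wk 1 D, D]"
    using 1 2 3 unfolding post_def Let_def
    by (simp add: numeral_2_eq_2 lift_def[of "Suc (Suc 0)" _ "Suc 0"] del: subst_subst)
  moreover have "eq_type S ([wk 1 D, D] @ \<Lambda>) (Id (wk 2 D) (Var 1) (Var 0))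
      (Id (wk 2 D) (Var 1) (subst (lift 2 (dg \<Lambda>)) (subst zeta' (transport \<Lambda> D))))"
    using Id_cong[OF eq_type_refl[OF c2(2)] eq_term_refl[OF c2(3)] eq_term_sym[OF t]] .
  moreover have "eq_tele S [] (wk 1 D # D # \<Lambda>) (wk 1 D # D # \<Lambda>)"
    using eq_tele_refl[of "wk 1 D # D # \<Lambda>" "[]"] c2 by simp
  ultimately show conv: "eq_tele S [] (Id_ext \<Lambda> D) (subst_tele (dg \<Lambda>) (post \<Lambda> D) @ \<Lambda>)"
    by (simp add: Id_ext_def)
  show s: "seq (Id_ext \<Lambda> D) (lift 3 (dg \<Lambda>)) (lift 3 (dg \<Lambda>')) G"
    using seq_lift[OF dg post(2)] seq_conv_source[OF eq_ctx_sym[OF conv]] by simp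
  then show "hom (Id_ext \<Lambda> D) (lift 3 (dg \<Lambda>)) G" by (rule seq_left)
qed

text \<open>On p = r(x) the hypothesis for \<open>\<Lambda>\<close> reduces the outer elimination to
  its branch \<open>?d1\<close>; on q = r(y) the rule \<open>Id_comp\<close> reduces
  \<open>?d1\<close> to \<open>d\<close>. By \<open>dg_nu\<close> the two restrictions together form
  the diagonal of \<open>D # \<Lambda>\<close>.\<close>

lemma elim_step:
  assumes \<Delta>: "eq_tele S (id_ctx (D # \<Lambda>)) \<Delta> \<Delta>'" and C: "eq_type S (\<Delta> @ id_ctx (D # \<Lambda>)) C C'"
    and d: "eq_term S (subst_tele (dg (D # \<Lambda>)) \<Delta> @ D # \<Lambda>) d d' (subst (lift (length \<Delta>) (dg (D # \<Lambda>))) C)"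
  shows "eq_term S (\<Delta> @ id_ctx (D # \<Lambda>)) (J_ctx (D # \<Lambda>) \<Delta> C d) (J_ctx (D' # \<Lambda>') \<Delta>' C' d') C"
    "eq_term S (subst_tele (dg (D # \<Lambda>)) \<Delta> @ D # \<Lambda>) (subst (lift (length \<Delta>) (dg (D # \<Lambda>))) (J_ctx (D # \<Lambda>) \<Delta> C d)) d
      (subst (lift (length \<Delta>) (dg (D # \<Lambda>))) C)"
proof -
  define m where "m = length \<Delta>"
  have m': "length \<Delta>' = m" using eq_tele_length[OF \<Delta>] m_def by simp
  define \<delta> where "\<delta> = (\<lambda>i. subst (lift 3 (dg \<Lambda>)) (omega n i))"
  define \<delta>' where "\<delta>' = (\<lambda>i. subst (lift 3 (dg \<Lambda>')) (omega n i))"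
  have \<delta>: "hom (Id_ext \<Lambda> D) \<delta> (id_ctx (D # \<Lambda>))" "seq (Id_ext \<Lambda> D) \<delta> \<delta>' (id_ctx (D # \<Lambda>))"
    unfolding \<delta>_def \<delta>'_def by (rule seq_comp[OF delta(1) omega], rule seq_comp[OF delta(2) omega])
  have diag: "(\<lambda>i. subst (diag D) (\<delta> i)) = dg (D # \<Lambda>)"
    unfolding \<delta>_def by (rule ext) (rule diag_delta)
  have t: "subst_tele (diag D) (subst_tele \<delta> \<Delta>) = subst_tele (dg (D # \<Lambda>)) \<Delta>"
    "subst (lift m (diag D)) (subst (lift m \<delta>) C) = subst (lift m (dg (D # \<Lambda>))) C"
    by (simp_all add: diag lift_comp)
  let ?\<Delta>1 = "subst_tele \<delta> \<Delta>" and ?C1 = "subst (lift m \<delta>) C"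
  let ?d1 = "J_gen D ?\<Delta>1 ?C1 d" and ?d1' = "J_gen D' (subst_tele \<delta>' \<Delta>') (subst (lift m \<delta>') C') d'"
  note l\<delta> = seq_tele[OF \<delta>(1) \<Delta>] seq_tele[OF \<delta>(2) \<Delta>]
  have C1: "eq_type S (?\<Delta>1 @ Id_ext \<Lambda> D) ?C1 (subst (lift m \<delta>') C')"
    using seq_eq_type[OF l\<delta>(2)[THEN conjunct2] C] m_def by simp
  have J1: "eq_term S (?\<Delta>1 @ Id_ext \<Lambda> D) ?d1 ?d1' ?C1"
    using l\<delta>(2) C1 d by (intro J_cong[OF D]) (auto simp: m_def[symmetric] t simp del: subst_tele_subst_tele subst_subst)
  have Jc: "eq_term S (subst_tele (dg (D # \<Lambda>)) \<Delta> @ D # \<Lambda>) (subst (lift m (diag D)) ?d1) d (subst (lift m (dg (D # \<Lambda>))) C)"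
    using Id_comp[of ?\<Delta>1 \<Lambda> D ?C1 d] eq_type_left[OF C1] eq_term_left[OF d] by (simp add: m_def[symmetric] t del: subst_tele_subst_tele subst_subst)
  let ?\<Delta>2 = "subst_tele (omega n) \<Delta> @ post \<Lambda> D" and ?C2 = "subst (lift m (omega n)) C"
  let ?\<Delta>2' = "subst_tele (omega n) \<Delta>' @ post \<Lambda>' D'" and ?C2' = "subst (lift m (omega n)) C'"
  note l\<omega> = seq_tele[OF omega \<Delta>]
  have \<Delta>2: "eq_tele S (id_ctx \<Lambda>) ?\<Delta>2 ?\<Delta>2'"
    using l\<omega> post(1) m' m_def by (subst eq_tele_append) auto
  have C2: "eq_type S (?\<Delta>2 @ id_ctx \<Lambda>) ?C2 ?C2'"
    using seq_eq_type[OF l\<omega>[THEN conjunct2] C] m_def by simp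
  have s2: "subst_tele (dg \<Lambda>) ?\<Delta>2 = ?\<Delta>1 @ subst_tele (dg \<Lambda>) (post \<Lambda> D)"
    by (simp add: subst_tele_append \<delta>_def)
  have s2': "subst (lift (length ?\<Delta>2) (dg \<Lambda>)) ?C2 = ?C1"
    unfolding \<delta>_def lift_comp[symmetric] by (simp add: m_def)
  \<comment> \<open>The left context is where elimination for \<open>D\<close> produces its result,
    the right one is where the hypothesis for \<open>\<Lambda>\<close> expects its branch.\<close>
  have conv: "eq_tele S [] (?\<Delta>1 @ Id_ext \<Lambda> D) (subst_tele (dg \<Lambda>) ?\<Delta>2 @ \<Lambda>)"
    unfolding s2 append_assoc
    using delta(3) eq_tele_refl[OF eq_tele_ctx[OF l\<delta>(1)[THEN conjunct1] id_ext(1)]] by (subst eq_tele_append) auto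
  have d2: "eq_term S (subst_tele (dg \<Lambda>) ?\<Delta>2 @ \<Lambda>) ?d1 ?d1' (subst (lift (length ?\<Delta>2) (dg \<Lambda>)) ?C2)"
    unfolding s2' by (rule eq_term_conv[OF conv J1])
  note E = elimD[OF \<Delta>2 C2 d2]
  have J: "J_ctx (D # \<Lambda>) \<Delta> C d = subst (lift m (nu n)) (J_ctx \<Lambda> ?\<Delta>2 ?C2 ?d1)"
    "J_ctx (D' # \<Lambda>') \<Delta>' C' d' = subst (lift m (nu n)) (J_ctx \<Lambda>' ?\<Delta>2' ?C2' ?d1')"
    using J_ctx_Cons[OF D_sc(1)] J_ctx_Cons[of \<Lambda>' D'] D_sc(2) len' m' by (simp_all add: \<delta>_def \<delta>'_def m_def)
  have rt: "subst_tele (nu n) (subst_tele (omega n) \<Delta>) = \<Delta>" "subst (lift m (nu n)) ?C2 = C"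
    by (simp_all add: lift_comp nu_omega lift_Var)
  have c\<omega>: "is_ctx S (subst_tele (omega n) \<Delta> @ G)" using eq_tele_ctx[OF l\<omega>[THEN conjunct1] post(2)] .
  \<comment> \<open>Renaming along \<open>nu\<close> restores the original order, since it undoes
    \<open>omega\<close> on the post-context and the motive.\<close>
  have "hom (\<Delta> @ id_ctx (D # \<Lambda>)) (lift m (nu n)) (subst_tele (omega n) \<Delta> @ G)"
    using seq_lift[OF nu c\<omega>] unfolding rt by (simp add: m_def)
  from seq_eq_term[OF this E(1)[unfolded append_assoc]]
  show "eq_term S (\<Delta> @ id_ctx (D # \<Lambda>)) (J_ctx (D # \<Lambda>) \<Delta> C d) (J_ctx (D' # \<Lambda>') \<Delta>' C' d') C"
    unfolding J rt .
  \<comment> \<open>The hypothesis computes the eliminator where p = r(x); restricting further along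
    \<open>diag D\<close> sets y' = y and q = r(y).\<close>
  have "hom (subst_tele (dg (D # \<Lambda>)) \<Delta> @ D # \<Lambda>) (lift m (diag D)) (?\<Delta>1 @ Id_ext \<Lambda> D)"
    using seq_lift[OF id_ext(2) eq_tele_ctx[OF l\<delta>(1)[THEN conjunct1] id_ext(1)]] unfolding t by (simp add: m_def)
  from seq_eq_term[OF this eq_term_conv[OF eq_ctx_sym[OF conv] E(2)]]
  have "eq_term S (subst_tele (dg (D # \<Lambda>)) \<Delta> @ D # \<Lambda>)
     (subst (lift m (diag D)) (subst (lift (length ?\<Delta>2) (dg \<Lambda>)) (J_ctx \<Lambda> ?\<Delta>2 ?C2 ?d1)))
     (subst (lift m (diag D)) ?d1) (subst (lift m (dg (D # \<Lambda>))) C)"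
    unfolding s2' t .
  moreover have "subst (lift m (diag D)) (subst (lift (length ?\<Delta>2) (dg \<Lambda>)) e) = subst (lift m (dg (D # \<Lambda>))) (subst (lift m (nu n)) e)" for e
  proof -
    have "lift (length ?\<Delta>2) (dg \<Lambda>) = lift m (lift 3 (dg \<Lambda>))" by (simp add: m_def)
    then show ?thesis by (simp add: lift_comp dg_nu del: lift_lift)
  qed
  ultimately show "eq_term S (subst_tele (dg (D # \<Lambda>)) \<Delta> @ D # \<Lambda>) (subst (lift (length \<Delta>) (dg (D # \<Lambda>))) (J_ctx (D # \<Lambda>) \<Delta> C d)) d
      (subst (lift (length \<Delta>) (dg (D # \<Lambda>))) C)"
    unfolding J m_def[symmetric] using eq_term_trans[OF _ Jc] by simp
qed

end

lemma elim_ok: "eq_tele S [] \<Lambda> \<Lambda>' \<Longrightarrow> elim_ok \<Lambda> \<Lambda>'"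
proof -
  assume e: "eq_tele S [] \<Lambda> \<Lambda>'"
  from eq_tele_length[OF e] e show ?thesis
  proof (induction \<Lambda> \<Lambda>' rule: list_induct2)
    case Nil show ?case by (rule elim_ok_Nil)
  next
    case (Cons D \<Lambda> D' \<Lambda>')
    then have "eq_tele S [] \<Lambda> \<Lambda>'" "elim_ok \<Lambda> \<Lambda>'" "eq_type S \<Lambda> D D'" by auto
    note p = this
    show ?case
      unfolding elim_ok_def using id_ctx_step[OF p] dg_step[OF p] elim_step[OF p] by blast
  qed
qed

end

section \<open>The groupoid of a context\<close>

lemma set_subst_tele: "A \<in> set (subst_tele \<sigma> \<Theta>) \<Longrightarrow> \<exists>B\<in>set \<Theta>. \<exists>\<rho>. A = subst \<rho> B"
  by (induction \<Theta>) auto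

context discrete_identity_type_theory
begin

section \<open>Elimination into telescopes, and uniqueness from discreteness\<close>

declare seq_trans [trans]

lemma seq_congI:
  "seq \<Gamma> \<sigma>' \<tau>' \<Delta> \<Longrightarrow> (\<And>i. i < length \<Delta> \<Longrightarrow> \<sigma> i = \<sigma>' i) \<Longrightarrow> (\<And>i. i < length \<Delta> \<Longrightarrow> \<tau> i = \<tau>' i) \<Longrightarrow> seq \<Gamma> \<sigma> \<tau> \<Delta>"
  using seq_cong[of \<Delta> \<sigma> \<sigma>' \<tau> \<tau>'] by blast

lemma dg_cong: "eq_tele S [] L L' \<Longrightarrow> seq L (dg L) (dg L') (id_ctx L)"
  and id_ctx_cong: "eq_tele S [] L L' \<Longrightarrow> eq_tele S [] (id_ctx L) (id_ctx L')"
  using elim_ok by (auto simp: elim_ok_def)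

lemma dg_hom: "is_ctx S L \<Longrightarrow> hom L (dg L) (id_ctx L)"
  using dg_cong eq_tele_refl[of L "[]"] by simp

lemma id_ctx_ctx: "is_ctx S L \<Longrightarrow> is_ctx S (id_ctx L)"
  using dg_hom seq_ctx by blast

text \<open>From here on an eliminator enters only through its typing and its computation rule, so
  bare existence is what the later constructions ask for.\<close>

lemma elim_term:
  assumes L: "is_ctx S L" and C: "is_type S (\<Delta> @ id_ctx L) C"
    and d: "has_type S (subst_tele (dg L) \<Delta> @ L) d (subst (lift (length \<Delta>) (dg L)) C)"
  shows "\<exists>t. has_type S (\<Delta> @ id_ctx L) t C \<and>
    eq_term S (subst_tele (dg L) \<Delta> @ L) (subst (lift (length \<Delta>) (dg L)) t) d (subst (lift (length \<Delta>) (dg L)) C)"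
proof -
  have "elim_ok L L" using elim_ok eq_tele_refl[of L "[]"] L by simp
  moreover have "eq_tele S (id_ctx L) \<Delta> \<Delta>" using eq_tele_refl type_ctx[OF C] by blast
  ultimately show ?thesis
    using eq_type_refl[OF C] eq_term_refl[OF d] eq_term_left unfolding elim_ok_def by blast
qed

text \<open>The morphism \<open>b\<close> into \<open>W\<close> is kept literally and only the
  entries of \<open>\<Theta>\<close> are eliminated, so the ends of a 2-cell built this way are
  known exactly. Each next type is computed at \<open>c\<close> rather than \<open>e\<close>; on the
  diagonal the two agree by the part already built.\<close>

lemma elim_tele:
  assumes L: "is_ctx S L" and X: "hom (\<Delta> @ id_ctx L) b W"
    and e: "hom (subst_tele (dg L) \<Delta> @ L) e (\<Theta> @ W)"
    and be: "seq (subst_tele (dg L) \<Delta> @ L) (\<lambda>i. e (i + length \<Theta>)) (\<lambda>i. subst (lift (length \<Delta>) (dg L)) (b i)) W"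
  shows "\<exists>c. hom (\<Delta> @ id_ctx L) c (\<Theta> @ W) \<and> (\<forall>i. c (i + length \<Theta>) = b i) \<and>
    seq (subst_tele (dg L) \<Delta> @ L) (\<lambda>i. subst (lift (length \<Delta>) (dg L)) (c i)) e (\<Theta> @ W)"
  using e be
proof (induction \<Theta> arbitrary: e)
  case Nil then show ?case using X seq_sym[OF Nil(2)] by (intro exI[of _ b]) simp
next
  case (Cons A \<Theta>)
  let ?D = "lift (length \<Delta>) (dg L)"
  obtain c where c: "hom (\<Delta> @ id_ctx L) c (\<Theta> @ W)" "\<And>i. c (i + length \<Theta>) = b i"
    "seq (subst_tele (dg L) \<Delta> @ L) (\<lambda>i. subst ?D (c i)) (\<lambda>i. e (Suc i)) (\<Theta> @ W)"
    using Cons.IH[of "\<lambda>i. e (Suc i)"] Cons.prems by auto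
  have A: "is_type S (\<Theta> @ W) A" using Cons.prems by simp
  have t: "eq_type S (subst_tele (dg L) \<Delta> @ L) (subst ?D (subst c A)) (subst (\<lambda>i. e (Suc i)) A)"
    using seq_eq_type[OF c(3) eq_type_refl[OF A]] by simp
  have "eq_term S (subst_tele (dg L) \<Delta> @ L) (e 0) (e 0) (subst (\<lambda>i. e (Suc i)) A)"
    using Cons.prems by simp
  from conv_term[OF eq_term_left[OF this] eq_type_sym[OF t]] obtain u where u: "has_type S (\<Delta> @ id_ctx L) u (subst c A)"
    "eq_term S (subst_tele (dg L) \<Delta> @ L) (subst ?D u) (e 0) (subst ?D (subst c A))"
    using elim_term[OF L subst_typeI[OF c(1) A]] by blast
  show ?case
    using c u A by (intro exI[of _ "\<lambda>i. case i of 0 \<Rightarrow> u | Suc j \<Rightarrow> c j"]) (auto intro: eq_term_refl)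
qed

text \<open>\<open>discrete\<close> speaks about elements of an identity type, so it applies to the
  entries of \<open>\<Theta>\<close> but not to those of \<open>W\<close>, whose equality has to be
  supplied.\<close>

lemma elim_unique:
  assumes L: "is_ctx S L" and \<Theta>: "\<And>A. A \<in> set \<Theta> \<Longrightarrow> \<exists>T a b. A = Id T a b"
    and "hom (\<Delta> @ id_ctx L) \<sigma> (\<Theta> @ W)" "hom (\<Delta> @ id_ctx L) \<tau> (\<Theta> @ W)"
    and "seq (\<Delta> @ id_ctx L) (\<lambda>i. \<sigma> (i + length \<Theta>)) (\<lambda>i. \<tau> (i + length \<Theta>)) W"
    and "seq (subst_tele (dg L) \<Delta> @ L) (\<lambda>i. subst (lift (length \<Delta>) (dg L)) (\<sigma> i)) (\<lambda>i. subst (lift (length \<Delta>) (dg L)) (\<tau> i)) (\<Theta> @ W)"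
  shows "seq (\<Delta> @ id_ctx L) \<sigma> \<tau> (\<Theta> @ W)"
  using assms(2-)
proof (induction \<Theta> arbitrary: \<sigma> \<tau>)
  case Nil then show ?case by simp
next
  case (Cons A \<Theta>)
  let ?D = "lift (length \<Delta>) (dg L)" and ?X = "\<Delta> @ id_ctx L" and ?Y = "subst_tele (dg L) \<Delta> @ L"
  have tl: "seq ?X (\<lambda>i. \<sigma> (Suc i)) (\<lambda>i. \<tau> (Suc i)) (\<Theta> @ W)"
    by (rule Cons.IH) (use Cons.prems in simp_all)
  obtain T a b where A: "A = Id T a b" using Cons.prems(1)[of A] by auto
  let ?A = "subst (\<lambda>i. \<sigma> (Suc i)) A"
  have At: "is_type S (\<Theta> @ W) A" using Cons.prems by simp
  have e: "eq_type S ?X ?A (subst (\<lambda>i. \<tau> (Suc i)) A)"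
    using seq_eq_type[OF tl eq_type_refl[OF At]] .
  have "eq_term S ?X (\<sigma> 0) (\<sigma> 0) ?A" "eq_term S ?X (\<tau> 0) (\<tau> 0) (subst (\<lambda>i. \<tau> (Suc i)) A)"
    using Cons.prems(2,3) by simp_all
  \<comment> \<open>\<open>\<tau> 0\<close> is typed over its own tail; the equality of the tails
    moves it to the type of \<open>\<sigma> 0\<close>, so that the identity type between the two can
    be formed.\<close>
  note h = eq_term_left[OF this(1)] conv_term[OF eq_term_left[OF this(2)] eq_type_sym[OF e]]
  have C: "is_type S ?X (Id ?A (\<sigma> 0) (\<tau> 0))"
    using Id_form[OF _ h] term_presup[OF h(1)] by blast
  have d: "eq_term S ?Y (subst ?D (\<sigma> 0)) (subst ?D (\<tau> 0)) (subst ?D ?A)"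
    using Cons.prems(5) by simp
  \<comment> \<open>On the diagonal the two values agree, so reflexivity inhabits this identity type
    after a conversion; its extension by elimination is the element fed to
    \<open>discrete\<close>.\<close>
  have "has_type S ?Y (Refl (subst ?D ?A) (subst ?D (\<sigma> 0))) (subst ?D (Id ?A (\<sigma> 0) (\<tau> 0)))"
    using conv_term[OF Id_intro[OF eq_term_left[OF d]] Id_cong[OF eq_type_refl[OF eq_term_type[OF d]] eq_term_refl[OF eq_term_left[OF d]] d]]
    by simp
  from elim_term[OF L C this] obtain u where "has_type S ?X u (Id ?A (\<sigma> 0) (\<tau> 0))" by auto
  then have "eq_term S ?X (\<sigma> 0) (\<tau> 0) ?A"
    using discrete[OF h[unfolded A subst_Id]] by (simp add: A)
  then show ?case using tl At by simp
qed

lemma set_Id_ctx_gen: "A \<in> set (Id_ctx_gen L) \<Longrightarrow> \<exists>T a b. A = Id T a b"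
proof (induction L arbitrary: A)
  case Nil then show ?case by simp
next
  case (Cons D L)
  show ?case
  proof (cases "A = id_ty L D")
    case True then show ?thesis unfolding id_ty_def Let_def by blast
  next
    case False
    then have "A \<in> set (subst_tele (kappa (length L)) (Id_ctx_gen L))"
      using Cons.prems unfolding Id_ctx_gen_Cons by simp
    from set_subst_tele[OF this] obtain B \<rho> where "B \<in> set (Id_ctx_gen L)" "A = subst \<rho> B" by auto
    then show ?thesis using Cons.IH[of B] by (metis subst_Id)
  qed
qed

text \<open>
  A 2-cell over \<open>\<Gamma>\<close> between morphisms into \<open>L\<close> is a morphism from \<open>\<Gamma>\<close> to \<open>id_ctx L\<close>. Only the values
  below \<open>length L\<close> of its ends matter.
\<close>

definition src :: "'a ctx \<Rightarrow> (nat \<Rightarrow> 'a expr) \<Rightarrow> nat \<Rightarrow> 'a expr" where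
  "src L a i = a (i + 2 * length L)"

definition tgt :: "'a ctx \<Rightarrow> (nat \<Rightarrow> 'a expr) \<Rightarrow> nat \<Rightarrow> 'a expr" where
  "tgt L a i = a (i + length L)"

lemma seq_closed_left: "seq \<Gamma> \<sigma> \<tau> (L @ X) \<Longrightarrow> is_ctx S L \<Longrightarrow> seq \<Gamma> \<sigma> \<tau> L"
  using seq_comp[of \<Gamma> \<sigma> \<tau> "L @ X" Var Var L] hom_closed_left[of L X] seq_ctx[of \<Gamma> \<sigma> \<tau> "L @ X"] is_ctx_append[of L X]
  by simp

lemma seq_src: "seq \<Gamma> a a' (id_ctx L) \<Longrightarrow> seq \<Gamma> (src L a) (src L a') L"
  using seq_append[of \<Gamma> a a' "Id_ctx_gen L @ L" L] by (simp add: id_ctx_def src_def[abs_def] mult_2)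

lemma seq_tgt: "seq \<Gamma> a a' (id_ctx L) \<Longrightarrow> seq \<Gamma> (tgt L a) (tgt L a') L"
  using seq_append[of \<Gamma> a a' "Id_ctx_gen L" "L @ L"] seq_closed_left[of \<Gamma> _ _ L L] seq_ctx[OF seq_src]
  by (simp add: id_ctx_def tgt_def[abs_def])

lemma seq_ends:
  "seq \<Gamma> (tgt L a) (tgt L a') L \<Longrightarrow> seq \<Gamma> (src L a) (src L a') L \<Longrightarrow>
    seq \<Gamma> (\<lambda>i. a (i + length L)) (\<lambda>i. a' (i + length L)) (L @ L)"
  by (rule seq_closed_append) (simp_all add: src_def[abs_def] tgt_def[abs_def] mult_2 add.assoc)

lemma cell_unique:
  assumes "is_ctx S L" "hom (\<Delta> @ id_ctx L) \<sigma> (id_ctx \<Phi>)" "hom (\<Delta> @ id_ctx L) \<tau> (id_ctx \<Phi>)"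
    and "seq (\<Delta> @ id_ctx L) (src \<Phi> \<sigma>) (src \<Phi> \<tau>) \<Phi>" "seq (\<Delta> @ id_ctx L) (tgt \<Phi> \<sigma>) (tgt \<Phi> \<tau>) \<Phi>"
    and "seq (subst_tele (dg L) \<Delta> @ L) (\<lambda>i. subst (lift (length \<Delta>) (dg L)) (\<sigma> i)) (\<lambda>i. subst (lift (length \<Delta>) (dg L)) (\<tau> i)) (id_ctx \<Phi>)"
  shows "seq (\<Delta> @ id_ctx L) \<sigma> \<tau> (id_ctx \<Phi>)"
  using elim_unique[of L "Id_ctx_gen \<Phi>" \<Delta> \<sigma> "\<Phi> @ \<Phi>" \<tau>, OF assms(1) set_Id_ctx_gen[of _ \<Phi>]] assms(2,3,6) seq_ends[OF assms(5,4)]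
  unfolding id_ctx_def[of \<Phi>] length_Id_ctx_gen by blast

lemmas cell_unique0 = cell_unique[where \<Delta> = "[]", simplified]

lemma src_subst: "(\<lambda>i. subst \<rho> (src L a i)) = src L (\<lambda>i. subst \<rho> (a i))"
  and tgt_subst: "(\<lambda>i. subst \<rho> (tgt L a i)) = tgt L (\<lambda>i. subst \<rho> (a i))"
  by (simp_all add: fun_eq_iff src_def tgt_def)

section \<open>Identity 2-cells\<close>

definition idc :: "'a ctx \<Rightarrow> (nat \<Rightarrow> 'a expr) \<Rightarrow> nat \<Rightarrow> 'a expr" where
  "idc L f i = subst f (dg L i)"

lemma seq_idc: "seq \<Gamma> f f' L \<Longrightarrow> seq \<Gamma> (idc L f) (idc L f') (id_ctx L)"
  unfolding idc_def[abs_def] by (rule seq_comp[OF _ dg_hom]) (auto dest: seq_ctx)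

lemma idc_Var: "idc L Var = dg L"
  by (simp add: fun_eq_iff idc_def)

lemma idc_subst: "(\<lambda>i. subst \<rho> (idc L f i)) = idc L (\<lambda>i. subst \<rho> (f i))"
  by (simp add: fun_eq_iff idc_def)

lemma src_idc: "src L (idc L f) = f"
  by (simp add: fun_eq_iff idc_def src_def dg_def)

text \<open>In \<open>dg\<close> the source comes last and is recovered as a whole function. The
  target is followed by the source, so it is recovered only below \<open>length L\<close>.\<close>

lemma tgt_idc: "i < length L \<Longrightarrow> tgt L (idc L f) i = f i"
  by (simp add: idc_def tgt_def dg_def)

lemma seq_tgt_idc: "seq \<Gamma> f g L \<Longrightarrow> seq \<Gamma> (tgt L (idc L f)) g L"
  by (erule seq_congI) (simp_all add: tgt_idc)

lemma src_dg: "src L (dg L) = Var"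
  using src_idc[of L Var] by (simp add: idc_Var)

lemma tgt_dg: "is_ctx S L \<Longrightarrow> seq L (tgt L (dg L)) Var L"
  using seq_tgt_idc[OF hom_id] by (simp add: idc_Var)

text \<open>
  If the variables \<open>n, \<dots>, 2 n - 1\<close> of \<open>X\<close> form an element \<open>y : L\<close>, then \<open>adjoin L X\<close> is
  \<open>X, z : L, q : Id\<^sub>L(y, z)\<close>, whose variables \<open>n, \<dots>, 2 n - 1\<close> are \<open>z\<close>. So \<open>adjoin L (id_ctx L)\<close>
  carries the generic pair of composable 2-cells, and \<open>adjoin L (adjoin L (id_ctx L))\<close> the generic triple.
\<close>

definition glue :: "nat \<Rightarrow> nat \<Rightarrow> 'a expr" where
  "glue n i = (if i < n then Var i else Var (i + n))"

definition adjoin :: "'a ctx \<Rightarrow> 'a ctx \<Rightarrow> 'a ctx" where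
  "adjoin L X = subst_tele (glue (length L)) (Id_ctx_gen L) @ L @ X"

definition pair :: "'a ctx \<Rightarrow> (nat \<Rightarrow> 'a expr) \<Rightarrow> (nat \<Rightarrow> 'a expr) \<Rightarrow> nat \<Rightarrow> 'a expr" where
  "pair L a b i = (if i < 2 * length L then b i else a (i - 2 * length L))"

definition last_cell :: "'a ctx \<Rightarrow> nat \<Rightarrow> 'a expr" where
  "last_cell L i = (if i < 2 * length L then Var i else Var (i + length L))"

lemma glue:
  assumes "hom X (\<lambda>i. Var (i + length L)) L"
  shows "hom (L @ X) (glue (length L)) (L @ L)"
proof (rule seq_closed_append)
  have c: "is_ctx S L" "is_ctx S X" using assms seq_ctx by auto
  show "hom (L @ X) (glue (length L)) L"
    by (rule seq_congI[OF hom_closed_left[OF c]]) (simp_all add: glue_def)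
  show "hom (L @ X) (\<lambda>i. glue (length L) (i + length L)) L"
    using seq_wk[OF assms is_ctx_closed_append[OF c]] by (simp add: glue_def)
qed

lemma adjoin_ctx:
  assumes "hom X (\<lambda>i. Var (i + length L)) L"
  shows "is_ctx S (adjoin L X)"
    and "hom (adjoin L X) (last_cell L) (id_ctx L)"
    and "hom (adjoin L X) (\<lambda>i. Var (i + 2 * length L)) X"
    and "hom (adjoin L X) (\<lambda>i. Var (i + length L)) L"
proof -
  have c: "is_ctx S L" "is_ctx S X" using assms seq_ctx by auto
  have i: "is_ctx S (Id_ctx_gen L @ L @ L)" using id_ctx_ctx[OF c(1)] by (simp add: id_ctx_def)
  show ctx: "is_ctx S (adjoin L X)"
    using eq_tele_ctx[OF seq_tele[THEN conjunct1, OF glue[OF assms] eq_tele_refl[OF i]]] is_ctx_closed_append[OF c]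
    by (simp add: adjoin_def)
  have "lift (length L) (glue (length L)) = last_cell L"
    by (auto simp: fun_eq_iff lift_def glue_def last_cell_def)
  then show "hom (adjoin L X) (last_cell L) (id_ctx L)"
    using seq_lift[OF glue[OF assms] i] by (simp add: adjoin_def id_ctx_def)
  show "hom (adjoin L X) (\<lambda>i. Var (i + 2 * length L)) X"
    using hom_wk[of "subst_tele (glue (length L)) (Id_ctx_gen L) @ L" X] ctx by (simp add: adjoin_def mult_2)
  show "hom (adjoin L X) (\<lambda>i. Var (i + length L)) L"
    using seq_comp[OF hom_wk[of "subst_tele (glue (length L)) (Id_ctx_gen L)" "L @ X"] hom_closed_left[OF c]] ctx
    by (simp add: adjoin_def)
qed

text \<open>\<open>pair\<close> takes q and z from \<open>b\<close> but y from the target of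
  \<open>a\<close>. So \<open>b\<close> is recovered only up to the definitional equality of that
  target with its own source.\<close>

lemma pair_last_cell:
  assumes "hom \<Gamma> b (id_ctx L)" "seq \<Gamma> (tgt L a) (src L b) L"
  shows "seq \<Gamma> (\<lambda>i. subst (pair L a b) (last_cell L i)) b (id_ctx L)"
proof -
  have "seq \<Gamma> (\<lambda>i. if i < length (Id_ctx_gen L @ L) then b i else tgt L a (i - length (Id_ctx_gen L @ L))) b ((Id_ctx_gen L @ L) @ L)"
    using assms by (intro seq_replace) (auto simp: id_ctx_def src_def[abs_def] mult_2)
  then show ?thesis
    unfolding id_ctx_def append_assoc
    by (rule seq_congI) (auto simp: pair_def last_cell_def tgt_def mult_2)
qed

lemma seq_pair:
  assumes X: "hom X (\<lambda>i. Var (i + length L)) L"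
    and a: "seq \<Gamma> a a' X" and b: "seq \<Gamma> b b' (id_ctx L)"
    and ab: "seq \<Gamma> (tgt L a) (src L b) L"
  shows "seq \<Gamma> (pair L a b) (pair L a' b') (adjoin L X)"
  unfolding adjoin_def
proof (rule seq_pullback[OF glue[OF X]], goal_cases)
  case 1
  show ?case using id_ctx_ctx X seq_ctx by (auto simp: id_ctx_def)
next
  case 2
  show ?case
    by (rule seq_closed_append; rule seq_congI, rule seq_tgt[OF b] a)
       (auto simp: pair_def tgt_def mult_2)
next
  case 3
  have "seq \<Gamma> (tgt L a) (tgt L a') L"
    using seq_comp[OF a X] by (simp add: tgt_def[abs_def])
  from seq_trans[OF seq_sym[OF this] seq_trans[OF ab seq_src[OF b]]]
  have ab': "seq \<Gamma> (tgt L a') (src L b') L" .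
  have "seq \<Gamma> (\<lambda>i. subst (pair L a b) (last_cell L i)) (\<lambda>i. subst (pair L a' b') (last_cell L i)) (id_ctx L)"
    using pair_last_cell[OF seq_left[OF b] ab] pair_last_cell[OF seq_right[OF b] ab'] b seq_trans seq_sym by blast
  then show ?case
    unfolding id_ctx_def
    by (rule seq_congI) (auto simp: last_cell_def glue_def)
qed

text \<open>Setting y = x and p = r(x) removes the first 2-cell from a generic chain, because the
  rest then starts at x. A law about a chain is thereby reduced to one about a shorter
  chain.\<close>

lemma adjoin_diag:
  assumes "is_ctx S L"
  defines "n \<equiv> length L"
  shows "\<exists>\<Delta>. adjoin L (id_ctx L) = \<Delta> @ id_ctx L \<and> length \<Delta> = 2 * n \<and> subst_tele (dg L) \<Delta> @ L = id_ctx L"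
    and "\<exists>\<Delta>. adjoin L (adjoin L (id_ctx L)) = \<Delta> @ id_ctx L \<and> length \<Delta> = 4 * n \<and>
      subst_tele (dg L) \<Delta> @ L = adjoin L (id_ctx L)"
proof -
  have i: "is_ctx S (Id_ctx_gen L @ L @ L)" using id_ctx_ctx[OF assms(1)] by (simp add: id_ctx_def)
  let ?\<Delta> = "subst_tele (glue n) (Id_ctx_gen L) @ L"
  \<comment> \<open>\<open>Id_ctx_gen L\<close> is scoped in the two copies of \<open>L\<close>, and
    on their variables the composite is the identity.\<close>
  have 1: "subst_tele (\<lambda>i. subst (lift n (dg L)) (glue n i)) (Id_ctx_gen L) = subst_tele Var (Id_ctx_gen L)"
    by (rule subst_tele_cong[OF i]) (auto simp: glue_def lift_def dg_def n_def)
  have 2: "subst_tele (\<lambda>i. subst (lift (n + (n + n)) (dg L)) (glue n i)) (Id_ctx_gen L) = subst_tele (glue n) (Id_ctx_gen L)"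
    by (rule subst_tele_cong[OF i]) (auto simp: glue_def lift_def n_def)
  have d: "subst_tele (dg L) ?\<Delta> @ L = id_ctx L"
    using 1 by (simp add: subst_tele_append subst_tele_closed[OF assms(1)] id_ctx_def n_def)
  then show "\<exists>\<Delta>. adjoin L (id_ctx L) = \<Delta> @ id_ctx L \<and> length \<Delta> = 2 * n \<and> subst_tele (dg L) \<Delta> @ L = id_ctx L"
    by (intro exI[of _ ?\<Delta>]) (simp add: adjoin_def n_def)
  have "subst_tele (dg L) (?\<Delta> @ ?\<Delta>) @ L = adjoin L (id_ctx L)"
    using d 2 by (simp add: subst_tele_append subst_tele_closed[OF assms(1)] adjoin_def n_def)
  then show "\<exists>\<Delta>. adjoin L (adjoin L (id_ctx L)) = \<Delta> @ id_ctx L \<and> length \<Delta> = 4 * n \<and>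
      subst_tele (dg L) \<Delta> @ L = adjoin L (id_ctx L)"
    by (intro exI[of _ "?\<Delta> @ ?\<Delta>"]) (simp add: adjoin_def n_def)
qed


text \<open>Vertical composition: the generic composite of \<open>p\<close> and \<open>q\<close> is \<open>q\<close> for \<open>p = r(x)\<close>.\<close>

definition vcomp_spec :: "'a ctx \<Rightarrow> (nat \<Rightarrow> 'a expr) \<Rightarrow> bool" where
  "vcomp_spec L c \<longleftrightarrow> hom (adjoin L (id_ctx L)) c (id_ctx L) \<and>
    (\<forall>i. c (i + length L) = (if i < length L then Var (i + length L) else Var (i + 3 * length L))) \<and>
    seq (id_ctx L) (\<lambda>i. subst (lift (2 * length L) (dg L)) (c i)) Var (id_ctx L)"

lemma vcomp_exists:
  assumes L: "is_ctx S L"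
  shows "\<exists>c. vcomp_spec L c"
proof -
  define n where "n = length L"
  obtain \<Delta> where \<Delta>: "adjoin L (id_ctx L) = \<Delta> @ id_ctx L" "length \<Delta> = 2 * n"
    "subst_tele (dg L) \<Delta> @ L = id_ctx L"
    using adjoin_diag(1)[OF L] n_def by blast
  note T = adjoin_ctx[OF hom_py[OF id_ctx_ctx[OF L]]]
  \<comment> \<open>The generic pair lists q, z, p, y, x in blocks of \<open>n\<close> variables.
    The composite has target z, starting at \<open>n\<close>, and source x, starting at
    \<open>4 * n\<close>.\<close>
  let ?b = "\<lambda>i. if i < n then Var (i + n) else Var (i + 3 * n)"
  have b: "hom (\<Delta> @ id_ctx L) ?b (L @ L)"
  proof (rule seq_closed_append)
    show "hom (\<Delta> @ id_ctx L) ?b L"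
      using T(4) unfolding \<Delta> by (rule seq_congI) (auto simp: n_def)
    have "hom (\<Delta> @ id_ctx L) (\<lambda>i. Var (i + 2 * n + 2 * n)) L"
      using seq_comp[OF T(3) hom_px[OF id_ctx_ctx[OF L]]] unfolding \<Delta> by (simp add: n_def)
    then show "hom (\<Delta> @ id_ctx L) (\<lambda>i. ?b (i + length L)) L"
      by (rule seq_congI) (auto simp: n_def)
  qed
  have "hom (id_ctx L) Var (Id_ctx_gen L @ L @ L)"
    using hom_id id_ctx_ctx[OF L] by (simp add: id_ctx_def)
  moreover have "seq (id_ctx L) (\<lambda>i. Var (i + n)) (\<lambda>i. subst (lift (2 * n) (dg L)) (?b i)) (L @ L)"
  proof -
    have "(\<lambda>i. subst (lift (2 * n) (dg L)) (?b i)) = (\<lambda>i. Var (i + n))"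
      by (auto simp: fun_eq_iff lift_def dg_def n_def)
    moreover have "hom (id_ctx L) (\<lambda>i. Var (i + n)) (L @ L)"
      using hom_wk[of "Id_ctx_gen L" "L @ L"] id_ctx_ctx[OF L] by (simp add: id_ctx_def n_def)
    ultimately show ?thesis by (simp only:)
  qed
  ultimately have "\<exists>c. hom (\<Delta> @ id_ctx L) c (Id_ctx_gen L @ L @ L) \<and> (\<forall>i. c (i + n) = ?b i) \<and>
    seq (subst_tele (dg L) \<Delta> @ L) (\<lambda>i. subst (lift (length \<Delta>) (dg L)) (c i)) Var (Id_ctx_gen L @ L @ L)"
    using elim_tele[OF L b, of Var "Id_ctx_gen L"] unfolding \<Delta>(2,3) length_Id_ctx_gen n_def[symmetric] by blast
  then show ?thesis
    unfolding vcomp_spec_def \<Delta>(1) unfolding \<Delta>(2,3) id_ctx_def[of L, symmetric] n_def by blast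
qed

definition vcomp_gen :: "'a ctx \<Rightarrow> nat \<Rightarrow> 'a expr" where
  "vcomp_gen L = (SOME c. vcomp_spec L c)"

lemma vcomp_gen:
  assumes "is_ctx S L"
  shows "hom (adjoin L (id_ctx L)) (vcomp_gen L) (id_ctx L)"
    and "seq (id_ctx L) (\<lambda>i. subst (lift (2 * length L) (dg L)) (vcomp_gen L i)) Var (id_ctx L)"
    and "i < length L \<Longrightarrow> tgt L (vcomp_gen L) i = Var (i + length L)"
    and "src L (vcomp_gen L) i = Var (i + 4 * length L)"
proof -
  have *: "vcomp_spec L (vcomp_gen L)"
    unfolding vcomp_gen_def using vcomp_exists[OF assms] by (rule someI_ex)
  then show "hom (adjoin L (id_ctx L)) (vcomp_gen L) (id_ctx L)"
    "seq (id_ctx L) (\<lambda>i. subst (lift (2 * length L) (dg L)) (vcomp_gen L i)) Var (id_ctx L)"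
    by (auto simp: vcomp_spec_def)
  have e: "vcomp_gen L (i + length L) = (if i < length L then Var (i + length L) else Var (i + 3 * length L))" for i
    using * unfolding vcomp_spec_def by blast
  show "i < length L \<Longrightarrow> tgt L (vcomp_gen L) i = Var (i + length L)"
    by (simp add: tgt_def e)
  show "src L (vcomp_gen L) i = Var (i + 4 * length L)"
    using e[of "i + length L"] by (simp add: src_def mult_2 add.assoc)
qed

text \<open>Diagrammatic order: the target of \<open>a\<close> is to be the source of
  \<open>b\<close>.\<close>

definition vc :: "'a ctx \<Rightarrow> (nat \<Rightarrow> 'a expr) \<Rightarrow> (nat \<Rightarrow> 'a expr) \<Rightarrow> nat \<Rightarrow> 'a expr" where
  "vc L a b i = subst (pair L a b) (vcomp_gen L i)"

lemma pair_subst: "(\<lambda>i. subst \<rho> (pair L a b i)) = pair L (\<lambda>i. subst \<rho> (a i)) (\<lambda>i. subst \<rho> (b i))"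
  by (auto simp: fun_eq_iff pair_def)

lemma vc_subst: "(\<lambda>i. subst \<rho> (vc L a b i)) = vc L (\<lambda>i. subst \<rho> (a i)) (\<lambda>i. subst \<rho> (b i))"
  by (simp add: fun_eq_iff vc_def pair_subst)

lemma seq_vc:
  assumes "seq \<Gamma> a a' (id_ctx L)" "seq \<Gamma> b b' (id_ctx L)" "seq \<Gamma> (tgt L a) (src L b) L"
  shows "seq \<Gamma> (vc L a b) (vc L a' b') (id_ctx L)"
proof -
  have L: "is_ctx S L" using assms(3) seq_ctx by blast
  show ?thesis
    unfolding vc_def[abs_def]
    by (rule seq_comp[OF seq_pair[OF hom_py[OF id_ctx_ctx[OF L]] assms] vcomp_gen(1)[OF L]])
qed

lemma src_vc: "is_ctx S L \<Longrightarrow> src L (vc L a b) = src L a"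
proof -
  assume L: "is_ctx S L"
  have "src L (vc L a b) = (\<lambda>i. subst (pair L a b) (src L (vcomp_gen L) i))"
    by (simp add: src_def[abs_def] vc_def)
  also have "\<dots> = src L a" unfolding vcomp_gen(4)[OF L] by (auto simp: fun_eq_iff pair_def src_def intro!: arg_cong[where f = a])
  finally show ?thesis .
qed

lemma tgt_vc:
  assumes b: "seq \<Gamma> b b' (id_ctx L)"
  shows "seq \<Gamma> (tgt L (vc L a b)) (tgt L b') L"
proof -
  have L: "is_ctx S L" using seq_ctx[OF seq_tgt[OF b]] by blast
  have t: "tgt L (vc L a b) = (\<lambda>i. subst (pair L a b) (tgt L (vcomp_gen L) i))"
    by (simp add: tgt_def[abs_def] vc_def)
  show ?thesis
    by (rule seq_congI[OF seq_tgt[OF b]]) (simp_all add: t vcomp_gen(3)[OF L], simp add: pair_def tgt_def)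
qed

text \<open>Pairing \<open>b\<close> with the identity on its own source is \<open>b\<close>
  substituted into the lifted diagonal, so this unit law is the computation rule of the generic
  composite. Replacing \<open>f\<close> by the source of \<open>b\<close> is a congruence.\<close>

lemma vc_idc_left:
  assumes b: "hom \<Gamma> b (id_ctx L)" and f: "seq \<Gamma> f (src L b) L"
  shows "seq \<Gamma> (vc L (idc L f) b) b (id_ctx L)"
proof -
  have L: "is_ctx S L" using f seq_ctx by blast
  have "seq \<Gamma> (vc L (idc L f) b) (vc L (idc L (src L b)) b) (id_ctx L)"
    by (rule seq_vc[OF seq_idc[OF f] b seq_tgt_idc[OF f]])
  also have "pair L (idc L (src L b)) b = (\<lambda>i. subst b (lift (2 * length L) (dg L) i))"
    by (auto simp: fun_eq_iff pair_def lift_def idc_def subst_wk src_def[abs_def])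
  then have "vc L (idc L (src L b)) b = (\<lambda>i. subst b (subst (lift (2 * length L) (dg L)) (vcomp_gen L i)))"
    by (simp add: vc_def[abs_def])
  then have "seq \<Gamma> (vc L (idc L (src L b)) b) b (id_ctx L)"
    using seq_comp[OF b vcomp_gen(2)[OF L]] by simp
  finally show ?thesis .
qed

lemma dg_ends: "is_ctx S L \<Longrightarrow> seq L (tgt L (dg L)) (src L (dg L)) L"
  using tgt_dg by (simp add: src_dg)

lemma vc_dg_dg: "is_ctx S L \<Longrightarrow> seq L (vc L (dg L) (dg L)) (dg L) (id_ctx L)"
  using vc_idc_left[OF dg_hom, of L Var] hom_id by (simp add: src_dg idc_Var)

text \<open>A law for arbitrary 2-cells follows from its generic case over \<open>id_ctx L\<close> by substitution.\<close>

lemma vc_idc_right: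
  assumes a: "hom \<Gamma> a (id_ctx L)" and f: "seq \<Gamma> (tgt L a) f L"
  shows "seq \<Gamma> (vc L a (idc L f)) a (id_ctx L)"
proof -
  have L: "is_ctx S L" using f seq_ctx by blast
  let ?I = "id_ctx L" and ?i = "idc L (tgt L Var)"
  have v: "hom ?I Var ?I" using hom_id id_ctx_ctx[OF L] by blast
  have i: "hom ?I ?i ?I" by (rule seq_idc[OF seq_tgt[OF v]])
  have h: "hom ?I (vc L Var ?i) ?I"
    using seq_vc[OF v i] seq_tgt[OF v] by (simp add: src_idc)
  \<comment> \<open>On the diagonal both factors are reflexivity, whose composite with itself is
    already known from the left unit law.\<close>
  have "seq L (vc L (dg L) (idc L (tgt L (dg L)))) (vc L (dg L) (dg L)) ?I"
  proof (rule seq_vc[OF dg_hom[OF L]])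
    show "seq L (idc L (tgt L (dg L))) (dg L) ?I"
      using seq_idc[OF tgt_dg[OF L]] by (simp add: idc_Var)
    show "seq L (tgt L (dg L)) (src L (idc L (tgt L (dg L)))) L"
      using seq_left[OF tgt_dg[OF L]] by (simp add: src_idc)
  qed
  also note vc_dg_dg[OF L]
  finally have d: "seq L (\<lambda>i. subst (dg L) (vc L Var ?i i)) (dg L) ?I"
    by (simp add: vc_subst idc_subst tgt_subst)
  have "seq ?I (vc L Var ?i) Var ?I"
  proof (rule cell_unique0[OF L h v])
    show "seq ?I (src L (vc L Var ?i)) (src L Var) L"
      using seq_src[OF v] by (simp add: src_vc[OF L])
    show "seq ?I (tgt L (vc L Var ?i)) (tgt L Var) L"
      using seq_trans[OF tgt_vc[OF i] seq_tgt_idc[OF seq_tgt[OF v]]] .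
  qed (use d in simp)
  from seq_comp[OF a this] have "seq \<Gamma> (vc L a (idc L (tgt L a))) a ?I"
    by (simp add: vc_subst idc_subst tgt_subst)
  moreover have "seq \<Gamma> (vc L a (idc L f)) (vc L a (idc L (tgt L a))) ?I"
    using seq_vc[OF a seq_idc[OF seq_sym[OF f]]] f by (simp add: src_idc)
  ultimately show ?thesis using seq_trans by blast
qed

text \<open>Elimination on the first of three generic 2-cells turns it into an identity. Both
  bracketings then become the composite of the other two by the left unit law.\<close>

lemma vc_assoc:
  assumes a: "hom \<Gamma> a (id_ctx L)" and b: "hom \<Gamma> b (id_ctx L)" and c: "hom \<Gamma> c (id_ctx L)"
    and ab: "seq \<Gamma> (tgt L a) (src L b) L" and bc: "seq \<Gamma> (tgt L b) (src L c) L"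
  shows "seq \<Gamma> (vc L (vc L a b) c) (vc L a (vc L b c)) (id_ctx L)"
proof -
  have L: "is_ctx S L" using ab seq_ctx by blast
  define n where "n = length L"
  let ?I = "id_ctx L" let ?T = "adjoin L ?I" let ?Q = "adjoin L ?T"
  note I = hom_py[OF id_ctx_ctx[OF L]]
  note T = adjoin_ctx[OF I]
  note Q = adjoin_ctx[OF T(4)]
  obtain \<Delta> where \<Delta>: "?Q = \<Delta> @ ?I" "length \<Delta> = 4 * n" "subst_tele (dg L) \<Delta> @ L = ?T"
    using adjoin_diag(2)[OF L] n_def by blast
  \<comment> \<open>The three 2-cells of the generic triple: \<open>a0\<close> drops two adjoined
    stages of \<open>2 * n\<close> variables each, \<open>b0\<close> drops one, and
    \<open>c0\<close> is the last cell.\<close>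
  define a0 b0 c0 :: "nat \<Rightarrow> 'a expr" where "a0 = (\<lambda>i. Var (i + 2 * n + 2 * n))"
    and "b0 = (\<lambda>i. wk (2 * n) (last_cell L i))" and "c0 = last_cell L"
  have a0: "hom ?Q a0 ?I"
    using seq_comp[OF Q(3) T(3)] by (simp add: a0_def n_def)
  have b0: "hom ?Q b0 ?I"
    using seq_comp[OF Q(3) T(2)] by (simp add: b0_def n_def wk_eq_subst)
  have c0: "hom ?Q c0 ?I" using Q(2) by (simp add: c0_def)
  have ab0: "seq ?Q (tgt L a0) (src L b0) L"
    by (rule seq_congI[OF seq_tgt[OF a0]])
      (auto simp: b0_def a0_def src_def tgt_def last_cell_def n_def)
  have bc0: "seq ?Q (tgt L b0) (src L c0) L"
    by (rule seq_congI[OF seq_tgt[OF b0]])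
      (auto simp: b0_def c0_def src_def tgt_def last_cell_def n_def)
  let ?L = "vc L (vc L a0 b0) c0" and ?R = "vc L a0 (vc L b0 c0)"
  have hab: "hom ?Q (vc L a0 b0) ?I" by (rule seq_vc[OF a0 b0 ab0])
  have hbc: "hom ?Q (vc L b0 c0) ?I" by (rule seq_vc[OF b0 c0 bc0])
  have hL: "hom ?Q ?L ?I" by (rule seq_vc[OF hab c0 seq_trans[OF tgt_vc[OF b0] bc0]])
  have hR: "hom ?Q ?R ?I" using seq_vc[OF a0 hbc] ab0 by (simp add: src_vc[OF L])
  define \<delta> where "\<delta> = lift (4 * n) (dg L)"
  have c\<Delta>: "is_ctx S (\<Delta> @ ?I)" using Q(1) \<Delta>(1) by simp
  have \<delta>: "hom ?T \<delta> ?Q"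
    using seq_lift[OF dg_hom[OF L] c\<Delta>] unfolding \<Delta> \<delta>_def .
  let ?b = "\<lambda>i. subst \<delta> (b0 i)" and ?c = "\<lambda>i. subst \<delta> (c0 i)" and ?x = "\<lambda>i. Var (i + 4 * n)"
  have a1: "(\<lambda>i. subst \<delta> (a0 i)) = idc L ?x"
    by (simp add: fun_eq_iff a0_def \<delta>_def idc_def wk_eq_subst lift_def add.assoc)
  have b1: "hom ?T ?b ?I" by (rule seq_comp[OF \<delta> b0])
  have c1: "hom ?T ?c ?I" by (rule seq_comp[OF \<delta> c0])
  have bc1: "seq ?T (tgt L ?b) (src L ?c) L"
    using seq_comp[OF \<delta> bc0] by (simp add: tgt_subst src_subst)
  have x1: "seq ?T ?x (src L ?b) L"
    by (rule seq_congI[OF seq_src[OF b1]])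
      (auto simp: b0_def \<delta>_def src_def last_cell_def n_def lift_def dg_def)
  have "seq ?T (vc L (vc L (idc L ?x) ?b) ?c) (vc L ?b ?c) ?I"
    by (rule seq_vc[OF vc_idc_left[OF b1 x1] c1 seq_trans[OF tgt_vc[OF b1] bc1]])
  also have "seq ?T (vc L ?b ?c) (vc L (idc L ?x) (vc L ?b ?c)) ?I"
    using seq_sym[OF vc_idc_left[OF seq_vc[OF b1 c1 bc1]]] x1 by (simp add: src_vc[OF L])
  finally have d: "seq ?T (\<lambda>i. subst \<delta> (?L i)) (\<lambda>i. subst \<delta> (?R i)) ?I"
    by (simp add: vc_subst a1)
  have "seq (\<Delta> @ ?I) ?L ?R ?I"
  proof (rule cell_unique[OF L])
    show "hom (\<Delta> @ ?I) ?L ?I" "hom (\<Delta> @ ?I) ?R ?I" using hL hR \<Delta>(1) by simp_all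
    show "seq (\<Delta> @ ?I) (src L ?L) (src L ?R) L"
      using seq_src[OF a0] \<Delta>(1) by (simp add: src_vc[OF L])
    have "seq ?Q (tgt L ?L) (tgt L ?R) L"
      using seq_trans[OF tgt_vc[OF c0] seq_sym[OF seq_trans[OF tgt_vc[OF hbc] tgt_vc[OF c0]]]] .
    then show "seq (\<Delta> @ ?I) (tgt L ?L) (tgt L ?R) L" using \<Delta>(1) by simp
    show "seq (subst_tele (dg L) \<Delta> @ L) (\<lambda>i. subst (lift (length \<Delta>) (dg L)) (?L i)) (\<lambda>i. subst (lift (length \<Delta>) (dg L)) (?R i)) ?I"
      using d unfolding \<Delta>(2,3) \<delta>_def .
  qed
  then have LR: "seq ?Q ?L ?R ?I" using \<Delta>(1) by simp
  \<comment> \<open>Instantiation returns \<open>a\<close> itself, but \<open>b\<close> and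
    \<open>c\<close> only up to definitional equality, since each shares an end with its
    predecessor. The facts \<open>l\<close> and \<open>r\<close> absorb the difference.\<close>
  let ?p = "pair L (pair L a b) c"
  have p1: "hom \<Gamma> (pair L a b) ?T" by (rule seq_pair[OF I a b ab])
  have pbc: "seq \<Gamma> (tgt L (pair L a b)) (src L c) L"
    by (rule seq_congI[OF bc]) (auto simp: tgt_def pair_def)
  have p: "hom \<Gamma> ?p ?Q" by (rule seq_pair[OF T(4) p1 c pbc])
  have pa: "(\<lambda>i. subst ?p (a0 i)) = a" by (simp add: fun_eq_iff a0_def pair_def n_def)
  have pb: "seq \<Gamma> (\<lambda>i. subst ?p (b0 i)) b ?I"
    using pair_last_cell[OF b ab] by (simp add: b0_def subst_wk pair_def[of _ "pair L a b" c] n_def)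
  have pc: "seq \<Gamma> (\<lambda>i. subst ?p (c0 i)) c ?I"
    using pair_last_cell[OF c pbc] by (simp add: c0_def)
  have pab0: "seq \<Gamma> (tgt L a) (src L (\<lambda>i. subst ?p (b0 i))) L"
    using seq_comp[OF p ab0] by (simp add: tgt_subst src_subst pa)
  have pbc0: "seq \<Gamma> (tgt L (\<lambda>i. subst ?p (b0 i))) (src L (\<lambda>i. subst ?p (c0 i))) L"
    using seq_comp[OF p bc0] by (simp add: tgt_subst src_subst)
  from seq_comp[OF p LR]
  have m: "seq \<Gamma> (vc L (vc L a (\<lambda>i. subst ?p (b0 i))) (\<lambda>i. subst ?p (c0 i)))
      (vc L a (vc L (\<lambda>i. subst ?p (b0 i)) (\<lambda>i. subst ?p (c0 i)))) ?I"
    by (simp add: vc_subst pa)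
  have l: "seq \<Gamma> (vc L (vc L a (\<lambda>i. subst ?p (b0 i))) (\<lambda>i. subst ?p (c0 i))) (vc L (vc L a b) c) ?I"
    by (rule seq_vc[OF seq_vc[OF a pb pab0] pc seq_trans[OF tgt_vc[OF seq_left[OF pb]] pbc0]])
  have r: "seq \<Gamma> (vc L a (vc L (\<lambda>i. subst ?p (b0 i)) (\<lambda>i. subst ?p (c0 i)))) (vc L a (vc L b c)) ?I"
    using seq_vc[OF a seq_vc[OF pb pc pbc0]] pab0 by (simp add: src_vc[OF L])
  show ?thesis using seq_trans[OF seq_trans[OF seq_sym[OF l] m] r] .
qed


section \<open>Inverses and horizontal composition\<close>

lemma elim_cell:
  assumes A: "is_ctx S A" and s: "hom (id_ctx A) s \<Phi>" and t: "hom (id_ctx A) t \<Phi>" and \<beta>: "hom A \<beta> (id_ctx \<Phi>)"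
    and ds: "seq A (\<lambda>i. subst (dg A) (s i)) (src \<Phi> \<beta>) \<Phi>" and dt: "seq A (\<lambda>i. subst (dg A) (t i)) (tgt \<Phi> \<beta>) \<Phi>"
  shows "\<exists>c. hom (id_ctx A) c (id_ctx \<Phi>) \<and> src \<Phi> c = s \<and> (\<forall>i<length \<Phi>. tgt \<Phi> c i = t i) \<and>
    seq A (\<lambda>i. subst (dg A) (c i)) \<beta> (id_ctx \<Phi>)"
proof -
  define k where "k = length \<Phi>"
  \<comment> \<open>The ends \<open>s\<close> and \<open>t\<close> form the part that
    \<open>elim_tele\<close> leaves untouched, which is why they reappear literally in the
    result.\<close>
  let ?b = "\<lambda>i. if i < k then t i else s (i - k)"
  have b: "hom ([] @ id_ctx A) ?b (\<Phi> @ \<Phi>)"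
    by (rule seq_closed_append; rule seq_congI, (simp, rule t s)[1]) (simp_all add: k_def)
  have "seq A (\<lambda>i. subst (dg A) (?b i)) (\<lambda>i. \<beta> (i + k)) (\<Phi> @ \<Phi>)"
    by (rule seq_closed_append; rule seq_congI, rule dt ds) (simp_all add: k_def src_def tgt_def mult_2 add.assoc)
  from seq_sym[OF this]
  have e: "seq (subst_tele (dg A) [] @ A) (\<lambda>i. \<beta> (i + length (Id_ctx_gen \<Phi>))) (\<lambda>i. subst (lift (length []) (dg A)) (?b i)) (\<Phi> @ \<Phi>)"
    by (simp add: k_def)
  have "hom (subst_tele (dg A) [] @ A) \<beta> (Id_ctx_gen \<Phi> @ \<Phi> @ \<Phi>)"
    using \<beta> by (simp add: id_ctx_def)
  from elim_tele[OF A b this e] obtain c where c: "hom (id_ctx A) c (id_ctx \<Phi>)" "\<And>i. c (i + k) = ?b i"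
    "seq A (\<lambda>i. subst (dg A) (c i)) \<beta> (id_ctx \<Phi>)"
    unfolding length_Id_ctx_gen by (auto simp: id_ctx_def k_def)
  have "c (i + 2 * k) = s i" for i using c(2)[of "i + k"] by (simp add: mult_2 add.assoc)
  then show ?thesis using c by (intro exI[of _ c]) (auto simp: src_def tgt_def fun_eq_iff k_def)
qed

definition inv_gen :: "'a ctx \<Rightarrow> nat \<Rightarrow> 'a expr" where
  "inv_gen L = (SOME c. hom (id_ctx L) c (id_ctx L) \<and> src L c = tgt L Var \<and>
    (\<forall>i<length L. tgt L c i = src L Var i) \<and> seq L (\<lambda>i. subst (dg L) (c i)) (dg L) (id_ctx L))"

lemma inv_gen:
  assumes L: "is_ctx S L"
  shows "hom (id_ctx L) (inv_gen L) (id_ctx L)" and "src L (inv_gen L) = tgt L Var"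
    and "seq (id_ctx L) (tgt L (inv_gen L)) (src L Var) L"
    and "seq L (\<lambda>i. subst (dg L) (inv_gen L i)) (dg L) (id_ctx L)"
proof -
  have v: "hom (id_ctx L) Var (id_ctx L)" using hom_id id_ctx_ctx[OF L] by blast
  have 1: "seq L (\<lambda>i. subst (dg L) (tgt L Var i)) (src L (dg L)) L"
    using dg_ends[OF L] by (simp add: tgt_subst)
  have 2: "seq L (\<lambda>i. subst (dg L) (src L Var i)) (tgt L (dg L)) L"
    using seq_sym[OF dg_ends[OF L]] by (simp add: src_subst)
  have "hom (id_ctx L) (inv_gen L) (id_ctx L) \<and> src L (inv_gen L) = tgt L Var \<and>
    (\<forall>i<length L. tgt L (inv_gen L) i = src L Var i) \<and> seq L (\<lambda>i. subst (dg L) (inv_gen L i)) (dg L) (id_ctx L)"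
    unfolding inv_gen_def
    by (rule someI_ex[OF elim_cell[OF L seq_tgt[OF v] seq_src[OF v] dg_hom[OF L] 1 2]])
  then show "hom (id_ctx L) (inv_gen L) (id_ctx L)" "src L (inv_gen L) = tgt L Var"
    "seq L (\<lambda>i. subst (dg L) (inv_gen L i)) (dg L) (id_ctx L)"
    "seq (id_ctx L) (tgt L (inv_gen L)) (src L Var) L"
    using seq_congI[OF seq_src[OF v], of "tgt L (inv_gen L)" "src L Var"] by auto
qed

definition vinv :: "'a ctx \<Rightarrow> (nat \<Rightarrow> 'a expr) \<Rightarrow> nat \<Rightarrow> 'a expr" where
  "vinv L a i = subst a (inv_gen L i)"

text \<open>On the diagonal the inverse is again reflexivity, so both cancellation laws reduce to
  \<open>vc_dg_dg\<close>.\<close>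

lemma vinv:
  assumes a: "hom \<Gamma> a (id_ctx L)"
  shows "hom \<Gamma> (vinv L a) (id_ctx L)" and "src L (vinv L a) = tgt L a"
    and "seq \<Gamma> (tgt L (vinv L a)) (src L a) L"
    and "seq \<Gamma> (vc L a (vinv L a)) (idc L (src L a)) (id_ctx L)"
    and "seq \<Gamma> (vc L (vinv L a) a) (idc L (tgt L a)) (id_ctx L)"
proof -
  have L: "is_ctx S L" using seq_ctx[OF seq_src[OF a]] by blast
  let ?I = "id_ctx L" and ?v = "inv_gen L"
  note v = inv_gen[OF L]
  have x: "hom ?I Var ?I" using hom_id id_ctx_ctx[OF L] by blast
  show "hom \<Gamma> (vinv L a) ?I"
    unfolding vinv_def[abs_def] by (rule seq_comp[OF a v(1)])
  have "src L (vinv L a) = (\<lambda>i. subst a (src L ?v i))" by (simp add: src_def[abs_def] vinv_def)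
  then show "src L (vinv L a) = tgt L a" by (simp add: v(2) tgt_subst)
  have "tgt L (vinv L a) = (\<lambda>i. subst a (tgt L ?v i))" by (simp add: tgt_def[abs_def] vinv_def)
  then show "seq \<Gamma> (tgt L (vinv L a)) (src L a) L" using seq_comp[OF a v(3)] by (simp add: src_subst)
  note dg = dg_hom[OF L]
  have xv: "seq ?I (tgt L Var) (src L ?v) L" using seq_tgt[OF x] by (simp add: v(2))
  have h1: "hom ?I (vc L Var ?v) ?I" by (rule seq_vc[OF x v(1) xv])
  have h2: "hom ?I (vc L ?v Var) ?I" by (rule seq_vc[OF v(1) x v(3)])
  have dv: "seq L (tgt L (\<lambda>i. subst (dg L) (?v i))) (src L (dg L)) L"
    using seq_trans[OF seq_tgt[OF v(4)] dg_ends[OF L]] .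
  have vd: "seq L (tgt L (dg L)) (src L (\<lambda>i. subst (dg L) (?v i))) L"
    using seq_trans[OF dg_ends[OF L] seq_sym[OF seq_src[OF v(4)]]] .
  have dd: "seq L (vc L (dg L) (\<lambda>i. subst (dg L) (?v i))) (dg L) ?I"
    "seq L (vc L (\<lambda>i. subst (dg L) (?v i)) (dg L)) (dg L) ?I"
    using seq_trans[OF seq_vc[OF dg v(4) vd] vc_dg_dg[OF L]]
      seq_trans[OF seq_vc[OF v(4) dg dv] vc_dg_dg[OF L]] .
  have i: "seq L (idc L (tgt L (dg L))) (dg L) ?I"
    using seq_idc[OF tgt_dg[OF L]] by (simp add: idc_Var)
  have "seq ?I (vc L Var ?v) (idc L (src L Var)) ?I"
  proof (rule cell_unique0[OF L h1 seq_idc[OF seq_src[OF x]]])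
    show "seq ?I (src L (vc L Var ?v)) (src L (idc L (src L Var))) L"
      using seq_src[OF x] by (simp add: src_vc[OF L] src_idc)
    show "seq ?I (tgt L (vc L Var ?v)) (tgt L (idc L (src L Var))) L"
      by (rule seq_trans[OF seq_trans[OF tgt_vc[OF v(1)] v(3)] seq_sym[OF seq_tgt_idc[OF seq_src[OF x]]]])
    show "seq L (\<lambda>i. subst (dg L) (vc L Var ?v i)) (\<lambda>i. subst (dg L) (idc L (src L Var) i)) ?I"
      using dd(1) by (simp add: vc_subst idc_subst src_subst src_dg idc_Var)
  qed
  from seq_comp[OF a this] show "seq \<Gamma> (vc L a (vinv L a)) (idc L (src L a)) ?I"
    by (simp add: vc_subst idc_subst src_subst vinv_def[abs_def])
  have "seq ?I (vc L ?v Var) (idc L (tgt L Var)) ?I"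
  proof (rule cell_unique0[OF L h2 seq_idc[OF seq_tgt[OF x]]])
    show "seq ?I (src L (vc L ?v Var)) (src L (idc L (tgt L Var))) L"
      using seq_tgt[OF x] by (simp add: src_vc[OF L] src_idc v(2))
    show "seq ?I (tgt L (vc L ?v Var)) (tgt L (idc L (tgt L Var))) L"
      by (rule seq_trans[OF tgt_vc[OF x] seq_sym[OF seq_tgt_idc[OF seq_tgt[OF x]]]])
    show "seq L (\<lambda>i. subst (dg L) (vc L ?v Var i)) (\<lambda>i. subst (dg L) (idc L (tgt L Var) i)) ?I"
      using seq_trans[OF dd(2) seq_sym[OF i]] by (simp add: vc_subst idc_subst tgt_subst)
  qed
  from seq_comp[OF a this] show "seq \<Gamma> (vc L (vinv L a) a) (idc L (tgt L a)) ?I"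
    by (simp add: vc_subst idc_subst tgt_subst vinv_def[abs_def])
qed

text \<open>
  The extension of a 2-cell \<open>\<beta>\<close> over \<open>A\<close> along \<open>dg A\<close>. Composing it with a 2-cell \<open>\<alpha>\<close> into \<open>A\<close> gives
  the horizontal composite, so that the laws for the latter are statements about \<open>dg\<close>.
\<close>

definition ext :: "'a ctx \<Rightarrow> 'a ctx \<Rightarrow> (nat \<Rightarrow> 'a expr) \<Rightarrow> nat \<Rightarrow> 'a expr" where
  "ext A \<Phi> \<beta> = (SOME c. hom (id_ctx A) c (id_ctx \<Phi>) \<and> src \<Phi> c = (\<lambda>i. subst (src A Var) (src \<Phi> \<beta> i)) \<and>
    (\<forall>i<length \<Phi>. tgt \<Phi> c i = subst (tgt A Var) (tgt \<Phi> \<beta> i)) \<and> seq A (\<lambda>i. subst (dg A) (c i)) \<beta> (id_ctx \<Phi>))"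

lemma ext:
  assumes \<beta>: "hom A \<beta> (id_ctx \<Phi>)"
  shows "hom (id_ctx A) (ext A \<Phi> \<beta>) (id_ctx \<Phi>)" and "src \<Phi> (ext A \<Phi> \<beta>) = (\<lambda>i. subst (src A Var) (src \<Phi> \<beta> i))"
    and "seq (id_ctx A) (tgt \<Phi> (ext A \<Phi> \<beta>)) (\<lambda>i. subst (tgt A Var) (tgt \<Phi> \<beta> i)) \<Phi>"
    and "seq A (\<lambda>i. subst (dg A) (ext A \<Phi> \<beta> i)) \<beta> (id_ctx \<Phi>)"
proof -
  have A: "is_ctx S A" using seq_ctx[OF \<beta>] by blast
  have v: "hom (id_ctx A) Var (id_ctx A)" using hom_id id_ctx_ctx[OF A] by blast
  note s = seq_comp[OF seq_src[OF v] seq_src[OF \<beta>]] and t = seq_comp[OF seq_tgt[OF v] seq_tgt[OF \<beta>]]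
  have 1: "seq A (\<lambda>i. subst (dg A) (subst (src A Var) (src \<Phi> \<beta> i))) (src \<Phi> \<beta>) \<Phi>"
    using seq_src[OF \<beta>] by (simp add: src_subst src_dg)
  have 2: "seq A (\<lambda>i. subst (dg A) (subst (tgt A Var) (tgt \<Phi> \<beta> i))) (tgt \<Phi> \<beta>) \<Phi>"
    using seq_comp[OF tgt_dg[OF A] seq_tgt[OF \<beta>]] by (simp add: tgt_subst)
  have "hom (id_ctx A) (ext A \<Phi> \<beta>) (id_ctx \<Phi>) \<and> src \<Phi> (ext A \<Phi> \<beta>) = (\<lambda>i. subst (src A Var) (src \<Phi> \<beta> i)) \<and>
    (\<forall>i<length \<Phi>. tgt \<Phi> (ext A \<Phi> \<beta>) i = subst (tgt A Var) (tgt \<Phi> \<beta> i)) \<and> seq A (\<lambda>i. subst (dg A) (ext A \<Phi> \<beta> i)) \<beta> (id_ctx \<Phi>)"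
    unfolding ext_def by (rule someI_ex[OF elim_cell[OF A s t \<beta> 1 2]])
  then show "hom (id_ctx A) (ext A \<Phi> \<beta>) (id_ctx \<Phi>)" "src \<Phi> (ext A \<Phi> \<beta>) = (\<lambda>i. subst (src A Var) (src \<Phi> \<beta> i))"
    "seq A (\<lambda>i. subst (dg A) (ext A \<Phi> \<beta> i)) \<beta> (id_ctx \<Phi>)"
    "seq (id_ctx A) (tgt \<Phi> (ext A \<Phi> \<beta>)) (\<lambda>i. subst (tgt A Var) (tgt \<Phi> \<beta> i)) \<Phi>"
    using seq_congI[OF t, of "tgt \<Phi> (ext A \<Phi> \<beta>)"] by auto
qed

definition hc :: "'a ctx \<Rightarrow> 'a ctx \<Rightarrow> (nat \<Rightarrow> 'a expr) \<Rightarrow> (nat \<Rightarrow> 'a expr) \<Rightarrow> nat \<Rightarrow> 'a expr" where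
  "hc A \<Phi> \<alpha> \<beta> i = subst \<alpha> (ext A \<Phi> \<beta> i)"

lemma hc_subst: "(\<lambda>i. subst \<rho> (hc A \<Phi> \<alpha> \<beta> i)) = hc A \<Phi> (\<lambda>i. subst \<rho> (\<alpha> i)) \<beta>"
  by (simp add: fun_eq_iff hc_def)

lemma src_hc: "hom A \<beta> (id_ctx \<Phi>) \<Longrightarrow> src \<Phi> (hc A \<Phi> \<alpha> \<beta>) = (\<lambda>i. subst (src A \<alpha>) (src \<Phi> \<beta> i))"
proof -
  assume \<beta>: "hom A \<beta> (id_ctx \<Phi>)"
  have "src \<Phi> (hc A \<Phi> \<alpha> \<beta>) = (\<lambda>i. subst \<alpha> (src \<Phi> (ext A \<Phi> \<beta>) i))" by (simp add: src_def[abs_def] hc_def)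
  then show ?thesis by (simp add: ext(2)[OF \<beta>] src_subst)
qed

lemma tgt_hc:
  assumes \<alpha>: "seq \<Gamma> \<alpha> \<alpha>' (id_ctx A)" and \<beta>: "seq A \<beta> \<beta>' (id_ctx \<Phi>)"
  shows "seq \<Gamma> (tgt \<Phi> (hc A \<Phi> \<alpha> \<beta>)) (\<lambda>i. subst (tgt A \<alpha>') (tgt \<Phi> \<beta>' i)) \<Phi>"
proof -
  have "tgt \<Phi> (hc A \<Phi> \<alpha> \<beta>) = (\<lambda>i. subst \<alpha> (tgt \<Phi> (ext A \<Phi> \<beta>) i))" by (simp add: tgt_def[abs_def] hc_def)
  then have "seq \<Gamma> (tgt \<Phi> (hc A \<Phi> \<alpha> \<beta>)) (\<lambda>i. subst (tgt A \<alpha>) (tgt \<Phi> \<beta> i)) \<Phi>"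
    using seq_comp[OF seq_left[OF \<alpha>] ext(3)[OF seq_left[OF \<beta>]]] by (simp add: tgt_subst)
  also have "seq \<Gamma> (\<lambda>i. subst (tgt A \<alpha>) (tgt \<Phi> \<beta> i)) (\<lambda>i. subst (tgt A \<alpha>') (tgt \<Phi> \<beta>' i)) \<Phi>"
    by (rule seq_comp[OF seq_tgt[OF \<alpha>] seq_tgt[OF \<beta>]])
  finally show ?thesis .
qed

text \<open>An instance of \<open>cell_unique\<close> with empty post-context. It turns each law of
  \<open>hc\<close> into a check of the ends and a computation along \<open>dg\<close>.\<close>

lemma ext_unique:
  assumes \<beta>: "hom A \<beta> (id_ctx \<Phi>)" and c: "hom (id_ctx A) c (id_ctx \<Phi>)"
    and "seq (id_ctx A) (src \<Phi> c) (\<lambda>i. subst (src A Var) (src \<Phi> \<beta> i)) \<Phi>"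
    and "seq (id_ctx A) (tgt \<Phi> c) (\<lambda>i. subst (tgt A Var) (tgt \<Phi> \<beta> i)) \<Phi>"
    and "seq A (\<lambda>i. subst (dg A) (c i)) \<beta> (id_ctx \<Phi>)"
  shows "seq (id_ctx A) (ext A \<Phi> \<beta>) c (id_ctx \<Phi>)"
proof -
  have A: "is_ctx S A" using seq_ctx[OF \<beta>] by blast
  show ?thesis
    by (rule cell_unique0[OF A ext(1)[OF \<beta>] c _ seq_trans[OF ext(3)[OF \<beta>] seq_sym[OF assms(4)]]
      seq_trans[OF ext(4)[OF \<beta>] seq_sym[OF assms(5)]]]) (simp add: ext(2)[OF \<beta>] seq_sym[OF assms(3)])
qed

lemma seq_ext:
  assumes \<beta>: "seq A \<beta> \<beta>' (id_ctx \<Phi>)"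
  shows "seq (id_ctx A) (ext A \<Phi> \<beta>) (ext A \<Phi> \<beta>') (id_ctx \<Phi>)"
proof -
  note l = seq_left[OF \<beta>] and r = seq_right[OF \<beta>]
  have A: "is_ctx S A" using seq_ctx[OF \<beta>] by blast
  have v: "hom (id_ctx A) Var (id_ctx A)" using hom_id id_ctx_ctx[OF A] by blast
  have "seq (id_ctx A) (src \<Phi> (ext A \<Phi> \<beta>')) (\<lambda>i. subst (src A Var) (src \<Phi> \<beta> i)) \<Phi>"
    using seq_comp[OF seq_src[OF v] seq_src[OF seq_sym[OF \<beta>]]] by (simp add: ext(2)[OF r])
  moreover have "seq (id_ctx A) (tgt \<Phi> (ext A \<Phi> \<beta>')) (\<lambda>i. subst (tgt A Var) (tgt \<Phi> \<beta> i)) \<Phi>"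
    by (rule seq_trans[OF ext(3)[OF r] seq_comp[OF seq_tgt[OF v] seq_tgt[OF seq_sym[OF \<beta>]]]])
  ultimately show ?thesis
    by (rule ext_unique[OF l ext(1)[OF r]]) (rule seq_trans[OF ext(4)[OF r] seq_sym[OF \<beta>]])
qed

lemma seq_hc: "seq \<Gamma> \<alpha> \<alpha>' (id_ctx A) \<Longrightarrow> seq A \<beta> \<beta>' (id_ctx \<Phi>) \<Longrightarrow>
    seq \<Gamma> (hc A \<Phi> \<alpha> \<beta>) (hc A \<Phi> \<alpha>' \<beta>') (id_ctx \<Phi>)"
  unfolding hc_def[abs_def] by (rule seq_comp[OF _ seq_ext])

text \<open>An identity 2-cell is \<open>f\<close> substituted into the diagonal, so this is the
  computation rule of \<open>ext\<close>.\<close>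

lemma hc_idc_right:
  assumes f: "hom \<Gamma> f A" and \<beta>: "hom A \<beta> (id_ctx \<Phi>)"
  shows "seq \<Gamma> (hc A \<Phi> (idc A f) \<beta>) (\<lambda>i. subst f (\<beta> i)) (id_ctx \<Phi>)"
  using seq_comp[OF f ext(4)[OF \<beta>]] by (simp add: hc_def[abs_def] idc_def[abs_def])

text \<open>The generic 2-cell \<open>Var\<close> restricts to \<open>dg A\<close> along the
  diagonal and has the right ends, so it is the extension of the identity 2-cell on the identity of
  \<open>A\<close>.\<close>

lemma hc_dg_left:
  assumes \<alpha>: "hom \<Gamma> \<alpha> (id_ctx A)"
  shows "seq \<Gamma> (hc A A \<alpha> (dg A)) \<alpha> (id_ctx A)"
proof -
  have A: "is_ctx S A" using seq_ctx[OF seq_src[OF \<alpha>]] by blast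
  have v: "hom (id_ctx A) Var (id_ctx A)" using hom_id id_ctx_ctx[OF A] by blast
  have "seq (id_ctx A) (ext A A (dg A)) Var (id_ctx A)"
  proof (rule ext_unique[OF dg_hom[OF A] v])
    show "seq (id_ctx A) (src A Var) (\<lambda>i. subst (src A Var) (src A (dg A) i)) A"
      using seq_src[OF v] by (simp add: src_dg)
    show "seq (id_ctx A) (tgt A Var) (\<lambda>i. subst (tgt A Var) (tgt A (dg A) i)) A"
      using seq_comp[OF seq_tgt[OF v] seq_sym[OF tgt_dg[OF A]]] by simp
  qed (use dg_hom[OF A] in simp)
  from seq_comp[OF \<alpha> this] show ?thesis by (simp add: hc_def[abs_def])
qed

text \<open>For generic \<open>\<alpha>\<close> the right side is the extension of
  \<open>hc B C \<beta> \<gamma>\<close>: on the diagonal its inner composite collapses to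
  \<open>\<beta>\<close>. Substituting \<open>\<alpha>\<close> gives the general case.\<close>

lemma hc_assoc:
  assumes \<alpha>: "hom \<Gamma> \<alpha> (id_ctx A)" and \<beta>: "hom A \<beta> (id_ctx B)" and \<gamma>: "hom B \<gamma> (id_ctx C)"
  shows "seq \<Gamma> (hc A C \<alpha> (hc B C \<beta> \<gamma>)) (hc B C (hc A B \<alpha> \<beta>) \<gamma>) (id_ctx C)"
proof -
  have A: "is_ctx S A" using seq_ctx[OF \<beta>] by blast
  have v: "hom (id_ctx A) Var (id_ctx A)" using hom_id id_ctx_ctx[OF A] by blast
  have \<beta>\<gamma>: "hom A (hc B C \<beta> \<gamma>) (id_ctx C)" by (rule seq_hc[OF \<beta> \<gamma>])
  have x\<beta>: "hom (id_ctx A) (hc A B Var \<beta>) (id_ctx B)" by (rule seq_hc[OF v \<beta>])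
  let ?c = "hc B C (hc A B Var \<beta>) \<gamma>"
  have c: "hom (id_ctx A) ?c (id_ctx C)" by (rule seq_hc[OF x\<beta> \<gamma>])
  have "seq (id_ctx A) (ext A C (hc B C \<beta> \<gamma>)) ?c (id_ctx C)"
  proof (rule ext_unique[OF \<beta>\<gamma> c])
    show "seq (id_ctx A) (src C ?c) (\<lambda>i. subst (src A Var) (src C (hc B C \<beta> \<gamma>) i)) C"
      using seq_src[OF c] by (simp add: src_hc[OF \<beta>] src_hc[OF \<gamma>])
    show "seq (id_ctx A) (tgt C ?c) (\<lambda>i. subst (tgt A Var) (tgt C (hc B C \<beta> \<gamma>) i)) C"
    proof -
      have "seq (id_ctx A) (tgt C ?c) (\<lambda>i. subst (tgt B (hc A B Var \<beta>)) (tgt C \<gamma> i)) C"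
        by (rule tgt_hc[OF x\<beta> \<gamma>])
      also have "seq (id_ctx A) (\<lambda>i. subst (tgt B (hc A B Var \<beta>)) (tgt C \<gamma> i)) (\<lambda>i. subst (\<lambda>i. subst (tgt A Var) (tgt B \<beta> i)) (tgt C \<gamma> i)) C"
        by (rule seq_comp[OF tgt_hc[OF v \<beta>] seq_tgt[OF \<gamma>]])
      also have "seq (id_ctx A) (\<lambda>i. subst (\<lambda>i. subst (tgt A Var) (tgt B \<beta> i)) (tgt C \<gamma> i)) (\<lambda>i. subst (tgt A Var) (tgt C (hc B C \<beta> \<gamma>) i)) C"
        using seq_comp[OF seq_tgt[OF v] seq_sym[OF tgt_hc[OF \<beta> \<gamma>]]] by simp
      finally show ?thesis .
    qed
    have "seq A (hc A B (dg A) \<beta>) \<beta> (id_ctx B)"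
      using hc_idc_right[OF hom_id[OF A] \<beta>] by (simp add: idc_Var)
    from seq_hc[OF this \<gamma>] show "seq A (\<lambda>i. subst (dg A) (?c i)) (hc B C \<beta> \<gamma>) (id_ctx C)"
      by (simp add: hc_subst)
  qed
  from seq_comp[OF \<alpha> this] show ?thesis
    by (simp add: hc_subst) (simp add: hc_def[abs_def])
qed

text \<open>Elimination makes the first of two generic 2-cells into \<open>A\<close> an identity.
  The left side turns into the extension of the composite of \<open>\<beta>\<close> and
  \<open>\<beta>'\<close>, the right side into \<open>\<beta>\<close> at the source followed by the
  extension of \<open>\<beta>'\<close>; these agree by \<open>ext_vc\<close>.\<close>

lemma vc_hc_interchange:
  assumes \<alpha>: "hom \<Gamma> \<alpha> (id_ctx A)" and \<alpha>': "hom \<Gamma> \<alpha>' (id_ctx A)" and \<beta>: "hom A \<beta> (id_ctx B)" and \<beta>': "hom A \<beta>' (id_ctx B)"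
    and \<alpha>\<alpha>': "seq \<Gamma> (tgt A \<alpha>) (src A \<alpha>') A" and \<beta>\<beta>': "seq A (tgt B \<beta>) (src B \<beta>') B"
  shows "seq \<Gamma> (hc A B (vc A \<alpha> \<alpha>') (vc B \<beta> \<beta>')) (vc B (hc A B \<alpha> \<beta>) (hc A B \<alpha>' \<beta>')) (id_ctx B)"
proof -
  have A: "is_ctx S A" and B: "is_ctx S B" using \<alpha>\<alpha>' \<beta>\<beta>' seq_ctx by auto
  let ?I = "id_ctx A" and ?J = "id_ctx B" let ?T = "adjoin A ?I"
  have v: "hom ?I Var ?I" using hom_id id_ctx_ctx[OF A] by blast
  have \<beta>2: "hom A (vc B \<beta> \<beta>') ?J" by (rule seq_vc[OF \<beta> \<beta>' \<beta>\<beta>'])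
  let ?x = "\<lambda>i. subst (src A Var) (\<beta> i)"
  have x: "hom ?I ?x ?J" by (rule seq_comp[OF seq_src[OF v] \<beta>])
  have xe: "seq ?I (tgt B ?x) (src B (ext A B \<beta>')) B"
    using seq_comp[OF seq_src[OF v] \<beta>\<beta>'] by (simp add: ext(2)[OF \<beta>'] tgt_subst)
  have e: "hom ?I (vc B ?x (ext A B \<beta>')) ?J" by (rule seq_vc[OF x ext(1)[OF \<beta>'] xe])
  \<comment> \<open>On the diagonal, \<open>\<beta>\<close> at the source is \<open>\<beta>\<close>
    and the extension of \<open>\<beta>'\<close> is \<open>\<beta>'\<close>, so this composite also
    extends \<open>vc B \<beta> \<beta>'\<close>.\<close>
  have ext_vc: "seq ?I (ext A B (vc B \<beta> \<beta>')) (vc B ?x (ext A B \<beta>')) ?J"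
  proof (rule ext_unique[OF \<beta>2 e])
    show "seq ?I (src B (vc B ?x (ext A B \<beta>'))) (\<lambda>i. subst (src A Var) (src B (vc B \<beta> \<beta>') i)) B"
      using seq_src[OF x] by (simp add: src_vc[OF B] src_subst)
    show "seq ?I (tgt B (vc B ?x (ext A B \<beta>'))) (\<lambda>i. subst (tgt A Var) (tgt B (vc B \<beta> \<beta>') i)) B"
      by (rule seq_trans[OF seq_trans[OF tgt_vc[OF ext(1)[OF \<beta>']] ext(3)[OF \<beta>']]
        seq_comp[OF seq_tgt[OF v] seq_sym[OF tgt_vc[OF \<beta>']]]])
    have "seq A (tgt B \<beta>) (src B (\<lambda>i. subst (dg A) (ext A B \<beta>' i))) B"
      by (rule seq_trans[OF \<beta>\<beta>' seq_sym[OF seq_src[OF ext(4)[OF \<beta>']]]])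
    from seq_vc[OF \<beta> ext(4)[OF \<beta>'] this]
    show "seq A (\<lambda>i. subst (dg A) (vc B ?x (ext A B \<beta>') i)) (vc B \<beta> \<beta>') ?J"
      by (simp add: vc_subst src_subst src_dg)
  qed
  define n where "n = length A"
  obtain \<Delta> where \<Delta>: "?T = \<Delta> @ ?I" "length \<Delta> = 2 * n" "subst_tele (dg A) \<Delta> @ A = ?I"
    using adjoin_diag(1)[OF A] n_def by blast
  note I = hom_py[OF id_ctx_ctx[OF A]]
  note T = adjoin_ctx[OF I]
  let ?a = "\<lambda>i. Var (i + 2 * n)" and ?a' = "last_cell A"
  have a: "hom ?T ?a ?I" using T(3) by (simp add: n_def)
  have a': "hom ?T ?a' ?I" using T(2) .
  have aa': "seq ?T (tgt A ?a) (src A ?a') A"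
    by (rule seq_congI[OF seq_tgt[OF a]]) (auto simp: src_def tgt_def last_cell_def n_def)
  have hab: "seq ?T (tgt B (hc A B ?a \<beta>)) (src B (hc A B ?a' \<beta>')) B"
    using seq_trans[OF tgt_hc[OF a \<beta>] seq_comp[OF aa' \<beta>\<beta>']] by (simp add: src_hc[OF \<beta>'])
  let ?L = "hc A B (vc A ?a ?a') (vc B \<beta> \<beta>')" and ?R = "vc B (hc A B ?a \<beta>) (hc A B ?a' \<beta>')"
  have hL: "hom ?T ?L ?J" by (rule seq_hc[OF seq_vc[OF a a' aa'] \<beta>2])
  have hR: "hom ?T ?R ?J" by (rule seq_vc[OF seq_hc[OF a \<beta>] seq_hc[OF a' \<beta>'] hab])
  define \<delta> where "\<delta> = lift (2 * n) (dg A)"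
  have c\<Delta>: "is_ctx S (\<Delta> @ ?I)" using T(1) \<Delta>(1) by simp
  have \<delta>: "hom ?I \<delta> ?T"
    using seq_lift[OF dg_hom[OF A] c\<Delta>] unfolding \<Delta> \<delta>_def .
  \<comment> \<open>The first cell of the generic pair degenerates to an identity, and the second
    becomes the generic 2-cell.\<close>
  have a1: "(\<lambda>i. subst \<delta> (?a i)) = idc A (src A Var)"
    by (simp add: fun_eq_iff \<delta>_def idc_def wk_eq_subst lift_def src_def[abs_def] n_def)
  have a1': "seq ?I (\<lambda>i. subst \<delta> (?a' i)) Var ?I"
    by (rule seq_congI[OF v]) (auto simp: \<delta>_def last_cell_def lift_def dg_def n_def)
  have a1a1: "seq ?I (tgt A (idc A (src A Var))) (src A (\<lambda>i. subst \<delta> (?a' i))) A"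
    using seq_comp[OF \<delta> aa'] by (simp only: tgt_subst src_subst a1)
  have d: "seq ?I (\<lambda>i. subst \<delta> (?L i)) (\<lambda>i. subst \<delta> (?R i)) ?J"
  proof -
    have "seq ?I (vc A (idc A (src A Var)) (\<lambda>i. subst \<delta> (?a' i))) Var ?I"
      using seq_trans[OF vc_idc_left a1'] seq_left[OF a1'] seq_trans[OF seq_sym[OF seq_tgt_idc[OF seq_src[OF v]]] a1a1] by blast
    from seq_hc[OF this \<beta>2]
    have L: "seq ?I (\<lambda>i. subst \<delta> (?L i)) (ext A B (vc B \<beta> \<beta>')) ?J"
      by (simp only: hc_subst vc_subst a1) (simp add: hc_def[abs_def])
    have 1: "seq ?I (hc A B (idc A (src A Var)) \<beta>) ?x ?J" by (rule hc_idc_right[OF seq_src[OF v] \<beta>])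
    have 2: "seq ?I (hc A B (\<lambda>i. subst \<delta> (?a' i)) \<beta>') (ext A B \<beta>') ?J"
      using seq_hc[OF a1' \<beta>'] by (simp add: hc_def[abs_def])
    have 3: "seq ?I (tgt B (hc A B (idc A (src A Var)) \<beta>)) (src B (hc A B (\<lambda>i. subst \<delta> (?a' i)) \<beta>')) B"
      using seq_comp[OF \<delta> hab] by (simp only: tgt_subst src_subst hc_subst a1)
    have R: "seq ?I (\<lambda>i. subst \<delta> (?R i)) (vc B ?x (ext A B \<beta>')) ?J"
      using seq_vc[OF 1 2 3] by (simp only: hc_subst vc_subst a1)
    show ?thesis by (rule seq_trans[OF seq_trans[OF L ext_vc] seq_sym[OF R]])
  qed
  have "seq (\<Delta> @ ?I) ?L ?R ?J"
  proof (rule cell_unique[OF A])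
    show "hom (\<Delta> @ ?I) ?L ?J" "hom (\<Delta> @ ?I) ?R ?J" using hL hR \<Delta>(1) by simp_all
    show "seq (\<Delta> @ ?I) (src B ?L) (src B ?R) B"
      using seq_src[OF hL] \<Delta>(1) by (simp add: src_vc[OF A] src_vc[OF B] src_hc[OF \<beta>] src_hc[OF \<beta>2])
    have "seq ?T (tgt B ?L) (\<lambda>i. subst (tgt A ?a') (tgt B \<beta>' i)) B"
      by (rule seq_trans[OF tgt_hc[OF seq_vc[OF a a' aa'] \<beta>2] seq_comp[OF tgt_vc[OF a'] tgt_vc[OF \<beta>']]])
    from seq_trans[OF this seq_sym[OF seq_trans[OF tgt_vc[OF seq_hc[OF a' \<beta>']] tgt_hc[OF a' \<beta>']]]]
    show "seq (\<Delta> @ ?I) (tgt B ?L) (tgt B ?R) B" using \<Delta>(1) by simp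
    show "seq (subst_tele (dg A) \<Delta> @ A) (\<lambda>i. subst (lift (length \<Delta>) (dg A)) (?L i)) (\<lambda>i. subst (lift (length \<Delta>) (dg A)) (?R i)) ?J"
      using d unfolding \<Delta>(2,3) \<delta>_def .
  qed
  then have LR: "seq ?T ?L ?R ?J" using \<Delta>(1) by simp
  let ?p = "pair A \<alpha> \<alpha>'"
  have p: "hom \<Gamma> ?p ?T" by (rule seq_pair[OF I \<alpha> \<alpha>' \<alpha>\<alpha>'])
  have pa: "(\<lambda>i. subst ?p (?a i)) = \<alpha>" by (simp add: fun_eq_iff pair_def n_def)
  have pa': "seq \<Gamma> (\<lambda>i. subst ?p (?a' i)) \<alpha>' ?I" by (rule pair_last_cell[OF \<alpha>' \<alpha>\<alpha>'])
  have paa': "seq \<Gamma> (tgt A \<alpha>) (src A (\<lambda>i. subst ?p (?a' i))) A"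
    using seq_comp[OF p aa'] by (simp only: tgt_subst src_subst pa)
  have ph: "seq \<Gamma> (tgt B (hc A B \<alpha> \<beta>)) (src B (hc A B (\<lambda>i. subst ?p (?a' i)) \<beta>')) B"
    using seq_comp[OF p hab] by (simp only: tgt_subst src_subst hc_subst pa)
  have m: "seq \<Gamma> (hc A B (vc A \<alpha> (\<lambda>i. subst ?p (?a' i))) (vc B \<beta> \<beta>')) (vc B (hc A B \<alpha> \<beta>) (hc A B (\<lambda>i. subst ?p (?a' i)) \<beta>')) ?J"
    using seq_comp[OF p LR] by (simp only: hc_subst vc_subst pa)
  have l: "seq \<Gamma> (hc A B (vc A \<alpha> (\<lambda>i. subst ?p (?a' i))) (vc B \<beta> \<beta>')) (hc A B (vc A \<alpha> \<alpha>') (vc B \<beta> \<beta>')) ?J"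
    by (rule seq_hc[OF seq_vc[OF \<alpha> pa' paa'] \<beta>2])
  have r: "seq \<Gamma> (vc B (hc A B \<alpha> \<beta>) (hc A B (\<lambda>i. subst ?p (?a' i)) \<beta>')) (vc B (hc A B \<alpha> \<beta>) (hc A B \<alpha>' \<beta>')) ?J"
    by (rule seq_vc[OF seq_hc[OF \<alpha> \<beta>] seq_hc[OF pa' \<beta>'] ph])
  show ?thesis by (rule seq_trans[OF seq_trans[OF seq_sym[OF l] m] r])
qed

end

section \<open>The 2-category of contexts\<close>

text \<open>\<open>arr_id\<close> and \<open>arr_comp\<close> take the image of all choices of
  representatives; their value is a single class once every choice gives the same one.\<close>

lemma Image_eq: "A \<noteq> {} \<Longrightarrow> (\<And>x. x \<in> A \<Longrightarrow> r `` {x} = C) \<Longrightarrow> r `` A = C"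
  by auto

lemma map_inst: "length f = n \<Longrightarrow> map (inst 0 f) [0..<n] = f"
  by (rule nth_equalityI) (auto simp: inst_def)

context discrete_identity_type_theory
begin

section \<open>Classes described by functions on variables\<close>

definition mkob :: "'a ctx \<Rightarrow> 'a ctx set" where
  "mkob \<Gamma> = {\<Gamma>'. eq_tele S [] \<Gamma> \<Gamma>'}"

definition mkmor :: "'a ctx \<Rightarrow> (nat \<Rightarrow> 'a expr) \<Rightarrow> 'a ctx \<Rightarrow> 'a ctx_mor set" where
  "mkmor \<Gamma> f \<Delta> = {(\<Gamma>', map f' [0..<length \<Delta>'], \<Delta>') | \<Gamma>' f' \<Delta>'.
    eq_tele S [] \<Gamma> \<Gamma>' \<and> eq_tele S [] \<Delta> \<Delta>' \<and> seq \<Gamma> f f' \<Delta>}"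

text \<open>The most recent variables of \<open>id_ctx \<Delta>\<close> come first, so the first
  \<open>length \<Delta>\<close> values of \<open>c\<close> are the entries of the identity
  proof.\<close>

definition tup :: "'a ctx \<Rightarrow> 'a ctx \<Rightarrow> (nat \<Rightarrow> 'a expr) \<Rightarrow> 'a ctx_cell" where
  "tup \<Gamma> \<Delta> c = (\<Gamma>, \<Delta>, map (src \<Delta> c) [0..<length \<Delta>], map (tgt \<Delta> c) [0..<length \<Delta>], map c [0..<length \<Delta>])"

definition mkcell :: "'a ctx \<Rightarrow> 'a ctx \<Rightarrow> (nat \<Rightarrow> 'a expr) \<Rightarrow> 'a ctx_cell set" where
  "mkcell \<Gamma> \<Delta> c = {tup \<Gamma>' \<Delta>' c' | \<Gamma>' \<Delta>' c'.
    eq_tele S [] \<Gamma> \<Gamma>' \<and> eq_tele S [] \<Delta> \<Delta>' \<and> seq \<Gamma> c c' (id_ctx \<Delta>)}"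

lemma eq_ctx_refl: "is_ctx S \<Gamma> \<Longrightarrow> eq_tele S [] \<Gamma> \<Gamma>"
  using eq_tele_refl[of \<Gamma> "[]"] by simp

lemma ob_rel_class: "ob_rel S `` {\<Gamma>} = mkob \<Gamma>"
  by (auto simp: ob_rel_def mkob_def)

lemma objects_iff: "X \<in> objects S \<longleftrightarrow> (\<exists>\<Gamma>. is_ctx S \<Gamma> \<and> X = mkob \<Gamma>)"
  by (auto simp: objects_def quotient_def ob_rel_class)

lemma mkob_eq: "is_ctx S \<Gamma> \<Longrightarrow> mkob \<Gamma> = mkob \<Gamma>' \<longleftrightarrow> eq_tele S [] \<Gamma> \<Gamma>'"
proof
  assume "is_ctx S \<Gamma>" "mkob \<Gamma> = mkob \<Gamma>'"
  then have "\<Gamma> \<in> mkob \<Gamma>'" using eq_ctx_refl by (auto simp: mkob_def)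
  then show "eq_tele S [] \<Gamma> \<Gamma>'" using eq_ctx_sym by (simp add: mkob_def)
next
  assume e: "eq_tele S [] \<Gamma> \<Gamma>'"
  show "mkob \<Gamma> = mkob \<Gamma>'"
    unfolding mkob_def using eq_ctx_trans[OF e] eq_ctx_trans[OF eq_ctx_sym[OF e]] by auto
qed

lemma eq_elem_length: "eq_elem S \<Gamma> ts us \<Delta> \<Longrightarrow> length ts = length \<Delta> \<and> length us = length \<Delta>"
  by (induction S \<Gamma> ts us \<Delta> rule: eq_elem.induct) auto

lemma eq_elem_closed:
  assumes "is_ctx S \<Gamma>" "is_ctx S \<Delta>"
  shows "eq_elem S \<Gamma> ts us \<Delta> \<longleftrightarrow> length ts = length \<Delta> \<and> length us = length \<Delta> \<and> seq \<Gamma> (inst 0 ts) (inst 0 us) \<Delta>"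
  using seq_eq_elem_iff[OF assms, of "inst 0 ts" "inst 0 us"] eq_elem_length[of \<Gamma> ts us \<Delta>]
  by (auto simp: map_inst)

lemma mor_rel_class:
  assumes "hom \<Gamma> f \<Delta>"
  shows "mor_rel S `` {(\<Gamma>, map f [0..<length \<Delta>], \<Delta>)} = mkmor \<Gamma> f \<Delta>"
proof (intro set_eqI iffI)
  have c: "is_ctx S \<Gamma>" "is_ctx S \<Delta>" using assms seq_ctx by auto
  fix x
  {
    assume "x \<in> mor_rel S `` {(\<Gamma>, map f [0..<length \<Delta>], \<Delta>)}"
    then obtain \<Gamma>' f' \<Delta>' where x: "x = (\<Gamma>', f', \<Delta>')" "eq_tele S [] \<Gamma> \<Gamma>'" "eq_tele S [] \<Delta> \<Delta>'"
      and f': "eq_elem S \<Gamma> (map f [0..<length \<Delta>]) f' \<Delta>" by (auto simp: mor_rel_def)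
    have l: "length f' = length \<Delta>'" using eq_elem_length[OF f'] eq_tele_length[OF x(3)] by simp
    have "seq \<Gamma> f (inst 0 f') \<Delta>"
      using f' eq_elem_length[OF f'] seq_eq_elem_iff[OF c, of f "inst 0 f'"] by (simp add: map_inst)
    then show "x \<in> mkmor \<Gamma> f \<Delta>"
      using x l by (auto simp: mkmor_def map_inst intro!: exI[of _ "inst 0 f'"])
  }
  {
    assume "x \<in> mkmor \<Gamma> f \<Delta>"
    then obtain \<Gamma>' f' \<Delta>' where x: "x = (\<Gamma>', map f' [0..<length \<Delta>'], \<Delta>')" "eq_tele S [] \<Gamma> \<Gamma>'" "eq_tele S [] \<Delta> \<Delta>'"
      and f': "seq \<Gamma> f f' \<Delta>" by (auto simp: mkmor_def)
    then show "x \<in> mor_rel S `` {(\<Gamma>, map f [0..<length \<Delta>], \<Delta>)}"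
      using seq_eq_elem_iff[OF c, of f f'] eq_tele_length[OF x(3)] by (auto simp: mor_rel_def)
  }
qed

lemma mkmor_cong:
  assumes e: "eq_tele S [] \<Gamma> \<Gamma>'" "eq_tele S [] \<Delta> \<Delta>'" and f: "seq \<Gamma> f f' \<Delta>"
  shows "mkmor \<Gamma> f \<Delta> = mkmor \<Gamma>' f' \<Delta>'"
proof -
  \<comment> \<open>One inclusion is stated for arbitrary data, so that the reverse one is its
    instance with the two sides exchanged.\<close>
  have 1: "mkmor \<Gamma>' f' \<Delta>' \<subseteq> mkmor \<Gamma> f \<Delta>"
    if e: "eq_tele S [] \<Gamma> \<Gamma>'" "eq_tele S [] \<Delta> \<Delta>'" and f: "seq \<Gamma> f f' \<Delta>" for \<Gamma> \<Gamma>' \<Delta> \<Delta>' f f'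
  proof -
    have "seq \<Gamma> f g \<Delta>" if "seq \<Gamma>' f' g \<Delta>'" for g
      using seq_trans[OF f seq_conv_source[OF eq_ctx_sym[OF e(1)] seq_conv_target[OF eq_ctx_sym[OF e(2)] that]]] .
    then show ?thesis using eq_ctx_trans[OF e(1)] eq_ctx_trans[OF e(2)] unfolding mkmor_def by blast
  qed
  show ?thesis
    using 1[OF e f] 1[OF eq_ctx_sym[OF e(1)] eq_ctx_sym[OF e(2)] seq_conv_source[OF e(1) seq_conv_target[OF e(2) seq_sym[OF f]]]]
    by blast
qed

lemma mkmor_mem:
  assumes f: "hom \<Gamma> f \<Delta>" and x: "x \<in> mkmor \<Gamma> f \<Delta>"
  shows "mor_rel S `` {x} = mkmor \<Gamma> f \<Delta>"
proof -
  obtain \<Gamma>' f' \<Delta>' where x: "x = (\<Gamma>', map f' [0..<length \<Delta>'], \<Delta>')" and e: "eq_tele S [] \<Gamma> \<Gamma>'" "eq_tele S [] \<Delta> \<Delta>'"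
      and f': "seq \<Gamma> f f' \<Delta>" using x by (auto simp: mkmor_def)
  have "hom \<Gamma>' f' \<Delta>'" using seq_conv_source[OF e(1) seq_conv_target[OF e(2) seq_right[OF f']]] .
  from mor_rel_class[OF this] mkmor_cong[OF e f'] show ?thesis by (simp add: x)
qed

lemma self_mkmor: "hom \<Gamma> f \<Delta> \<Longrightarrow> (\<Gamma>, map f [0..<length \<Delta>], \<Delta>) \<in> mkmor \<Gamma> f \<Delta>"
  unfolding mkmor_def using eq_ctx_refl seq_ctx by blast

lemma mkmor_eq:
  assumes f: "hom \<Gamma> f \<Delta>" and eq: "mkmor \<Gamma>' f' \<Delta>' = mkmor \<Gamma> f \<Delta>"
  shows "eq_tele S [] \<Gamma>' \<Gamma> \<and> eq_tele S [] \<Delta>' \<Delta> \<and> seq \<Gamma>' f' f \<Delta>'"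
proof -
  have "(\<Gamma>, map f [0..<length \<Delta>], \<Delta>) \<in> mkmor \<Gamma>' f' \<Delta>'" using self_mkmor[OF f] eq by simp
  then obtain g where g: "eq_tele S [] \<Gamma>' \<Gamma>" "eq_tele S [] \<Delta>' \<Delta>" "seq \<Gamma>' f' g \<Delta>'"
    "map f [0..<length \<Delta>] = map g [0..<length \<Delta>]" by (auto simp: mkmor_def)
  have "seq \<Gamma>' f' f \<Delta>'"
    by (rule seq_congI[OF g(3)]) (use g(4) eq_tele_length[OF g(2)] in auto)
  with g show ?thesis by blast
qed

lemma arrows_iff: "F \<in> arrows S \<longleftrightarrow> (\<exists>\<Gamma> f \<Delta>. hom \<Gamma> f \<Delta> \<and> F = mkmor \<Gamma> f \<Delta>)"
proof
  assume "F \<in> arrows S"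
  then obtain \<Gamma> f \<Delta> where F: "is_ctx S \<Gamma>" "is_ctx S \<Delta>" "elem S \<Gamma> f \<Delta>" "F = mor_rel S `` {(\<Gamma>, f, \<Delta>)}"
    by (auto simp: arrows_def quotient_def)
  then have "length f = length \<Delta>" "hom \<Gamma> (inst 0 f) \<Delta>" by (auto simp: elem_iff eq_elem_closed)
  then show "\<exists>\<Gamma> f \<Delta>. hom \<Gamma> f \<Delta> \<and> F = mkmor \<Gamma> f \<Delta>"
    using mor_rel_class[of \<Gamma> "inst 0 f" \<Delta>] F(4) by (auto simp: map_inst)
next
  assume "\<exists>\<Gamma> f \<Delta>. hom \<Gamma> f \<Delta> \<and> F = mkmor \<Gamma> f \<Delta>"
  then obtain \<Gamma> f \<Delta> where f: "hom \<Gamma> f \<Delta>" "F = mkmor \<Gamma> f \<Delta>" by blast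
  then show "F \<in> arrows S"
    using mor_rel_class[OF f(1)] seq_ctx[OF f(1)] seq_elem[OF f(1)] by (auto simp: arrows_def quotient_def)
qed

lemma arr_dom: "hom \<Gamma> f \<Delta> \<Longrightarrow> arr_dom (mkmor \<Gamma> f \<Delta>) = mkob \<Gamma>"
  and arr_cod: "hom \<Gamma> f \<Delta> \<Longrightarrow> arr_cod (mkmor \<Gamma> f \<Delta>) = mkob \<Delta>"
  using eq_ctx_refl seq_ctx[of \<Gamma> f f \<Delta>] unfolding arr_dom_def arr_cod_def mkmor_def mkob_def by blast+

lemma arr_id:
  assumes \<Gamma>: "is_ctx S \<Gamma>"
  shows "arr_id S (mkob \<Gamma>) = mkmor \<Gamma> Var \<Gamma>"
  unfolding arr_id_def
proof (rule Image_eq)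
  show "{(\<Gamma>', vars 0 (length \<Gamma>') :: 'a expr list, \<Gamma>') |\<Gamma>'. \<Gamma>' \<in> mkob \<Gamma>} \<noteq> {}"
    using eq_ctx_refl[OF \<Gamma>] by (auto simp: mkob_def)
  fix x assume "x \<in> {(\<Gamma>', vars 0 (length \<Gamma>') :: 'a expr list, \<Gamma>') |\<Gamma>'. \<Gamma>' \<in> mkob \<Gamma>}"
  then have "x \<in> mkmor \<Gamma> Var \<Gamma>"
    using hom_id[OF \<Gamma>] by (auto simp: mkob_def mkmor_def vars_def)
  then show "mor_rel S `` {x} = mkmor \<Gamma> Var \<Gamma>" by (rule mkmor_mem[OF hom_id[OF \<Gamma>]])
qed

lemma arr_comp:
  assumes f: "hom \<Gamma> f \<Delta>" and g: "hom \<Delta> g \<Theta>"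
  shows "arr_comp S (mkmor \<Delta> g \<Theta>) (mkmor \<Gamma> f \<Delta>) = mkmor \<Gamma> (\<lambda>i. subst f (g i)) \<Theta>"
  unfolding arr_comp_def
proof (rule Image_eq)
  let ?A = "{(\<Gamma>', map (subst (inst 0 f')) g', \<Theta>') |\<Gamma>' f' \<Delta>' g' \<Theta>'.
    (\<Gamma>', f', \<Delta>') \<in> mkmor \<Gamma> f \<Delta> \<and> (\<Delta>', g', \<Theta>') \<in> mkmor \<Delta> g \<Theta>}"
  show "?A \<noteq> {}" using self_mkmor[OF f] self_mkmor[OF g] by blast
  fix x assume "x \<in> ?A"
  then obtain \<Gamma>' f' \<Delta>' g' \<Theta>' where x: "x = (\<Gamma>', map (subst (inst 0 f')) g', \<Theta>')"
    "(\<Gamma>', f', \<Delta>') \<in> mkmor \<Gamma> f \<Delta>" "(\<Delta>', g', \<Theta>') \<in> mkmor \<Delta> g \<Theta>" by blast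
  then obtain f1 g1 where f1: "f' = map f1 [0..<length \<Delta>']" "eq_tele S [] \<Gamma> \<Gamma>'" "eq_tele S [] \<Delta> \<Delta>'" "seq \<Gamma> f f1 \<Delta>"
    and g1: "g' = map g1 [0..<length \<Theta>']" "eq_tele S [] \<Theta> \<Theta>'" "seq \<Delta> g g1 \<Theta>"
    by (auto simp: mkmor_def)
  \<comment> \<open>Composition is defined through the list \<open>f'\<close>, which represents the
    function \<open>f1\<close> only below the length of \<open>\<Delta>\<close>.\<close>
  have "seq \<Gamma> f (inst 0 f') \<Delta>"
    by (rule seq_congI[OF f1(4)]) (simp_all add: f1(1) eq_tele_length[OF f1(3)] inst_map)
  from seq_comp[OF this g1(3)]
  have "x \<in> mkmor \<Gamma> (\<lambda>i. subst f (g i)) \<Theta>"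
    unfolding mkmor_def x(1) g1(1) using f1(2) g1(2) by (auto intro!: exI[of _ "\<lambda>i. subst (inst 0 f') (g1 i)"])
  then show "mor_rel S `` {x} = mkmor \<Gamma> (\<lambda>i. subst f (g i)) \<Theta>" by (rule mkmor_mem[OF seq_comp[OF f g]])
qed

text \<open>The definition compares \<open>\<alpha>\<close> and \<open>\<alpha>'\<close> over the
  ends \<open>f\<close> and \<open>g\<close>, whereas the second cell read as a morphism carries
  \<open>f'\<close> and \<open>g'\<close>. The equality of the ends bridges the two typings.\<close>

lemma eq_elem_cell:
  assumes \<Gamma>: "is_ctx S \<Gamma>" and \<Delta>: "is_ctx S \<Delta>"
  shows "eq_elem S \<Gamma> f f' \<Delta> \<and> eq_elem S \<Gamma> g g' \<Delta> \<and> eq_elem S \<Gamma> \<alpha> \<alpha>' (Id_ctx \<Delta> f g) \<longleftrightarrow>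
    list_all (\<lambda>ts. length ts = length \<Delta>) [f, f', g, g', \<alpha>, \<alpha>'] \<and>
    seq \<Gamma> (inst 0 (\<alpha> @ g @ f)) (inst 0 (\<alpha>' @ g' @ f')) (id_ctx \<Delta>)" (is "?P \<longleftrightarrow> ?L \<and> ?Q")
proof -
  define n where "n = length \<Delta>"
  have ci: "is_ctx S (Id_ctx_gen \<Delta> @ \<Delta> @ \<Delta>)" using id_ctx_ctx[OF \<Delta>] by (simp add: id_ctx_def)
  have e: "seq \<Gamma> (inst 0 f) (inst 0 f') \<Delta> \<longleftrightarrow> seq \<Gamma> (src \<Delta> (inst 0 (\<alpha> @ g @ f))) (src \<Delta> (inst 0 (\<alpha>' @ g' @ f'))) \<Delta>"
    "seq \<Gamma> (inst 0 g) (inst 0 g') \<Delta> \<longleftrightarrow> seq \<Gamma> (tgt \<Delta> (inst 0 (\<alpha> @ g @ f))) (tgt \<Delta> (inst 0 (\<alpha>' @ g' @ f'))) \<Delta>" if ?L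
    by (rule seq_cong; use that in \<open>auto simp: src_def tgt_def inst_def nth_append\<close>)+
  have main: "eq_elem S \<Gamma> \<alpha> \<alpha>' (Id_ctx \<Delta> f g) \<longleftrightarrow> ?Q"
    if L: ?L and F: "seq \<Gamma> (inst 0 f) (inst 0 f') \<Delta>" and G: "seq \<Gamma> (inst 0 g) (inst 0 g') \<Delta>"
  proof -
    have l: "length f = n" "length f' = n" "length g = n" "length g' = n" "length \<alpha> = n" "length \<alpha>' = n"
      using L by (auto simp: n_def)
    have \<kappa>: "seq \<Gamma> (inst 0 (g @ f)) (inst 0 (g' @ f')) (\<Delta> @ \<Delta>)"
      by (rule seq_closed_append; rule seq_congI, rule F G)
        (auto simp: inst_def nth_append l n_def[symmetric])
    have c: "is_ctx S (Id_ctx \<Delta> f g @ \<Gamma>)"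
      unfolding Id_ctx_def using eq_tele_ctx[OF seq_tele[OF \<kappa> eq_tele_refl[OF ci], THEN conjunct1] \<Gamma>] .
    \<comment> \<open>This fact and the next exchange the ends below a fixed
      \<open>\<alpha>'\<close>, starting from its typing over \<open>f\<close>, \<open>g\<close> and
      over \<open>f'\<close>, \<open>g'\<close> respectively.\<close>
    have r: "seq \<Gamma> (inst 0 (\<alpha>' @ g' @ f')) (inst 0 (\<alpha>' @ g @ f)) (id_ctx \<Delta>)"
      if h: "hom \<Gamma> (inst 0 (\<alpha>' @ g @ f)) (id_ctx \<Delta>)"
    proof -
      have "seq \<Gamma> (inst 0 (g' @ f')) (\<lambda>i. inst 0 (\<alpha>' @ g @ f) (i + length (Id_ctx_gen \<Delta>))) (\<Delta> @ \<Delta>)"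
        by (rule seq_congI[OF seq_sym[OF \<kappa>]]) (auto simp: inst_def nth_append l n_def[symmetric])
      from seq_replace[OF h[unfolded id_ctx_def] this] show ?thesis
        unfolding id_ctx_def by (rule seq_congI) (auto simp: inst_def nth_append l n_def[symmetric])
    qed
    have r': "hom \<Gamma> (inst 0 (\<alpha>' @ g @ f)) (id_ctx \<Delta>)"
      if h: "hom \<Gamma> (inst 0 (\<alpha>' @ g' @ f')) (id_ctx \<Delta>)"
    proof -
      have "seq \<Gamma> (inst 0 (g @ f)) (\<lambda>i. inst 0 (\<alpha>' @ g' @ f') (i + length (Id_ctx_gen \<Delta>))) (\<Delta> @ \<Delta>)"
        by (rule seq_congI[OF \<kappa>]) (auto simp: inst_def nth_append l n_def[symmetric])
      from seq_left[OF seq_replace[OF h[unfolded id_ctx_def] this]] show ?thesis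
        unfolding id_ctx_def by (rule seq_congI) (auto simp: inst_def nth_append l n_def[symmetric])
    qed
    have lam: "(\<lambda>i. subst (inst 0 \<beta>) (lift n (inst 0 (g @ f)) i)) = inst 0 (\<beta> @ g @ f)" if "length \<beta> = n" for \<beta>
      using that by (auto simp: fun_eq_iff lift_def inst_def subst_wk nth_append)
    have "eq_elem S \<Gamma> \<alpha> \<alpha>' (Id_ctx \<Delta> f g) \<longleftrightarrow> seq \<Gamma> (inst 0 \<alpha>) (inst 0 \<alpha>') (Id_ctx \<Delta> f g @ \<Gamma>)"
      using eq_elem_iff[OF c] l by (simp add: Id_ctx_def n_def)
    \<comment> \<open>\<open>Id_ctx \<Delta> f g @ \<Gamma>\<close> is the pullback of
      \<open>id_ctx \<Delta>\<close> along the pair of ends, so its sections are the morphisms into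
      \<open>id_ctx \<Delta>\<close> over that pair.\<close>
    also have "\<dots> \<longleftrightarrow> seq \<Gamma> (inst 0 (\<alpha> @ g @ f)) (inst 0 (\<alpha>' @ g @ f)) (id_ctx \<Delta>)"
    proof
      assume "seq \<Gamma> (inst 0 \<alpha>) (inst 0 \<alpha>') (Id_ctx \<Delta> f g @ \<Gamma>)"
      from seq_comp[OF this[unfolded Id_ctx_def] seq_lift[OF seq_left[OF \<kappa>] ci]]
      show "seq \<Gamma> (inst 0 (\<alpha> @ g @ f)) (inst 0 (\<alpha>' @ g @ f)) (id_ctx \<Delta>)"
        using lam l by (simp add: n_def id_ctx_def)
    next
      assume q: "seq \<Gamma> (inst 0 (\<alpha> @ g @ f)) (inst 0 (\<alpha>' @ g @ f)) (id_ctx \<Delta>)"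
      show "seq \<Gamma> (inst 0 \<alpha>) (inst 0 \<alpha>') (Id_ctx \<Delta> f g @ \<Gamma>)"
        unfolding Id_ctx_def
      proof (rule seq_pullback[OF seq_left[OF \<kappa>] ci])
        have "(\<lambda>i. inst 0 \<beta> (i + length (Id_ctx_gen \<Delta>))) = Var" if "length \<beta> = n" for \<beta> :: "'a expr list"
          using that by (auto simp: fun_eq_iff inst_def n_def)
        then show "seq \<Gamma> (\<lambda>i. inst 0 \<alpha> (i + length (Id_ctx_gen \<Delta>))) (\<lambda>i. inst 0 \<alpha>' (i + length (Id_ctx_gen \<Delta>))) \<Gamma>"
          using hom_id[OF \<Gamma>] l by simp
        show "seq \<Gamma> (\<lambda>i. if i < length (Id_ctx_gen \<Delta>) then inst 0 \<alpha> i
              else subst (\<lambda>i. inst 0 \<alpha> (i + length (Id_ctx_gen \<Delta>))) (inst 0 (g @ f) (i - length (Id_ctx_gen \<Delta>))))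
          (\<lambda>i. if i < length (Id_ctx_gen \<Delta>) then inst 0 \<alpha>' i
              else subst (\<lambda>i. inst 0 \<alpha>' (i + length (Id_ctx_gen \<Delta>))) (inst 0 (g @ f) (i - length (Id_ctx_gen \<Delta>))))
          (Id_ctx_gen \<Delta> @ \<Delta> @ \<Delta>)"
        proof -
          have "(if i < length (Id_ctx_gen \<Delta>) then inst 0 \<beta> i
              else subst (\<lambda>i. inst 0 \<beta> (i + length (Id_ctx_gen \<Delta>))) (inst 0 (g @ f) (i - length (Id_ctx_gen \<Delta>))))
            = inst 0 (\<beta> @ g @ f) i" if "length \<beta> = n" for \<beta> i
          proof -
            have "(\<lambda>i. inst 0 \<beta> (i + n)) = Var" using that by (auto simp: fun_eq_iff inst_def)
            then show ?thesis using that l by (auto simp: inst_def[of 0 "\<beta> @ g @ f"] inst_def[of 0 \<beta>] inst_def[of 0 "g @ f"] nth_append n_def[symmetric])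
          qed
          then show ?thesis using q l by (simp only: id_ctx_def)
        qed
      qed
    qed
    also have "\<dots> \<longleftrightarrow> ?Q"
    proof
      assume q: "seq \<Gamma> (inst 0 (\<alpha> @ g @ f)) (inst 0 (\<alpha>' @ g @ f)) (id_ctx \<Delta>)"
      show ?Q using seq_trans[OF q seq_sym[OF r[OF seq_right[OF q]]]] .
    next
      assume q: ?Q
      show "seq \<Gamma> (inst 0 (\<alpha> @ g @ f)) (inst 0 (\<alpha>' @ g @ f)) (id_ctx \<Delta>)"
        using seq_trans[OF q r[OF r'[OF seq_right[OF q]]]] .
    qed
    finally show ?thesis .
  qed
  show ?thesis
  proof
    assume p: ?P
    then have L: ?L using eq_elem_length[of \<Gamma> f f' \<Delta>] eq_elem_length[of \<Gamma> g g' \<Delta>] eq_elem_length[of \<Gamma> \<alpha> \<alpha>' "Id_ctx \<Delta> f g"]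
      by (auto simp: Id_ctx_def)
    moreover have "seq \<Gamma> (inst 0 f) (inst 0 f') \<Delta>" "seq \<Gamma> (inst 0 g) (inst 0 g') \<Delta>"
      using p eq_elem_closed[OF \<Gamma> \<Delta>] by blast+
    ultimately show "?L \<and> ?Q" using main p by blast
  next
    assume q: "?L \<and> ?Q"
    then have s: "seq \<Gamma> (inst 0 f) (inst 0 f') \<Delta>" "seq \<Gamma> (inst 0 g) (inst 0 g') \<Delta>"
      using e seq_src seq_tgt by blast+
    then have "eq_elem S \<Gamma> f f' \<Delta>" "eq_elem S \<Gamma> g g' \<Delta>"
      using q eq_elem_closed[OF \<Gamma> \<Delta>] by auto
    then show ?P using main[OF _ s] q by blast
  qed
qed


lemma seq_ctx_id_ctx: "seq \<Gamma> c c' (id_ctx \<Delta>) \<Longrightarrow> is_ctx S \<Gamma> \<and> is_ctx S \<Delta>"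
  using seq_ctx[OF seq_src] by blast

lemma inst_tup:
  "i < 3 * length \<Delta> \<Longrightarrow> inst 0 (map c [0..<length \<Delta>] @ map (tgt \<Delta> c) [0..<length \<Delta>] @ map (src \<Delta> c) [0..<length \<Delta>]) i = c i"
  by (auto simp: inst_def nth_append src_def tgt_def intro!: arg_cong[where f = c])

lemma tup_cell:
  assumes "length f = length \<Delta>" "length g = length \<Delta>" "length \<alpha> = length \<Delta>"
  shows "(\<Gamma>, \<Delta>, f, g, \<alpha>) = tup \<Gamma> \<Delta> (inst 0 (\<alpha> @ g @ f))"
  using assms by (auto simp: tup_def inst_def src_def tgt_def nth_append intro!: nth_equalityI)

lemma cell_rel_tup:
  assumes c: "hom \<Gamma> c (id_ctx \<Delta>)"
  shows "cell_rel S `` {tup \<Gamma> \<Delta> c} = mkcell \<Gamma> \<Delta> c"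
proof (intro set_eqI iffI)
  have ctx: "is_ctx S \<Gamma>" "is_ctx S \<Delta>" using seq_ctx_id_ctx[OF c] by auto
  let ?t = "map c [0..<length \<Delta>] @ map (tgt \<Delta> c) [0..<length \<Delta>] @ map (src \<Delta> c) [0..<length \<Delta>]"
  fix x
  {
    assume "x \<in> cell_rel S `` {tup \<Gamma> \<Delta> c}"
    then obtain \<Gamma>' \<Delta>' f g \<alpha> where x: "x = (\<Gamma>', \<Delta>', f, g, \<alpha>)" and e: "eq_tele S [] \<Gamma> \<Gamma>'" "eq_tele S [] \<Delta> \<Delta>'"
      and "eq_elem S \<Gamma> (map (src \<Delta> c) [0..<length \<Delta>]) f \<Delta> \<and> eq_elem S \<Gamma> (map (tgt \<Delta> c) [0..<length \<Delta>]) g \<Delta> \<and>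
        eq_elem S \<Gamma> (map c [0..<length \<Delta>]) \<alpha> (Id_ctx \<Delta> (map (src \<Delta> c) [0..<length \<Delta>]) (map (tgt \<Delta> c) [0..<length \<Delta>]))"
      by (auto simp: cell_rel_def tup_def)
    then have l: "length f = length \<Delta>" "length g = length \<Delta>" "length \<alpha> = length \<Delta>"
      and s: "seq \<Gamma> (inst 0 ?t) (inst 0 (\<alpha> @ g @ f)) (id_ctx \<Delta>)"
      unfolding eq_elem_cell[OF ctx] by simp_all
    have "seq \<Gamma> c (inst 0 (\<alpha> @ g @ f)) (id_ctx \<Delta>)"
      by (rule seq_congI[OF s]) (simp_all only: length_id_ctx inst_tup)
    moreover have "x = tup \<Gamma>' \<Delta>' (inst 0 (\<alpha> @ g @ f))"
      using tup_cell[of f \<Delta>' g \<alpha>] l eq_tele_length[OF e(2)] x by simp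
    ultimately show "x \<in> mkcell \<Gamma> \<Delta> c" using e by (auto simp: mkcell_def)
  }
  {
    assume "x \<in> mkcell \<Gamma> \<Delta> c"
    then obtain \<Gamma>' \<Delta>' c' where x: "x = tup \<Gamma>' \<Delta>' c'" and e: "eq_tele S [] \<Gamma> \<Gamma>'" "eq_tele S [] \<Delta> \<Delta>'"
      and s: "seq \<Gamma> c c' (id_ctx \<Delta>)" by (auto simp: mkcell_def)
    have l: "length \<Delta>' = length \<Delta>" using eq_tele_length[OF e(2)] by simp
    have "src \<Delta>' c' = src \<Delta> c'" "tgt \<Delta>' c' = tgt \<Delta> c'" by (simp_all add: src_def[abs_def] tgt_def[abs_def] l)
    then have x': "x = (\<Gamma>', \<Delta>', map (src \<Delta> c') [0..<length \<Delta>], map (tgt \<Delta> c') [0..<length \<Delta>], map c' [0..<length \<Delta>])"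
      by (simp add: x tup_def l)
    let ?t' = "map c' [0..<length \<Delta>] @ map (tgt \<Delta> c') [0..<length \<Delta>] @ map (src \<Delta> c') [0..<length \<Delta>]"
    have "seq \<Gamma> (inst 0 ?t) (inst 0 ?t') (id_ctx \<Delta>)"
      by (rule seq_congI[OF s]) (simp_all only: length_id_ctx inst_tup)
    then show "x \<in> cell_rel S `` {tup \<Gamma> \<Delta> c}"
      using e eq_elem_cell[OF ctx] by (auto simp: cell_rel_def tup_def x')
  }
qed

lemma two_cells_iff: "X \<in> two_cells S \<longleftrightarrow> (\<exists>\<Gamma> \<Delta> c. hom \<Gamma> c (id_ctx \<Delta>) \<and> X = mkcell \<Gamma> \<Delta> c)"
proof
  assume "X \<in> two_cells S"
  then obtain \<Gamma> \<Delta> f g \<alpha> where X: "X = cell_rel S `` {(\<Gamma>, \<Delta>, f, g, \<alpha>)}" and ctx: "is_ctx S \<Gamma>" "is_ctx S \<Delta>"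
    and "eq_elem S \<Gamma> f f \<Delta> \<and> eq_elem S \<Gamma> g g \<Delta> \<and> eq_elem S \<Gamma> \<alpha> \<alpha> (Id_ctx \<Delta> f g)"
    by (auto simp: two_cells_def quotient_def elem_iff)
  then have l: "length f = length \<Delta>" "length g = length \<Delta>" "length \<alpha> = length \<Delta>"
    and s: "hom \<Gamma> (inst 0 (\<alpha> @ g @ f)) (id_ctx \<Delta>)"
    unfolding eq_elem_cell[OF ctx] by simp_all
  have "X = mkcell \<Gamma> \<Delta> (inst 0 (\<alpha> @ g @ f))"
    using cell_rel_tup[OF s] tup_cell[OF l] X by simp
  with s show "\<exists>\<Gamma> \<Delta> c. hom \<Gamma> c (id_ctx \<Delta>) \<and> X = mkcell \<Gamma> \<Delta> c" by blast
next
  assume "\<exists>\<Gamma> \<Delta> c. hom \<Gamma> c (id_ctx \<Delta>) \<and> X = mkcell \<Gamma> \<Delta> c"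
  then obtain \<Gamma> \<Delta> c where c: "hom \<Gamma> c (id_ctx \<Delta>)" and X: "X = mkcell \<Gamma> \<Delta> c" by blast
  have ctx: "is_ctx S \<Gamma>" "is_ctx S \<Delta>" using seq_ctx_id_ctx[OF c] by auto
  have "hom \<Gamma> (inst 0 (map c [0..<length \<Delta>] @ map (tgt \<Delta> c) [0..<length \<Delta>] @ map (src \<Delta> c) [0..<length \<Delta>])) (id_ctx \<Delta>)"
    by (rule seq_congI[OF c]) (simp_all only: length_id_ctx inst_tup)
  then have "tup \<Gamma> \<Delta> c \<in> {(\<Gamma>, \<Delta>, f, g, \<alpha>). is_ctx S \<Gamma> \<and> is_ctx S \<Delta> \<and>
    elem S \<Gamma> f \<Delta> \<and> elem S \<Gamma> g \<Delta> \<and> elem S \<Gamma> \<alpha> (Id_ctx \<Delta> f g)}"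
    using ctx eq_elem_cell[OF ctx] by (simp add: tup_def elem_iff)
  then show "X \<in> two_cells S"
    unfolding X cell_rel_tup[OF c, symmetric] two_cells_def by (rule quotientI)
qed

text \<open>Exchanging \<open>\<Delta>\<close> for a definitionally equal context replaces the
  target of the morphism by another identity context; \<open>id_ctx_cong\<close> equates the
  two.\<close>

lemma mkcell_cong:
  assumes e: "eq_tele S [] \<Gamma> \<Gamma>'" "eq_tele S [] \<Delta> \<Delta>'" and f: "seq \<Gamma> f f' (id_ctx \<Delta>)"
  shows "mkcell \<Gamma> \<Delta> f = mkcell \<Gamma>' \<Delta>' f'"
proof -
  have 1: "mkcell \<Gamma>' \<Delta>' f' \<subseteq> mkcell \<Gamma> \<Delta> f"
    if e: "eq_tele S [] \<Gamma> \<Gamma>'" "eq_tele S [] \<Delta> \<Delta>'" and f: "seq \<Gamma> f f' (id_ctx \<Delta>)" for \<Gamma> \<Gamma>' \<Delta> \<Delta>' f f'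
  proof -
    have "seq \<Gamma> f g (id_ctx \<Delta>)" if "seq \<Gamma>' f' g (id_ctx \<Delta>')" for g
      using seq_trans[OF f seq_conv_source[OF eq_ctx_sym[OF e(1)] seq_conv_target[OF eq_ctx_sym[OF id_ctx_cong[OF e(2)]] that]]] .
    then show ?thesis using eq_ctx_trans[OF e(1)] eq_ctx_trans[OF e(2)] unfolding mkcell_def by blast
  qed
  show ?thesis
    using 1[OF e f] 1[OF eq_ctx_sym[OF e(1)] eq_ctx_sym[OF e(2)]
      seq_conv_source[OF e(1) seq_conv_target[OF id_ctx_cong[OF e(2)] seq_sym[OF f]]]]
    by blast
qed

lemma mkcell_eq:
  assumes f: "hom \<Gamma> f (id_ctx \<Delta>)" and eq: "mkcell \<Gamma> \<Delta> f' = mkcell \<Gamma> \<Delta> f"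
  shows "seq \<Gamma> f' f (id_ctx \<Delta>)"
proof -
  have "tup \<Gamma> \<Delta> f \<in> mkcell \<Gamma> \<Delta> f"
    unfolding mkcell_def using f eq_ctx_refl seq_ctx_id_ctx[OF f] by blast
  then obtain g where g: "seq \<Gamma> f' g (id_ctx \<Delta>)" "tup \<Gamma> \<Delta> f = tup \<Gamma> \<Delta> g"
    unfolding eq[symmetric] by (auto simp: mkcell_def tup_def)
  have "f i = g i" if i: "i < 3 * length \<Delta>" for i
    using inst_tup[OF i, of f] inst_tup[OF i, of g] g(2) by (simp add: tup_def del: map_eq_conv)
  then show ?thesis by (intro seq_congI[OF g(1)]) simp_all
qed

text \<open>A representative of the source class need not be the source stored in \<open>c\<close>.
  Writing it into the cell in place of the stored one gives a definitionally equal cell that has it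
  literally as source.\<close>

lemma cell_src:
  assumes c: "hom \<Gamma> c (id_ctx \<Delta>)"
  shows "cell_src (mkcell \<Gamma> \<Delta> c) = mkmor \<Gamma> (src \<Delta> c) \<Delta>"
proof (intro set_eqI iffI)
  fix x
  {
    assume "x \<in> cell_src (mkcell \<Gamma> \<Delta> c)"
    then obtain \<Gamma>' \<Delta>' c' where "x = (\<Gamma>', map (src \<Delta>' c') [0..<length \<Delta>'], \<Delta>')" and e: "eq_tele S [] \<Gamma> \<Gamma>'" "eq_tele S [] \<Delta> \<Delta>'"
      and s: "seq \<Gamma> c c' (id_ctx \<Delta>)" by (auto simp: cell_src_def mkcell_def tup_def)
    moreover have "src \<Delta>' c' = src \<Delta> c'" using eq_tele_length[OF e(2)] by (simp add: src_def[abs_def])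
    ultimately show "x \<in> mkmor \<Gamma> (src \<Delta> c) \<Delta>" using seq_src[OF s] by (auto simp: mkmor_def)
  }
  {
    assume "x \<in> mkmor \<Gamma> (src \<Delta> c) \<Delta>"
    then obtain \<Gamma>' \<Delta>' f' where x: "x = (\<Gamma>', map f' [0..<length \<Delta>'], \<Delta>')" and e: "eq_tele S [] \<Gamma> \<Gamma>'" "eq_tele S [] \<Delta> \<Delta>'"
      and s: "seq \<Gamma> (src \<Delta> c) f' \<Delta>" by (auto simp: mkmor_def)
    have l: "length \<Delta>' = length \<Delta>" using eq_tele_length[OF e(2)] by simp
    let ?c = "\<lambda>i. if i < 2 * length \<Delta> then c i else f' (i - 2 * length \<Delta>)"
    have "seq \<Gamma> f' (\<lambda>i. c (i + length (Id_ctx_gen \<Delta> @ \<Delta>))) \<Delta>"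
      using seq_sym[OF s] by (simp add: src_def[abs_def] mult_2)
    from seq_replace[OF _ this] have "seq \<Gamma> ?c c (id_ctx \<Delta>)"
      using c by (simp add: id_ctx_def mult_2 cong: if_cong)
    note seq_sym[OF this]
    moreover have "x = (\<Gamma>', map (src \<Delta>' ?c) [0..<length \<Delta>'], \<Delta>')" by (simp add: x src_def l)
    ultimately show "x \<in> cell_src (mkcell \<Gamma> \<Delta> c)"
      using e unfolding cell_src_def mkcell_def tup_def by blast
  }
qed

text \<open>The exchanged end now lies between the identity proof and the source, so the pair of
  ends is replaced as one block.\<close>

lemma cell_tgt:
  assumes c: "hom \<Gamma> c (id_ctx \<Delta>)"
  shows "cell_tgt (mkcell \<Gamma> \<Delta> c) = mkmor \<Gamma> (tgt \<Delta> c) \<Delta>"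
proof (intro set_eqI iffI)
  fix x
  {
    assume "x \<in> cell_tgt (mkcell \<Gamma> \<Delta> c)"
    then obtain \<Gamma>' \<Delta>' c' where "x = (\<Gamma>', map (tgt \<Delta>' c') [0..<length \<Delta>'], \<Delta>')" and e: "eq_tele S [] \<Gamma> \<Gamma>'" "eq_tele S [] \<Delta> \<Delta>'"
      and s: "seq \<Gamma> c c' (id_ctx \<Delta>)" by (auto simp: cell_tgt_def mkcell_def tup_def)
    moreover have "tgt \<Delta>' c' = tgt \<Delta> c'" using eq_tele_length[OF e(2)] by (simp add: tgt_def[abs_def])
    ultimately show "x \<in> mkmor \<Gamma> (tgt \<Delta> c) \<Delta>" using seq_tgt[OF s] by (auto simp: mkmor_def)
  }
  {
    assume "x \<in> mkmor \<Gamma> (tgt \<Delta> c) \<Delta>"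
    then obtain \<Gamma>' \<Delta>' f' where x: "x = (\<Gamma>', map f' [0..<length \<Delta>'], \<Delta>')" and e: "eq_tele S [] \<Gamma> \<Gamma>'" "eq_tele S [] \<Delta> \<Delta>'"
      and s: "seq \<Gamma> (tgt \<Delta> c) f' \<Delta>" by (auto simp: mkmor_def)
    have l: "length \<Delta>' = length \<Delta>" using eq_tele_length[OF e(2)] by simp
    let ?t = "\<lambda>i. if i < length \<Delta> then f' i else c (i + length \<Delta>)"
    let ?c = "\<lambda>i. if i < length (Id_ctx_gen \<Delta>) then c i else ?t (i - length (Id_ctx_gen \<Delta>))"
    have t: "seq \<Gamma> ?t (\<lambda>i. c (i + length (Id_ctx_gen \<Delta>))) (\<Delta> @ \<Delta>)"
      by (rule seq_closed_append; rule seq_congI, rule seq_sym[OF s] seq_src[OF c])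
        (simp_all add: tgt_def src_def mult_2 add.assoc)
    have "seq \<Gamma> c ?c (id_ctx \<Delta>)"
      unfolding id_ctx_def by (rule seq_sym[OF seq_replace[OF c[unfolded id_ctx_def] t]])
    moreover have "x = (\<Gamma>', map (tgt \<Delta>' ?c) [0..<length \<Delta>'], \<Delta>')" by (simp add: x tgt_def l)
    ultimately show "x \<in> cell_tgt (mkcell \<Gamma> \<Delta> c)"
      using e unfolding cell_tgt_def mkcell_def tup_def by blast
  }
qed

text \<open>The operations on classes are computed at chosen representatives of the classes of contexts.\<close>

definition rep :: "'a ctx set \<Rightarrow> 'a ctx" where
  "rep X = (SOME \<Gamma>. is_ctx S \<Gamma> \<and> X = mkob \<Gamma>)"

definition canon :: "'a ctx \<Rightarrow> bool" where
  "canon \<Gamma> \<longleftrightarrow> is_ctx S \<Gamma> \<and> rep (mkob \<Gamma>) = \<Gamma>"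

definition mor_at :: "'a ctx \<Rightarrow> 'a ctx \<Rightarrow> 'a ctx_mor set \<Rightarrow> nat \<Rightarrow> 'a expr" where
  "mor_at \<Gamma> \<Delta> F = (SOME f. hom \<Gamma> f \<Delta> \<and> F = mkmor \<Gamma> f \<Delta>)"

definition cell_at :: "'a ctx \<Rightarrow> 'a ctx \<Rightarrow> 'a ctx_cell set \<Rightarrow> nat \<Rightarrow> 'a expr" where
  "cell_at \<Gamma> \<Delta> X = (SOME c. hom \<Gamma> c (id_ctx \<Delta>) \<and> X = mkcell \<Gamma> \<Delta> c)"

definition cell_dom :: "'a ctx_cell set \<Rightarrow> 'a ctx" where
  "cell_dom X = rep (arr_dom (cell_src X))"

definition cell_cod :: "'a ctx_cell set \<Rightarrow> 'a ctx" where
  "cell_cod X = rep (arr_cod (cell_src X))"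

definition vide :: "'a ctx_mor set \<Rightarrow> 'a ctx_cell set" where
  "vide F = (let \<Gamma> = rep (arr_dom F); \<Delta> = rep (arr_cod F) in mkcell \<Gamma> \<Delta> (idc \<Delta> (mor_at \<Gamma> \<Delta> F)))"

definition vcmp :: "'a ctx_cell set \<Rightarrow> 'a ctx_cell set \<Rightarrow> 'a ctx_cell set" where
  "vcmp Y X = (let \<Gamma> = cell_dom X; \<Delta> = cell_cod X in mkcell \<Gamma> \<Delta> (vc \<Delta> (cell_at \<Gamma> \<Delta> X) (cell_at \<Gamma> \<Delta> Y)))"

definition hcmp :: "'a ctx_cell set \<Rightarrow> 'a ctx_cell set \<Rightarrow> 'a ctx_cell set" where
  "hcmp Y X = (let \<Gamma> = cell_dom X; \<Delta> = cell_cod X; \<Theta> = cell_cod Y in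
    mkcell \<Gamma> \<Theta> (hc \<Delta> \<Theta> (cell_at \<Gamma> \<Delta> X) (cell_at \<Delta> \<Theta> Y)))"

lemma canon_ctx: "canon \<Gamma> \<Longrightarrow> is_ctx S \<Gamma>"
  by (simp add: canon_def)

lemma canon_exists: "is_ctx S \<Gamma> \<Longrightarrow> \<exists>\<Gamma>'. canon \<Gamma>' \<and> eq_tele S [] \<Gamma> \<Gamma>'"
proof -
  assume \<Gamma>: "is_ctx S \<Gamma>"
  then have "is_ctx S (rep (mkob \<Gamma>)) \<and> mkob \<Gamma> = mkob (rep (mkob \<Gamma>))"
    unfolding rep_def by (intro someI[of "\<lambda>\<Gamma>'. is_ctx S \<Gamma>' \<and> mkob \<Gamma> = mkob \<Gamma>'"]) simp
  then show ?thesis using mkob_eq[OF \<Gamma>, of "rep (mkob \<Gamma>)"] by (auto simp: canon_def intro!: exI[of _ "rep (mkob \<Gamma>)"])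
qed

text \<open>Composability is an equality of classes of contexts. For canonical representatives it
  becomes literal equality, so composable cells can be written over the same middle context.\<close>

lemma canon_eq: "canon \<Gamma> \<Longrightarrow> canon \<Gamma>' \<Longrightarrow> eq_tele S [] \<Gamma> \<Gamma>' \<Longrightarrow> \<Gamma> = \<Gamma>'"
  using mkob_eq[of \<Gamma> \<Gamma>'] unfolding canon_def by metis

lemma arrow_cases:
  assumes "F \<in> arrows S"
  obtains \<Gamma> f \<Delta> where "canon \<Gamma>" "canon \<Delta>" "hom \<Gamma> f \<Delta>" "F = mkmor \<Gamma> f \<Delta>"
proof -
  obtain \<Gamma> f \<Delta> where f: "hom \<Gamma> f \<Delta>" "F = mkmor \<Gamma> f \<Delta>" using assms unfolding arrows_iff by blast
  obtain \<Gamma>' \<Delta>' where e: "canon \<Gamma>'" "eq_tele S [] \<Gamma> \<Gamma>'" "canon \<Delta>'" "eq_tele S [] \<Delta> \<Delta>'"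
    using canon_exists seq_ctx[OF f(1)] by blast
  show ?thesis
    using that[OF e(1,3) seq_conv_source[OF e(2) seq_conv_target[OF e(4) f(1)]]] mkmor_cong[OF e(2,4) f(1)] f(2) by simp
qed

lemma cell_cases:
  assumes "X \<in> two_cells S"
  obtains \<Gamma> \<Delta> c where "canon \<Gamma>" "canon \<Delta>" "hom \<Gamma> c (id_ctx \<Delta>)" "X = mkcell \<Gamma> \<Delta> c"
proof -
  obtain \<Gamma> c \<Delta> where c: "hom \<Gamma> c (id_ctx \<Delta>)" "X = mkcell \<Gamma> \<Delta> c" using assms unfolding two_cells_iff by blast
  obtain \<Gamma>' \<Delta>' where e: "canon \<Gamma>'" "eq_tele S [] \<Gamma> \<Gamma>'" "canon \<Delta>'" "eq_tele S [] \<Delta> \<Delta>'"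
    using canon_exists seq_ctx_id_ctx[OF c(1)] by blast
  show ?thesis
    using that[OF e(1,3) seq_conv_source[OF e(2) seq_conv_target[OF id_ctx_cong[OF e(4)] c(1)]]] mkcell_cong[OF e(2,4) c(1)] c(2)
    by simp
qed

lemma mor_at: "hom \<Gamma> f \<Delta> \<Longrightarrow> seq \<Gamma> f (mor_at \<Gamma> \<Delta> (mkmor \<Gamma> f \<Delta>)) \<Delta>"
proof -
  assume f: "hom \<Gamma> f \<Delta>"
  then have "hom \<Gamma> (mor_at \<Gamma> \<Delta> (mkmor \<Gamma> f \<Delta>)) \<Delta> \<and> mkmor \<Gamma> f \<Delta> = mkmor \<Gamma> (mor_at \<Gamma> \<Delta> (mkmor \<Gamma> f \<Delta>)) \<Delta>"
    unfolding mor_at_def by (intro someI[of "\<lambda>g. hom \<Gamma> g \<Delta> \<and> mkmor \<Gamma> f \<Delta> = mkmor \<Gamma> g \<Delta>"]) simp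
  then show ?thesis using mkmor_eq by blast
qed

lemma cell_at: "hom \<Gamma> c (id_ctx \<Delta>) \<Longrightarrow> seq \<Gamma> (cell_at \<Gamma> \<Delta> (mkcell \<Gamma> \<Delta> c)) c (id_ctx \<Delta>)"
proof -
  assume c: "hom \<Gamma> c (id_ctx \<Delta>)"
  then have "hom \<Gamma> (cell_at \<Gamma> \<Delta> (mkcell \<Gamma> \<Delta> c)) (id_ctx \<Delta>) \<and> mkcell \<Gamma> \<Delta> c = mkcell \<Gamma> \<Delta> (cell_at \<Gamma> \<Delta> (mkcell \<Gamma> \<Delta> c))"
    unfolding cell_at_def by (intro someI[of "\<lambda>g. hom \<Gamma> g (id_ctx \<Delta>) \<and> mkcell \<Gamma> \<Delta> c = mkcell \<Gamma> \<Delta> g"]) simp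
  then show ?thesis using mkcell_eq[OF c] by simp
qed

lemma mkcell_congI: "seq \<Gamma> c c' (id_ctx \<Delta>) \<Longrightarrow> mkcell \<Gamma> \<Delta> c = mkcell \<Gamma> \<Delta> c'"
  using mkcell_cong[OF eq_ctx_refl eq_ctx_refl] seq_ctx_id_ctx by blast

lemma mkmor_congI: "seq \<Gamma> f f' \<Delta> \<Longrightarrow> mkmor \<Gamma> f \<Delta> = mkmor \<Gamma> f' \<Delta>"
  using mkmor_cong[OF eq_ctx_refl eq_ctx_refl] seq_ctx by blast

lemma cell_dom_cod:
  assumes "canon \<Gamma>" "canon \<Delta>" "hom \<Gamma> c (id_ctx \<Delta>)"
  shows "cell_dom (mkcell \<Gamma> \<Delta> c) = \<Gamma>" "cell_cod (mkcell \<Gamma> \<Delta> c) = \<Delta>"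
  using assms by (simp_all add: cell_dom_def cell_cod_def cell_src arr_dom[OF seq_src] arr_cod[OF seq_src] canon_def)

lemma vide:
  assumes "canon \<Gamma>" "canon \<Delta>" and f: "hom \<Gamma> f \<Delta>"
  shows "vide (mkmor \<Gamma> f \<Delta>) = mkcell \<Gamma> \<Delta> (idc \<Delta> f)"
  using assms mkcell_congI[OF seq_idc[OF seq_sym[OF mor_at[OF f]]]]
  by (simp add: vide_def Let_def arr_dom[OF f] arr_cod[OF f] canon_def)

text \<open>The chosen representatives are composable as well, because their ends are definitionally
  equal to those of \<open>a\<close> and \<open>b\<close>.\<close>

lemma vcmp:
  assumes "canon \<Gamma>" "canon \<Delta>" and a: "hom \<Gamma> a (id_ctx \<Delta>)" and b: "hom \<Gamma> b (id_ctx \<Delta>)"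
    and ab: "seq \<Gamma> (tgt \<Delta> a) (src \<Delta> b) \<Delta>"
  shows "vcmp (mkcell \<Gamma> \<Delta> b) (mkcell \<Gamma> \<Delta> a) = mkcell \<Gamma> \<Delta> (vc \<Delta> a b)"
proof -
  have "seq \<Gamma> (tgt \<Delta> (cell_at \<Gamma> \<Delta> (mkcell \<Gamma> \<Delta> a))) (src \<Delta> (cell_at \<Gamma> \<Delta> (mkcell \<Gamma> \<Delta> b))) \<Delta>"
    by (rule seq_trans[OF seq_trans[OF seq_tgt[OF cell_at[OF a]] ab] seq_sym[OF seq_src[OF cell_at[OF b]]]])
  from mkcell_congI[OF seq_vc[OF cell_at[OF a] cell_at[OF b] this]] show ?thesis
    by (simp add: vcmp_def Let_def cell_dom_cod assms)
qed

lemma hcmp: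
  assumes "canon \<Gamma>" "canon \<Delta>" "canon \<Theta>" and a: "hom \<Gamma> a (id_ctx \<Delta>)" and b: "hom \<Delta> b (id_ctx \<Theta>)"
  shows "hcmp (mkcell \<Delta> \<Theta> b) (mkcell \<Gamma> \<Delta> a) = mkcell \<Gamma> \<Theta> (hc \<Delta> \<Theta> a b)"
  using mkcell_congI[OF seq_hc[OF cell_at[OF a] cell_at[OF b]]]
  by (simp add: hcmp_def Let_def cell_dom_cod assms)

lemma mkmor_canon_eq:
  assumes "canon \<Gamma>" "canon \<Delta>" "canon \<Gamma>'" "canon \<Delta>'" "hom \<Gamma> f \<Delta>" "mkmor \<Gamma>' f' \<Delta>' = mkmor \<Gamma> f \<Delta>"
  shows "\<Gamma>' = \<Gamma> \<and> \<Delta>' = \<Delta> \<and> seq \<Gamma> f' f \<Delta>"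
  using mkmor_eq[OF assms(5,6)] canon_eq[OF assms(3,1)] canon_eq[OF assms(4,2)] by auto

lemma mkob_canon_eq: "canon \<Gamma> \<Longrightarrow> canon \<Gamma>' \<Longrightarrow> mkob \<Gamma> = mkob \<Gamma>' \<Longrightarrow> \<Gamma> = \<Gamma>'"
  using mkob_eq[of \<Gamma> \<Gamma>'] canon_eq canon_ctx by blast

lemma vcomposable_cases:
  assumes "X \<in> two_cells S" "Y \<in> two_cells S" "cell_src Y = cell_tgt X"
  obtains \<Gamma> \<Delta> a b where "canon \<Gamma>" "canon \<Delta>" "hom \<Gamma> a (id_ctx \<Delta>)" "hom \<Gamma> b (id_ctx \<Delta>)"
    "X = mkcell \<Gamma> \<Delta> a" "Y = mkcell \<Gamma> \<Delta> b" "seq \<Gamma> (tgt \<Delta> a) (src \<Delta> b) \<Delta>"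
proof -
  obtain \<Gamma> \<Delta> a where a: "canon \<Gamma>" "canon \<Delta>" "hom \<Gamma> a (id_ctx \<Delta>)" "X = mkcell \<Gamma> \<Delta> a" using cell_cases[OF assms(1)] .
  obtain \<Gamma>' \<Delta>' b where b: "canon \<Gamma>'" "canon \<Delta>'" "hom \<Gamma>' b (id_ctx \<Delta>')" "Y = mkcell \<Gamma>' \<Delta>' b" using cell_cases[OF assms(2)] .
  have "\<Gamma>' = \<Gamma> \<and> \<Delta>' = \<Delta> \<and> seq \<Gamma> (src \<Delta>' b) (tgt \<Delta> a) \<Delta>"
    using assms(3) by (intro mkmor_canon_eq[OF a(1,2) b(1,2) seq_tgt[OF a(3)]]) (simp add: a(4) b(4) cell_src[OF b(3)] cell_tgt[OF a(3)])
  then show ?thesis using that[OF a(1,2,3) _ a(4), of b] b seq_sym by auto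
qed

lemma hcomposable_cases:
  assumes "X \<in> two_cells S" "Y \<in> two_cells S" "arr_dom (cell_src Y) = arr_cod (cell_src X)"
  obtains \<Gamma> \<Delta> \<Theta> a b where "canon \<Gamma>" "canon \<Delta>" "canon \<Theta>" "hom \<Gamma> a (id_ctx \<Delta>)" "hom \<Delta> b (id_ctx \<Theta>)"
    "X = mkcell \<Gamma> \<Delta> a" "Y = mkcell \<Delta> \<Theta> b"
proof -
  obtain \<Gamma> \<Delta> a where a: "canon \<Gamma>" "canon \<Delta>" "hom \<Gamma> a (id_ctx \<Delta>)" "X = mkcell \<Gamma> \<Delta> a" using cell_cases[OF assms(1)] .
  obtain \<Delta>' \<Theta> b where b: "canon \<Delta>'" "canon \<Theta>" "hom \<Delta>' b (id_ctx \<Theta>)" "Y = mkcell \<Delta>' \<Theta> b" using cell_cases[OF assms(2)] .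
  have "\<Delta> = \<Delta>'"
    using assms(3) by (intro mkob_canon_eq[OF a(2) b(1)])
      (simp add: a(4) b(4) cell_src[OF a(3)] cell_src[OF b(3)] arr_dom[OF seq_src[OF b(3)]] arr_cod[OF seq_src[OF a(3)]])
  then show ?thesis using that[OF a(1,2) b(2) a(3)] a b by auto
qed

lemma composable_cases:
  assumes "F \<in> arrows S" "G \<in> arrows S" "arr_dom G = arr_cod F"
  obtains \<Gamma> \<Delta> \<Theta> f g where "canon \<Gamma>" "canon \<Delta>" "canon \<Theta>" "hom \<Gamma> f \<Delta>" "hom \<Delta> g \<Theta>"
    "F = mkmor \<Gamma> f \<Delta>" "G = mkmor \<Delta> g \<Theta>"
proof -
  obtain \<Gamma> f \<Delta> where a: "canon \<Gamma>" "canon \<Delta>" "hom \<Gamma> f \<Delta>" "F = mkmor \<Gamma> f \<Delta>" using arrow_cases[OF assms(1)] .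
  obtain \<Delta>' g \<Theta> where b: "canon \<Delta>'" "canon \<Theta>" "hom \<Delta>' g \<Theta>" "G = mkmor \<Delta>' g \<Theta>" using arrow_cases[OF assms(2)] .
  have "\<Delta> = \<Delta>'"
    using assms(3) by (intro mkob_canon_eq[OF a(2) b(1)]) (simp add: a(4) b(4) arr_dom[OF b(3)] arr_cod[OF a(3)])
  then show ?thesis using that[OF a(1,2) b(2) a(3)] a b by auto
qed


section \<open>The laws of the 2-category of contexts\<close>

lemma mkcell_two_cells: "hom \<Gamma> c (id_ctx \<Delta>) \<Longrightarrow> mkcell \<Gamma> \<Delta> c \<in> two_cells S"
  and mkmor_arrows: "hom \<Gamma> f \<Delta> \<Longrightarrow> mkmor \<Gamma> f \<Delta> \<in> arrows S"
  and mkob_objects: "is_ctx S \<Gamma> \<Longrightarrow> mkob \<Gamma> \<in> objects S"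
  unfolding two_cells_iff arrows_iff objects_iff by blast+

lemma contexts_category: "category (objects S) (arrows S) arr_dom arr_cod (arr_id S) (arr_comp S)"
proof unfold_locales
  show "arr_dom F \<in> objects S" if asm: "F \<in> arrows S" for F
    using asm by (rule arrow_cases) (simp add: arr_dom mkob_objects canon_ctx)
  show "arr_cod F \<in> objects S" if asm: "F \<in> arrows S" for F
    using asm by (rule arrow_cases) (simp add: arr_cod mkob_objects canon_ctx)
  show "arr_id S X \<in> arrows S \<and> arr_dom (arr_id S X) = X \<and> arr_cod (arr_id S X) = X" if asm: "X \<in> objects S" for X
  proof -
    obtain \<Gamma> where \<Gamma>: "is_ctx S \<Gamma>" "X = mkob \<Gamma>" using asm unfolding objects_iff by blast
    show ?thesis using hom_id[OF \<Gamma>(1)] by (simp add: \<Gamma>(2) arr_id[OF \<Gamma>(1)] mkmor_arrows arr_dom arr_cod)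
  qed
  show "arr_comp S G F \<in> arrows S \<and> arr_dom (arr_comp S G F) = arr_dom F \<and> arr_cod (arr_comp S G F) = arr_cod G"
    if asm: "F \<in> arrows S" "G \<in> arrows S" "arr_dom G = arr_cod F" for F G
  proof -
    obtain \<Gamma> \<Delta> \<Theta> f g where "canon \<Gamma>" "canon \<Delta>" "canon \<Theta>"
      and h: "hom \<Gamma> f \<Delta>" "hom \<Delta> g \<Theta>" "F = mkmor \<Gamma> f \<Delta>" "G = mkmor \<Delta> g \<Theta>"
      using composable_cases[OF asm] .
    show ?thesis
      using seq_comp[OF h(1,2)] by (simp add: h(3,4) arr_comp[OF h(1,2)] mkmor_arrows arr_dom[OF h(1)] arr_cod[OF h(2)] arr_dom arr_cod)
  qed
  show "arr_comp S F (arr_id S (arr_dom F)) = F" "arr_comp S (arr_id S (arr_cod F)) F = F" if asm: "F \<in> arrows S" for F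
  proof -
    obtain \<Gamma> f \<Delta> where f: "canon \<Gamma>" "canon \<Delta>" "hom \<Gamma> f \<Delta>" "F = mkmor \<Gamma> f \<Delta>" using arrow_cases[OF asm] .
    note i = hom_id[OF canon_ctx[OF f(1)]] hom_id[OF canon_ctx[OF f(2)]]
    show "arr_comp S F (arr_id S (arr_dom F)) = F" "arr_comp S (arr_id S (arr_cod F)) F = F"
      using arr_comp[OF i(1) f(3)] arr_comp[OF f(3) i(2)]
      by (simp_all add: f(4) arr_dom[OF f(3)] arr_cod[OF f(3)] arr_id canon_ctx f(1,2))
  qed
  show "arr_comp S H (arr_comp S G F) = arr_comp S (arr_comp S H G) F"
    if asm: "F \<in> arrows S" "G \<in> arrows S" "H \<in> arrows S" "arr_dom G = arr_cod F" "arr_dom H = arr_cod G" for F G H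
  proof -
    obtain \<Gamma> \<Delta> \<Theta> f g where "canon \<Gamma>" and h: "canon \<Delta>" "canon \<Theta>" "hom \<Gamma> f \<Delta>" "hom \<Delta> g \<Theta>"
      "F = mkmor \<Gamma> f \<Delta>" "G = mkmor \<Delta> g \<Theta>"
      using composable_cases[OF asm(1,2,4)] .
    obtain \<Theta>' k \<Psi> where k: "canon \<Theta>'" and "canon \<Psi>" and k': "hom \<Theta>' k \<Psi>" "H = mkmor \<Theta>' k \<Psi>"
      using arrow_cases[OF asm(3)] .
    have "\<Theta>' = \<Theta>"
      using asm(5) by (intro mkob_canon_eq[OF k h(2)]) (simp add: k'(2) h(6) arr_dom[OF k'(1)] arr_cod[OF h(4)])
    note k = k'[unfolded this]
    show ?thesis
      by (simp add: h(5,6) k(2) arr_comp[OF h(3,4)] arr_comp[OF h(4) k(1)]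
        arr_comp[OF seq_comp[OF h(3,4)] k(1)] arr_comp[OF h(3) seq_comp[OF h(4) k(1)]])
  qed
qed

lemma cells_category: "category (arrows S) (two_cells S) cell_src cell_tgt vide vcmp"
proof unfold_locales
  show "cell_src X \<in> arrows S" "cell_tgt X \<in> arrows S" if asm: "X \<in> two_cells S" for X
  proof -
    obtain \<Gamma> \<Delta> a where a: "hom \<Gamma> a (id_ctx \<Delta>)" "X = mkcell \<Gamma> \<Delta> a" using asm unfolding two_cells_iff by blast
    show "cell_src X \<in> arrows S" "cell_tgt X \<in> arrows S"
      using seq_src[OF a(1)] seq_tgt[OF a(1)] by (simp_all add: a(2) cell_src[OF a(1)] cell_tgt[OF a(1)] mkmor_arrows)
  qed
  show "vide F \<in> two_cells S \<and> cell_src (vide F) = F \<and> cell_tgt (vide F) = F" if asm: "F \<in> arrows S" for F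
  proof -
    obtain \<Gamma> f \<Delta> where f: "canon \<Gamma>" "canon \<Delta>" "hom \<Gamma> f \<Delta>" "F = mkmor \<Gamma> f \<Delta>" using arrow_cases[OF asm] .
    note i = seq_idc[OF f(3)]
    show ?thesis
      by (simp add: f(4) vide[OF f(1-3)] mkcell_two_cells[OF i] cell_src[OF i] cell_tgt[OF i] src_idc
        mkmor_congI[OF seq_tgt_idc[OF f(3)]])
  qed
  show "vcmp Y X \<in> two_cells S \<and> cell_src (vcmp Y X) = cell_src X \<and> cell_tgt (vcmp Y X) = cell_tgt Y"
    if XY: "X \<in> two_cells S" "Y \<in> two_cells S" "cell_src Y = cell_tgt X" for X Y
    using XY
  proof (rule vcomposable_cases)
    fix \<Gamma> \<Delta> a b assume h: "canon \<Gamma>" "canon \<Delta>" "hom \<Gamma> a (id_ctx \<Delta>)" "hom \<Gamma> b (id_ctx \<Delta>)"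
      "X = mkcell \<Gamma> \<Delta> a" "Y = mkcell \<Gamma> \<Delta> b" "seq \<Gamma> (tgt \<Delta> a) (src \<Delta> b) \<Delta>"
    note v = seq_vc[OF h(3,4,7)]
    show ?thesis
      by (simp add: h(5,6) vcmp[OF h(1-4,7)] mkcell_two_cells[OF v] cell_src[OF v] cell_tgt[OF v] cell_src[OF h(3)]
        cell_tgt[OF h(4)] src_vc[OF canon_ctx[OF h(2)]] mkmor_congI[OF tgt_vc[OF h(4)]])
  qed
  show "vcmp X (vide (cell_src X)) = X" "vcmp (vide (cell_tgt X)) X = X" if asm: "X \<in> two_cells S" for X
  proof -
    obtain \<Gamma> \<Delta> a where a: "canon \<Gamma>" "canon \<Delta>" "hom \<Gamma> a (id_ctx \<Delta>)" "X = mkcell \<Gamma> \<Delta> a" using cell_cases[OF asm] .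
    note s = seq_src[OF a(3)] and t = seq_tgt[OF a(3)]
    have st: "seq \<Gamma> (tgt \<Delta> (idc \<Delta> (src \<Delta> a))) (src \<Delta> a) \<Delta>" "seq \<Gamma> (tgt \<Delta> a) (src \<Delta> (idc \<Delta> (tgt \<Delta> a))) \<Delta>"
      using seq_tgt_idc[OF s] t by (simp_all add: src_idc)
    show "vcmp X (vide (cell_src X)) = X" "vcmp (vide (cell_tgt X)) X = X"
      by (simp_all add: a(4) cell_src[OF a(3)] cell_tgt[OF a(3)] vide[OF a(1,2) s] vide[OF a(1,2) t]
        vcmp[OF a(1,2) seq_idc[OF s] a(3) st(1)] vcmp[OF a(1-3) seq_idc[OF t] st(2)]
        mkcell_congI[OF vc_idc_left[OF a(3) s]] mkcell_congI[OF vc_idc_right[OF a(3) t]])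
  qed
  show "vcmp Z (vcmp Y X) = vcmp (vcmp Z Y) X"
    if XYZ: "X \<in> two_cells S" "Y \<in> two_cells S" "Z \<in> two_cells S" "cell_src Y = cell_tgt X" "cell_src Z = cell_tgt Y" for X Y Z
    using XYZ(1,2,4)
  proof (rule vcomposable_cases)
    fix \<Gamma> \<Delta> a b assume h: "canon \<Gamma>" "canon \<Delta>" "hom \<Gamma> a (id_ctx \<Delta>)" "hom \<Gamma> b (id_ctx \<Delta>)"
      "X = mkcell \<Gamma> \<Delta> a" "Y = mkcell \<Gamma> \<Delta> b" "seq \<Gamma> (tgt \<Delta> a) (src \<Delta> b) \<Delta>"
    obtain \<Gamma>' \<Delta>' c where c: "canon \<Gamma>'" "canon \<Delta>'" "hom \<Gamma>' c (id_ctx \<Delta>')" "Z = mkcell \<Gamma>' \<Delta>' c" using cell_cases[OF XYZ(3)] .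
    have "\<Gamma>' = \<Gamma> \<and> \<Delta>' = \<Delta> \<and> seq \<Gamma> (src \<Delta>' c) (tgt \<Delta> b) \<Delta>"
      using XYZ(5) by (intro mkmor_canon_eq[OF h(1,2) c(1,2) seq_tgt[OF h(4)]])
        (simp add: c(4) h(6) cell_src[OF c(3)] cell_tgt[OF h(4)])
    then have c: "hom \<Gamma> c (id_ctx \<Delta>)" "Z = mkcell \<Gamma> \<Delta> c" "seq \<Gamma> (tgt \<Delta> b) (src \<Delta> c) \<Delta>"
      using c seq_sym[of \<Gamma> "src \<Delta>' c" "tgt \<Delta> b" \<Delta>] by auto
    have ab: "seq \<Gamma> (tgt \<Delta> (vc \<Delta> a b)) (src \<Delta> c) \<Delta>" by (rule seq_trans[OF tgt_vc[OF h(4)] c(3)])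
    have bc: "seq \<Gamma> (tgt \<Delta> a) (src \<Delta> (vc \<Delta> b c)) \<Delta>" using h(7) by (simp add: src_vc[OF canon_ctx[OF h(2)]])
    show ?thesis
      by (simp add: h(5,6) c(2) vcmp[OF h(1-4,7)] vcmp[OF h(1,2,4) c(1,3)] vcmp[OF h(1,2) seq_vc[OF h(3,4,7)] c(1) ab]
        vcmp[OF h(1-3) seq_vc[OF h(4) c(1,3)] bc] mkcell_congI[OF vc_assoc[OF h(3,4) c(1) h(7) c(3)]])
  qed
qed

text \<open>Over canonical contexts every operation on classes is given by its counterpart on
  functions, so each remaining law is a \<open>seq\<close> statement about \<open>vc\<close>,
  \<open>hc\<close>, \<open>idc\<close> or \<open>vinv\<close>, passed to classes by
  \<open>mkcell_congI\<close>.\<close>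

lemma contexts_two_category:
  "locally_groupoidal_two_category (objects S) (arrows S) arr_dom arr_cod (arr_id S) (arr_comp S)
    (two_cells S) cell_src cell_tgt vide vcmp hcmp"
proof (intro locally_groupoidal_two_category.intro two_category.intro contexts_category cells_category
    two_category_axioms.intro locally_groupoidal_two_category_axioms.intro)
  fix X assume X: "X \<in> two_cells S"
  obtain \<Gamma> \<Delta> a where a: "canon \<Gamma>" "canon \<Delta>" "hom \<Gamma> a (id_ctx \<Delta>)" "X = mkcell \<Gamma> \<Delta> a" using cell_cases[OF X] .
  note s = seq_src[OF a(3)] and t = seq_tgt[OF a(3)] and i = hom_id[OF canon_ctx[OF a(1)]] hom_id[OF canon_ctx[OF a(2)]]
  note ends = a(4) cell_src[OF a(3)] cell_tgt[OF a(3)] arr_dom[OF s] arr_dom[OF t] arr_cod[OF s] arr_cod[OF t]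
  show "arr_dom (cell_src X) = arr_dom (cell_tgt X) \<and> arr_cod (cell_src X) = arr_cod (cell_tgt X)"
    by (simp add: ends)
  have l: "mkcell \<Gamma> \<Delta> (hc \<Gamma> \<Delta> (idc \<Gamma> Var) a) = mkcell \<Gamma> \<Delta> a"
    using mkcell_congI[OF hc_idc_right[OF i(1) a(3)]] by simp
  show "hcmp X (vide (arr_id S (arr_dom (cell_src X)))) = X"
    by (simp add: ends arr_id canon_ctx a(1) vide[OF a(1,1) i(1)] hcmp[OF a(1,1,2) seq_idc[OF i(1)] a(3)] l)
  have r: "mkcell \<Gamma> \<Delta> (hc \<Delta> \<Delta> a (idc \<Delta> Var)) = mkcell \<Gamma> \<Delta> a"
    using mkcell_congI[OF hc_dg_left[OF a(3)]] by (simp add: idc_Var)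
  show "hcmp (vide (arr_id S (arr_cod (cell_src X)))) X = X"
    by (simp add: ends arr_id canon_ctx a(2) vide[OF a(2,2) i(2)] hcmp[OF a(1,2,2,3) seq_idc[OF i(2)]] r)
  note v = vinv[OF a(3)]
  have 1: "seq \<Gamma> (tgt \<Delta> a) (src \<Delta> (vinv \<Delta> a)) \<Delta>" using t by (simp add: v(2))
  have "vcmp (mkcell \<Gamma> \<Delta> (vinv \<Delta> a)) X = vide (cell_src X)" "vcmp X (mkcell \<Gamma> \<Delta> (vinv \<Delta> a)) = vide (cell_tgt X)"
    by (simp_all add: ends vide[OF a(1,2) s] vide[OF a(1,2) t] vcmp[OF a(1-3) v(1) 1] vcmp[OF a(1,2) v(1) a(3) v(3)]
      mkcell_congI[OF v(4)] mkcell_congI[OF v(5)])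
  then show "\<exists>Y\<in>two_cells S. cell_src Y = cell_tgt X \<and> cell_tgt Y = cell_src X \<and> vcmp Y X = vide (cell_src X) \<and> vcmp X Y = vide (cell_tgt X)"
    by (intro bexI[of _ "mkcell \<Gamma> \<Delta> (vinv \<Delta> a)"])
      (simp_all add: ends mkcell_two_cells[OF v(1)] cell_src[OF v(1)] cell_tgt[OF v(1)] v(2) mkmor_congI[OF v(3)])
next
  fix X Y assume XY: "X \<in> two_cells S" "Y \<in> two_cells S" "arr_dom (cell_src Y) = arr_cod (cell_src X)"
  then show "hcmp Y X \<in> two_cells S \<and> cell_src (hcmp Y X) = arr_comp S (cell_src Y) (cell_src X) \<and>
    cell_tgt (hcmp Y X) = arr_comp S (cell_tgt Y) (cell_tgt X)"
  proof (rule hcomposable_cases)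
    fix \<Gamma> \<Delta> \<Theta> a b assume h: "canon \<Gamma>" "canon \<Delta>" "canon \<Theta>" "hom \<Gamma> a (id_ctx \<Delta>)" "hom \<Delta> b (id_ctx \<Theta>)"
      "X = mkcell \<Gamma> \<Delta> a" "Y = mkcell \<Delta> \<Theta> b"
    note ab = seq_hc[OF h(4,5)]
    show ?thesis
      by (simp add: h(6,7) hcmp[OF h(1-5)] mkcell_two_cells[OF ab] cell_src[OF ab] cell_tgt[OF ab]
        cell_src[OF h(4)] cell_src[OF h(5)] cell_tgt[OF h(4)] cell_tgt[OF h(5)]
        arr_comp[OF seq_src[OF h(4)] seq_src[OF h(5)]] arr_comp[OF seq_tgt[OF h(4)] seq_tgt[OF h(5)]]
        src_hc[OF h(5)] mkmor_congI[OF tgt_hc[OF h(4,5)]])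
  qed
  fix Z assume Z: "Z \<in> two_cells S" "arr_dom (cell_src Z) = arr_cod (cell_src Y)"
  show "hcmp Z (hcmp Y X) = hcmp (hcmp Z Y) X"
    using XY
  proof (rule hcomposable_cases)
    fix \<Gamma> \<Delta> \<Theta> a b assume h: "canon \<Gamma>" "canon \<Delta>" "canon \<Theta>" "hom \<Gamma> a (id_ctx \<Delta>)" "hom \<Delta> b (id_ctx \<Theta>)"
      "X = mkcell \<Gamma> \<Delta> a" "Y = mkcell \<Delta> \<Theta> b"
    obtain \<Theta>' \<Psi> c where c: "canon \<Theta>'" "canon \<Psi>" "hom \<Theta>' c (id_ctx \<Psi>)" "Z = mkcell \<Theta>' \<Psi> c" using cell_cases[OF Z(1)] .
    have "\<Theta>' = \<Theta>"
      using Z(2) by (intro mkob_canon_eq[OF c(1) h(3)])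
        (simp add: c(4) h(7) cell_src[OF c(3)] cell_src[OF h(5)] arr_dom[OF seq_src[OF c(3)]] arr_cod[OF seq_src[OF h(5)]])
    then have c: "canon \<Psi>" "hom \<Theta> c (id_ctx \<Psi>)" "Z = mkcell \<Theta> \<Psi> c" using c by auto
    show ?thesis
      by (simp add: h(6,7) c(3) hcmp[OF h(1-5)] hcmp[OF h(2,3) c(1) h(5) c(2)] hcmp[OF h(1,3) c(1) seq_hc[OF h(4,5)] c(2)]
        hcmp[OF h(1,2) c(1) h(4) seq_hc[OF h(5) c(2)]] mkcell_congI[OF hc_assoc[OF h(4,5) c(2)]])
  qed
next
  fix F G assume FG: "F \<in> arrows S" "G \<in> arrows S" "arr_dom G = arr_cod F"
  then show "hcmp (vide G) (vide F) = vide (arr_comp S G F)"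
  proof (rule composable_cases)
    fix \<Gamma> \<Delta> \<Theta> f g assume h: "canon \<Gamma>" "canon \<Delta>" "canon \<Theta>" "hom \<Gamma> f \<Delta>" "hom \<Delta> g \<Theta>"
      "F = mkmor \<Gamma> f \<Delta>" "G = mkmor \<Delta> g \<Theta>"
    have "mkcell \<Gamma> \<Theta> (hc \<Delta> \<Theta> (idc \<Delta> f) (idc \<Theta> g)) = mkcell \<Gamma> \<Theta> (idc \<Theta> (\<lambda>i. subst f (g i)))"
      using mkcell_congI[OF hc_idc_right[OF h(4) seq_idc[OF h(5)]]] by (simp add: idc_subst)
    then show ?thesis
      by (simp add: h(6,7) vide[OF h(1,2,4)] vide[OF h(2,3,5)] arr_comp[OF h(4,5)] vide[OF h(1,3) seq_comp[OF h(4,5)]]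
        hcmp[OF h(1-3) seq_idc[OF h(4)] seq_idc[OF h(5)]])
  qed
next
  fix X X' Y Y' assume T: "X \<in> two_cells S" "X' \<in> two_cells S" "Y \<in> two_cells S" "Y' \<in> two_cells S"
    and st: "cell_src X' = cell_tgt X" "cell_src Y' = cell_tgt Y" and YX: "arr_dom (cell_src Y) = arr_cod (cell_src X)"
  from T(1,2) st(1) show "hcmp (vcmp Y' Y) (vcmp X' X) = vcmp (hcmp Y' X') (hcmp Y X)"
  proof (rule vcomposable_cases)
    fix \<Gamma> \<Delta> a a' assume a: "canon \<Gamma>" "canon \<Delta>" "hom \<Gamma> a (id_ctx \<Delta>)" "hom \<Gamma> a' (id_ctx \<Delta>)"
      "X = mkcell \<Gamma> \<Delta> a" "X' = mkcell \<Gamma> \<Delta> a'" "seq \<Gamma> (tgt \<Delta> a) (src \<Delta> a') \<Delta>"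
    from T(3,4) st(2) show ?thesis
    proof (rule vcomposable_cases)
      fix \<Delta>' \<Theta> b b' assume b: "canon \<Delta>'" "canon \<Theta>" "hom \<Delta>' b (id_ctx \<Theta>)" "hom \<Delta>' b' (id_ctx \<Theta>)"
        "Y = mkcell \<Delta>' \<Theta> b" "Y' = mkcell \<Delta>' \<Theta> b'" "seq \<Delta>' (tgt \<Theta> b) (src \<Theta> b') \<Theta>"
      have "\<Delta>' = \<Delta>"
        using YX by (intro mkob_canon_eq[OF b(1) a(2)])
          (simp add: a(5) b(5) cell_src[OF a(3)] cell_src[OF b(3)] arr_dom[OF seq_src[OF b(3)]] arr_cod[OF seq_src[OF a(3)]])
      note b = b[unfolded this]
      \<comment> \<open>The two horizontal composites must be vertically composable before
        \<open>vcmp\<close> can be evaluated on them.\<close>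
      have ab: "seq \<Gamma> (tgt \<Theta> (hc \<Delta> \<Theta> a b)) (src \<Theta> (hc \<Delta> \<Theta> a' b')) \<Theta>"
        using seq_trans[OF tgt_hc[OF a(3) b(3)] seq_comp[OF a(7) b(7)]] by (simp add: src_hc[OF b(4)])
      show ?thesis
        by (simp add: a(5,6) b(5,6) vcmp[OF a(1-4,7)] vcmp[OF b(1-4,7)] hcmp[OF a(1,2) b(2) a(3) b(3)]
          hcmp[OF a(1,2) b(2) a(4) b(4)] hcmp[OF a(1,2) b(2) seq_vc[OF a(3,4,7)] seq_vc[OF b(3,4,7)]]
          vcmp[OF a(1) b(2) seq_hc[OF a(3) b(3)] seq_hc[OF a(4) b(4)] ab]
          mkcell_congI[OF vc_hc_interchange[OF a(3,4) b(3,4) a(7) b(7)]])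
    qed
  qed
qed

end

theorem corollary3p3p3:
  fixes S :: "'f judgements"
  assumes "discrete_identity_type_theory S"
  shows "\<exists>vide vcmp hcmp.
    locally_groupoidal_two_category
      (objects S) (arrows S) arr_dom arr_cod (arr_id S) (arr_comp S)
      (two_cells S) cell_src cell_tgt vide vcmp hcmp"
  using discrete_identity_type_theory.contexts_two_category[OF assms] by blast

end
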